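(* Let $b_i\in C^1(\mathbb{R}^N)$ for $i=1,\dots,N$, and suppose that $L=\Delta_k+b\cdot\nabla_k$ generates a Markov semigroup $(P_t)_{t\ge0}$ on $C_b(\mathbb{R}^N)$. Let $\gamma<\frac12$. Assume that there exists $\eta<0$ such that $$\tilde\Gamma(P_tf)\le e^{2\eta t}P_t(\tilde\Gamma(f))$$ for all $t>0$ and all $f\in C_b(\mathbb{R}^N)\cap C^1(\mathbb{R}^N)$ with $\tilde\Gamma(f)$ bounded. Moreover, assume that there exists a Lyapunov function $\rho$ for $L$. Then there exist a sequence of times $(t_l)_{l\ge0}$ with $t_l\to\infty$ and a probability measure $\nu$ on $\mathbb{R}^N$ such that for all bounded continuous $f$ on $\mathbb{R}^N$ and all $x\in\mathbb{R}^N$ with $\rho(x)\neq\infty$, $$P_{t_l}f(x)\to\int f\,\mathrm{d}\nu\qquad\text{as }l\to\infty .$$ Additionally, the measure $\nu$ is invariant for the Markov semigroup $(P_t)_{t\ge0}$.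
   Context: A root system is a finite set $R\subset\mathbb{R}^N\setminus\{0\}$ with $R\cap\alpha\mathbb{R}=\{-\alpha,\alpha\}$ and $\sigma_\alpha(R)=R$ for all $\alpha\in R$, where $\sigma_\alpha x=x-2\frac{\langle\alpha,x\rangle}{\langle\alpha,\alpha\rangle}\alpha$ is the reflection in the hyperplane orthogonal to $\alpha$. $G$ is the finite group generated by the reflections $\sigma_\alpha$, $\alpha\in R$. Throughout, fix a root system $R$ normalised by $|\alpha|^2=2$ for all $\alpha\in R$, a positive subsystem $R_+$ (so $R=R_+\cup(-R_+)$ is a disjoint union with $R_+$ and $-R_+$ on different sides of a hyperplane through the origin), and a function $k:R\to[0,\infty)$, $\alpha\mapsto k_\alpha$, with $k_{g\alpha}=k_\alpha$ for all $g\in G$. Put $\gamma:=\sum_{\alpha\in R_+}k_\alpha$. The Dunkl operators are, for $i=1,\dots,N$, $$T_if(x)=\partial_if(x)+\sum_{\alpha\in R_+}k_\alpha\alpha_i\frac{f(x)-f(\sigma_\alpha x)}{\langle\alpha,x\rangle},$$ where difference quotients at points with $\langle\alpha,x\rangle=0$ are understood by their continuous extension. The Dunkl gradient is $\nabla_k=(T_1,\dots,T_N)$ and the Dunkl laplacian is $\Delta_k=\sum_{i=1}^NT_i^2$. Thus $Lf=\Delta_kf+\sum_{i=1}^N b_iT_if$. The symmetrised gradient form is $\tilde\Gamma(f)(x):=\sum_{g\in G}|\nabla_kf(gx)|^2$. $C_b(\mathbb{R}^N)$ is the space of bounded continuous functions. A smooth function $\rho:\mathbb{R}^N\to[0,\infty]$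 is a Lyapunov function for $L$ if: (i) $\rho^{-1}([0,\infty))\ne\emptyset$; (ii) for any $M>0$ the level set $\{x\in\mathbb{R}^N:\rho(x)\le M\}$ is compact; (iii) there exist positive constants $C_1,C_2$, with $C_2\neq0$, such that $L\rho(x)\le C_1-C_2\rho(x)$ for all $x$ with $\rho(x)\ne\infty$. A probability measure $\nu$ is invariant for $(P_t)$ if $\int P_tf\,\mathrm{d}\nu=\int f\,\mathrm{d}\nu$ for all $t\geq 0$ and all bounded continuous $f$. *)

theory Defs
  imports "HOL-Probability.Probability"
begin

section \<open>Root systems\<close>

definition reflection :: "real ^ 'n \<Rightarrow> real ^ 'n \<Rightarrow> real ^ 'n" where
  "reflection \<alpha> x = x - (2 * (\<alpha> \<bullet> x) / (\<alpha> \<bullet> \<alpha>)) *\<^sub>R \<alpha>"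

definition root_system :: "(real ^ 'n) set \<Rightarrow> bool" where
  "root_system R \<longleftrightarrow> finite R \<and> 0 \<notin> R \<and>
     (\<forall>\<alpha>\<in>R. R \<inter> range (\<lambda>c. c *\<^sub>R \<alpha>) = {- \<alpha>, \<alpha>} \<and> reflection \<alpha> ` R = R)"

definition normalised :: "(real ^ 'n) set \<Rightarrow> bool" where
  "normalised R \<longleftrightarrow> (\<forall>\<alpha>\<in>R. (norm \<alpha>)\<^sup>2 = 2)"

definition positive_subsystem :: "(real ^ 'n) set \<Rightarrow> (real ^ 'n) set \<Rightarrow> bool" where
  "positive_subsystem R Rp \<longleftrightarrow> R = Rp \<union> uminus ` Rp \<and> Rp \<inter> uminus ` Rp = {} \<and>
     (\<exists>u. u \<noteq> 0 \<and> (\<forall>\<alpha>\<in>Rp. 0 < u \<bullet> \<alpha>) \<and> (\<forall>\<alpha>\<in>uminus ` Rp. u \<bullet> \<alpha> < 0))"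

text \<open>The generators are involutions, so closure under composition already yields a group.\<close>

inductive_set reflection_group :: "(real ^ 'n) set \<Rightarrow> (real ^ 'n \<Rightarrow> real ^ 'n) set"
  for R :: "(real ^ 'n) set" where
  id: "id \<in> reflection_group R"
| comp: "\<alpha> \<in> R \<Longrightarrow> g \<in> reflection_group R \<Longrightarrow> reflection \<alpha> \<circ> g \<in> reflection_group R"

definition multiplicity_function :: "(real ^ 'n) set \<Rightarrow> (real ^ 'n \<Rightarrow> real) \<Rightarrow> bool" where
  "multiplicity_function R k \<longleftrightarrow>
     (\<forall>\<alpha>\<in>R. 0 \<le> k \<alpha>) \<and> (\<forall>g\<in>reflection_group R. \<forall>\<alpha>\<in>R. k (g \<alpha>) = k \<alpha>)"

section \<open>Differentiability classes\<close>

text \<open>Only used for open \<open>S\<close>, where it is the usual class \<open>C\<^sup>n(S)\<close>.\<close>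

primrec Ck_on :: "nat \<Rightarrow> (real ^ 'n) set \<Rightarrow> (real ^ 'n \<Rightarrow> real) \<Rightarrow> bool" where
  "Ck_on 0 S f \<longleftrightarrow> continuous_on S f"
| "Ck_on (Suc n) S f \<longleftrightarrow> (\<forall>x\<in>S. f differentiable (at x)) \<and>
     (\<forall>v. Ck_on n S (\<lambda>x. frechet_derivative f (at x) v))"

definition smooth_on :: "(real ^ 'n) set \<Rightarrow> (real ^ 'n \<Rightarrow> real) \<Rightarrow> bool" where
  "smooth_on S f \<longleftrightarrow> (\<forall>n. Ck_on n S f)"

section \<open>Dunkl operators\<close>

definition dunkl_quotient :: "real ^ 'n \<Rightarrow> (real ^ 'n \<Rightarrow> real) \<Rightarrow> real ^ 'n \<Rightarrow> real" where
  "dunkl_quotient \<alpha> f x =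
     (if \<alpha> \<bullet> x \<noteq> 0 then (f x - f (reflection \<alpha> x)) / (\<alpha> \<bullet> x)
      else Lim (at x within {y. \<alpha> \<bullet> y \<noteq> 0}) (\<lambda>y. (f y - f (reflection \<alpha> y)) / (\<alpha> \<bullet> y)))"

definition dunkl_op ::
  "(real ^ 'n) set \<Rightarrow> (real ^ 'n \<Rightarrow> real) \<Rightarrow> 'n \<Rightarrow> (real ^ 'n \<Rightarrow> real) \<Rightarrow> real ^ 'n \<Rightarrow> real" where
  "dunkl_op Rp k i f x = frechet_derivative f (at x) (axis i 1) +
     (\<Sum>\<alpha>\<in>Rp. k \<alpha> * \<alpha> $ i * dunkl_quotient \<alpha> f x)"

definition dunkl_gradient ::
  "(real ^ 'n) set \<Rightarrow> (real ^ 'n \<Rightarrow> real) \<Rightarrow> (real ^ 'n \<Rightarrow> real) \<Rightarrow> real ^ 'n \<Rightarrow> real ^ 'n" where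
  "dunkl_gradient Rp k f x = (\<chi> i. dunkl_op Rp k i f x)"

definition dunkl_laplacian ::
  "(real ^ 'n) set \<Rightarrow> (real ^ 'n \<Rightarrow> real) \<Rightarrow> (real ^ 'n \<Rightarrow> real) \<Rightarrow> real ^ 'n \<Rightarrow> real" where
  "dunkl_laplacian Rp k f x = (\<Sum>i\<in>UNIV. dunkl_op Rp k i (dunkl_op Rp k i f) x)"

definition dunkl_L ::
  "(real ^ 'n) set \<Rightarrow> (real ^ 'n \<Rightarrow> real) \<Rightarrow> (real ^ 'n \<Rightarrow> real ^ 'n) \<Rightarrow>
     (real ^ 'n \<Rightarrow> real) \<Rightarrow> real ^ 'n \<Rightarrow> real" where
  "dunkl_L Rp k b f x = dunkl_laplacian Rp k f x + b x \<bullet> dunkl_gradient Rp k f x"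

definition sym_Gamma ::
  "(real ^ 'n) set \<Rightarrow> (real ^ 'n) set \<Rightarrow> (real ^ 'n \<Rightarrow> real) \<Rightarrow>
     (real ^ 'n \<Rightarrow> real) \<Rightarrow> real ^ 'n \<Rightarrow> real" where
  "sym_Gamma R Rp k f x = (\<Sum>g\<in>reflection_group R. (norm (dunkl_gradient Rp k f (g x)))\<^sup>2)"

section \<open>Markov semigroups on bounded continuous functions\<close>

text \<open>Continuity in time is only required pointwise: semigroups such as the heat semigroup are
  not strongly continuous for the supremum norm on all bounded continuous functions.\<close>

definition markov_semigroup ::
  "(real \<Rightarrow> ((real ^ 'n) \<Rightarrow>\<^sub>C real) \<Rightarrow> ((real ^ 'n) \<Rightarrow>\<^sub>C real)) \<Rightarrow> bool" where
  "markov_semigroup P \<longleftrightarrow>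
     (\<forall>t\<ge>0. linear (P t)) \<and>
     P 0 = id \<and> (\<forall>s\<ge>0. \<forall>t\<ge>0. P (s + t) = P s \<circ> P t) \<and>
     (\<forall>t\<ge>0. P t (const_bcontfun 1) = const_bcontfun 1) \<and>
     (\<forall>t\<ge>0. \<forall>f. (\<forall>x. 0 \<le> apply_bcontfun f x) \<longrightarrow> (\<forall>x. 0 \<le> apply_bcontfun (P t f) x)) \<and>
     (\<forall>f x. continuous_on {0..} (\<lambda>t. apply_bcontfun (P t f) x))"

text \<open>The graph of the infinitesimal generator; the limit is taken in the supremum norm.\<close>

definition generator_graph ::
  "(real \<Rightarrow> ((real ^ 'n) \<Rightarrow>\<^sub>C real) \<Rightarrow> ((real ^ 'n) \<Rightarrow>\<^sub>C real)) \<Rightarrow>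
     (((real ^ 'n) \<Rightarrow>\<^sub>C real) \<times> ((real ^ 'n) \<Rightarrow>\<^sub>C real)) set" where
  "generator_graph P = {(f, g). ((\<lambda>t. (P t f - f) /\<^sub>R t) \<longlongrightarrow> g) (at_right 0)}"

text \<open>An operator \<open>A\<close>, defined classically on smooth functions, generates \<open>P\<close> if the generator of
  \<open>P\<close> extends \<open>A\<close> from the smooth compactly supported functions. No core property is required.\<close>

definition generates ::
  "((real ^ 'n \<Rightarrow> real) \<Rightarrow> real ^ 'n \<Rightarrow> real) \<Rightarrow>
     (real \<Rightarrow> ((real ^ 'n) \<Rightarrow>\<^sub>C real) \<Rightarrow> ((real ^ 'n) \<Rightarrow>\<^sub>C real)) \<Rightarrow> bool" where
  "generates A P \<longleftrightarrow> markov_semigroup P \<and>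
     (\<forall>f. smooth_on UNIV (apply_bcontfun f) \<and> compact (closure {x. apply_bcontfun f x \<noteq> 0}) \<longrightarrow>
        (\<exists>g. (f, g) \<in> generator_graph P \<and> (\<forall>x. apply_bcontfun g x = A (apply_bcontfun f) x)))"

definition invariant_measure ::
  "(real ^ 'n) measure \<Rightarrow> (real \<Rightarrow> ((real ^ 'n) \<Rightarrow>\<^sub>C real) \<Rightarrow> ((real ^ 'n) \<Rightarrow>\<^sub>C real)) \<Rightarrow> bool" where
  "invariant_measure \<nu> P \<longleftrightarrow>
     (\<forall>t\<ge>0. \<forall>f. (\<integral>x. apply_bcontfun (P t f) x \<partial>\<nu>) = (\<integral>x. apply_bcontfun f x \<partial>\<nu>))"

section \<open>Lyapunov functions\<close>

text \<open>Smoothness of a \<open>[0,\<infinity>]\<close>-valued function means continuity into \<open>[0,\<infinity>]\<close> together with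
  smoothness on the (then open) set where it is finite. The third conjunct says that
  \<open>L \<rho> x\<close> is meaningful wherever \<open>\<rho> x\<close> is finite: \<open>L \<rho> x\<close> contains the values of \<open>\<rho>\<close> at the
  images of \<open>x\<close> under the reflections with nonzero multiplicity, and \<open>enn2real\<close> would turn an
  infinite value into \<open>0\<close>.\<close>

definition lyapunov_function ::
  "(real ^ 'n) set \<Rightarrow> (real ^ 'n \<Rightarrow> real) \<Rightarrow> (real ^ 'n \<Rightarrow> real ^ 'n) \<Rightarrow>
     (real ^ 'n \<Rightarrow> ennreal) \<Rightarrow> bool" where
  "lyapunov_function Rp k b \<rho> \<longleftrightarrow>
     continuous_on UNIV \<rho> \<and>
     smooth_on {x. \<rho> x \<noteq> \<infinity>} (\<lambda>x. enn2real (\<rho> x)) \<and>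
     (\<forall>x. \<rho> x \<noteq> \<infinity> \<longrightarrow> (\<forall>\<alpha>\<in>Rp. k \<alpha> \<noteq> 0 \<longrightarrow> \<rho> (reflection \<alpha> x) \<noteq> \<infinity>)) \<and>
     (\<exists>x. \<rho> x \<noteq> \<infinity>) \<and>
     (\<forall>M>0. compact {x. \<rho> x \<le> ennreal M}) \<and>
     (\<exists>C1>0. \<exists>C2>0. \<forall>x. \<rho> x \<noteq> \<infinity> \<longrightarrow>
        dunkl_L Rp k b (\<lambda>y. enn2real (\<rho> y)) x \<le> C1 - C2 * enn2real (\<rho> x))"

end

theory Submission
  imports Defs
begin

text \<open>If \<open>f\<close> is \<open>C\<^sup>1\<close> with bounded derivative, the gradient bound gives
  \<open>\<bar>\<nabla>\<^sub>k P\<^sub>t f\<bar> \<le> c e\<^sup>\<eta>\<^sup>t\<close>. On a ball centred at the origin the reflection part of \<open>\<nabla>\<^sub>k u\<close> is at most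
  \<open>2 \<gamma> sup \<bar>\<nabla> u\<bar>\<close>, so \<open>\<gamma> < 1/2\<close> turns this into an ordinary Lipschitz bound: \<open>P\<^sub>t f\<close> becomes constant
  on compact sets at an exponential rate.

  The Lyapunov function makes the functionals \<open>f \<mapsto> P\<^sub>t f x\<close> tight uniformly in \<open>t\<close>. For a concave truncation
  \<open>\<phi>\<close> the positive maximum principle gives \<open>L (\<phi> \<circ> \<rho>) \<le> \<phi>' (\<rho>) L \<rho>\<close>. Truncating \<open>\<rho>\<close> itself yields a bound
  linear in \<open>t\<close>; with it the truncation error in Gronwall's inequality for \<open>sqrt (1 + \<rho>)\<close> vanishes in the limit,
  and that inequality is uniform in \<open>t\<close>.

  Together these make \<open>P\<^sub>t f x\<close> Cauchy as \<open>t \<rightarrow> \<infinity>\<close>, with a limit independent of \<open>x\<close>, for every bounded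
  continuous \<open>f\<close>. By tightness the limit functional is continuous along decreasing sequences, so it is integration
  against a probability measure, and the semigroup property makes that measure invariant.\<close>

section \<open>Daniell means on bounded continuous functions\<close>

text \<open>The generator is known only on smooth compactly supported functions, so \<rho> itself is
  never admissible: every estimate uses test functions that are constant beyond a level M. There the
  drift \<open>- C2 * \<rho>\<close> is lost, exactly where it is wanted. The square root makes the
  loss affordable: at a value p above M the missing drift is of order \<open>sqrt p\<close>, at most
  \<open>p / sqrt M\<close>, and p has semigroup average at most \<rho> x + C1 T up to time T. With
  T fixed the error disappears as M grows, and only afterwards is T varied.

  A bound independent of time is essential because P(s+t) f x is read as P(s) applied to P(t) f: the
  inner function is close to a constant only on compact sets, while s is arbitrary.

  The threshold 1/2 comes from the normalisation: a root contributes its length once through the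
  mean value of the difference quotient and once as a vector, hence the factor 2 in 2 \<gamma>.

  The values converge along all integers, so the times are explicit and no subsequence of measures
  is extracted; the measure is recovered from the limiting functional.\<close>

lemma bcontfun_real_iff:
  fixes f :: "'a::topological_space \<Rightarrow> real"
  shows "f \<in> bcontfun \<longleftrightarrow> continuous_on UNIV f \<and> (\<exists>B. \<forall>x. \<bar>f x\<bar> \<le> B)"
  by (auto simp: bcontfun_def bounded_iff)

lemma bcontfun_real_I:
  fixes f :: "'a::topological_space \<Rightarrow> real"
  assumes "continuous_on UNIV f" "\<And>x. 0 \<le> f x" "\<And>x. f x \<le> B"
  shows "f \<in> bcontfun"
  using assms by (auto simp: bcontfun_real_iff intro!: exI[of _ B])

lemma bcontfun_const: "(\<lambda>_. c::real) \<in> bcontfun"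
  by (rule const_bcontfun)

lemma bcontfun_add: "f \<in> bcontfun \<Longrightarrow> g \<in> bcontfun \<Longrightarrow> (\<lambda>x. f x + g x :: real) \<in> bcontfun"
  by (rule plus_cont)

lemma bcontfun_diff: "f \<in> bcontfun \<Longrightarrow> g \<in> bcontfun \<Longrightarrow> (\<lambda>x. f x - g x :: real) \<in> bcontfun"
  by (rule minus_cont)

lemma bcontfun_cmult: "f \<in> bcontfun \<Longrightarrow> (\<lambda>x. c * f x :: real) \<in> bcontfun"
  using scaleR_cont[of f c] by simp

lemma bcontfun_abs: "f \<in> bcontfun \<Longrightarrow> (\<lambda>x. \<bar>f x\<bar> :: real) \<in> bcontfun"
  by (auto simp: bcontfun_real_iff intro: continuous_intros)

lemma bcontfun_sum:
  "(\<And>i. i \<in> I \<Longrightarrow> f i \<in> bcontfun) \<Longrightarrow> (\<lambda>x. \<Sum>i\<in>I. f i x :: real) \<in> bcontfun"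
  by (induction I rule: infinite_finite_induct) (auto intro: bcontfun_const bcontfun_add)

lemma bcontfun_min:
  assumes "f \<in> bcontfun" "g \<in> bcontfun"
  shows "(\<lambda>x. min (f x) (g x) :: real) \<in> bcontfun"
proof -
  have *: "(\<lambda>x. min (f x) (g x)) = (\<lambda>x. 1/2 * ((f x + g x) - \<bar>f x - g x\<bar>))"
    by (auto simp: min_def field_simps)
  show ?thesis
    unfolding * by (intro bcontfun_cmult bcontfun_add bcontfun_diff bcontfun_abs assms)
qed

lemma bcontfun_max:
  assumes "f \<in> bcontfun" "g \<in> bcontfun"
  shows "(\<lambda>x. max (f x) (g x) :: real) \<in> bcontfun"
proof -
  have *: "(\<lambda>x. max (f x) (g x)) = (\<lambda>x. 1/2 * ((f x + g x) + \<bar>f x - g x\<bar>))"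
    by (auto simp: max_def field_simps)
  show ?thesis
    unfolding * by (intro bcontfun_cmult bcontfun_add bcontfun_diff bcontfun_abs assms)
qed

text \<open>The case distinction is needed because \<open>infdist x {} = 0\<close>.\<close>

definition open_bump :: "'a::metric_space set \<Rightarrow> nat \<Rightarrow> 'a \<Rightarrow> real" where
  "open_bump U n x = (if U = UNIV then 1 else min 1 (real n * infdist x (- U)))"

lemma open_bump_bounds: "0 \<le> open_bump U n x" "open_bump U n x \<le> 1"
  by (auto simp: open_bump_def infdist_nonneg)

lemma open_bump_outside: "x \<notin> U \<Longrightarrow> open_bump U n x = 0"
  by (auto simp: open_bump_def)

lemma open_bump_bcontfun: "open_bump U n \<in> bcontfun"
proof -
  have "continuous_on UNIV (\<lambda>x. open_bump U n x)"
    unfolding open_bump_def by (cases "U = UNIV") (auto intro!: continuous_intros)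
  then show ?thesis
    by (rule bcontfun_real_I[where B=1]) (auto simp: open_bump_bounds)
qed

lemma open_bump_mono: "n \<le> m \<Longrightarrow> open_bump U n x \<le> open_bump U m x"
  by (auto simp: open_bump_def min_le_iff_disj infdist_nonneg mult_right_mono)

lemma open_bump_inside:
  assumes "open U" "x \<in> U"
  obtains N where "\<And>n. n \<ge> N \<Longrightarrow> open_bump U n x = 1"
proof (cases "U = UNIV")
  case True
  then show ?thesis using that by (auto simp: open_bump_def)
next
  case False
  have "infdist x (- U) > 0"
    using assms False by (intro infdist_pos_not_in_closed) auto
  then obtain N where N: "1 < real N * infdist x (- U)"
    using reals_Archimedean3 by blast
  show ?thesis
  proof (rule that[of N])
    fix n assume "n \<ge> N"
    then have "real N * infdist x (- U) \<le> real n * infdist x (- U)"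
      by (intro mult_right_mono) (auto simp: infdist_nonneg)
    then show "open_bump U n x = 1"
      using N False by (simp add: open_bump_def)
  qed
qed

text \<open>The functional accepts all functions but is constrained only on \<open>bcontfun\<close>,
  so a limit of semigroup values can be inserted directly. Continuity along sequences decreasing to
  zero is the axiom that yields countable additivity; it takes the place of compact supports in the
  Riesz theorem.\<close>

locale daniell_mean =
  fixes \<Lambda> :: "('a::metric_space \<Rightarrow> real) \<Rightarrow> real"
  assumes add: "f \<in> bcontfun \<Longrightarrow> g \<in> bcontfun \<Longrightarrow> \<Lambda> (\<lambda>x. f x + g x) = \<Lambda> f + \<Lambda> g"
    and cmult: "f \<in> bcontfun \<Longrightarrow> \<Lambda> (\<lambda>x. c * f x) = c * \<Lambda> f"
    and mono: "f \<in> bcontfun \<Longrightarrow> g \<in> bcontfun \<Longrightarrow> (\<And>x. f x \<le> g x) \<Longrightarrow> \<Lambda> f \<le> \<Lambda> g"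
    and one: "\<Lambda> (\<lambda>_. 1) = 1"
    and daniell: "(\<And>n. h n \<in> bcontfun) \<Longrightarrow> (\<And>n x. h (Suc n) x \<le> h n x) \<Longrightarrow>
      (\<And>x. (\<lambda>n. h n x) \<longlonglongrightarrow> 0) \<Longrightarrow> (\<lambda>n. \<Lambda> (h n)) \<longlonglongrightarrow> 0"
begin

lemma const: "\<Lambda> (\<lambda>_. c) = c"
  using cmult[of "\<lambda>_. 1" c] one by (simp add: bcontfun_const)

lemma diff: "f \<in> bcontfun \<Longrightarrow> g \<in> bcontfun \<Longrightarrow> \<Lambda> (\<lambda>x. f x - g x) = \<Lambda> f - \<Lambda> g"
  using add[of f "\<lambda>x. (-1) * g x"] cmult[of g "-1"] bcontfun_cmult[of g "-1"] by simp

lemma sum: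
  "(\<And>i. i \<in> I \<Longrightarrow> f i \<in> bcontfun) \<Longrightarrow> \<Lambda> (\<lambda>x. \<Sum>i\<in>I. f i x) = (\<Sum>i\<in>I. \<Lambda> (f i))"
  by (induction I rule: infinite_finite_induct) (auto simp: const add bcontfun_sum)

lemma nonneg: "f \<in> bcontfun \<Longrightarrow> (\<And>x. 0 \<le> f x) \<Longrightarrow> 0 \<le> \<Lambda> f"
  using mono[of "\<lambda>_. 0" f] by (simp add: const bcontfun_const)

section \<open>The outer measure attached to a Daniell mean\<close>

definition below :: "'a set \<Rightarrow> ('a \<Rightarrow> real) set" where
  "below U = {f \<in> bcontfun. \<forall>x. 0 \<le> f x \<and> f x \<le> indicator U x}"

definition content :: "'a set \<Rightarrow> ennreal" where
  "content U = (SUP f\<in>below U. ennreal (\<Lambda> f))"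

text \<open>Open sets are measured from inside by test functions and all other sets from outside by
  open sets, so outer regularity holds by construction.\<close>

definition outer :: "'a set \<Rightarrow> ennreal" where
  "outer A = (INF U\<in>{U. open U \<and> A \<subseteq> U}. content U)"

lemma belowD:
  assumes "f \<in> below U"
  shows "f \<in> bcontfun" "0 \<le> f x" "f x \<le> 1" "x \<notin> U \<Longrightarrow> f x = 0"
proof -
  show "f \<in> bcontfun" "0 \<le> f x" using assms by (auto simp: below_def)
  have *: "0 \<le> f x" "f x \<le> indicator U x" using assms by (auto simp: below_def)
  show "f x \<le> 1" using *(2) by (rule order_trans) (auto simp: indicator_def)
  show "f x = 0" if "x \<notin> U" using * that by simp
qed

lemma belowI:
  assumes "f \<in> bcontfun" "\<And>x. 0 \<le> f x" "\<And>x. f x \<le> 1" "\<And>x. x \<notin> U \<Longrightarrow> f x = 0"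
  shows "f \<in> below U"
  unfolding below_def using assms by (auto simp: indicator_def)

lemma content_upper: "f \<in> below U \<Longrightarrow> ennreal (\<Lambda> f) \<le> content U"
  unfolding content_def by (rule SUP_upper)

lemma zero_below: "(\<lambda>_. 0) \<in> below U"
  by (auto intro!: belowI bcontfun_const)

lemma content_mono: "U \<subseteq> V \<Longrightarrow> content U \<le> content V"
  unfolding content_def by (rule SUP_subset_mono) (auto intro!: belowI dest: belowD)

lemma content_empty: "content {} = 0"
proof -
  have "ennreal (\<Lambda> f) \<le> 0" if "f \<in> below {}" for f
  proof -
    have "f = (\<lambda>_. 0)" using belowD(4)[OF that] by auto
    then show ?thesis by (simp add: const)
  qed
  then show ?thesis
    unfolding content_def by (metis SUP_least bot.extremum_uniqueI bot_ennreal)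
qed

lemma content_UNIV: "content UNIV = 1"
proof (rule antisym)
  show "content UNIV \<le> 1"
    unfolding content_def
  proof (rule SUP_least)
    fix f assume f: "f \<in> below UNIV"
    have "\<Lambda> f \<le> \<Lambda> (\<lambda>_. 1)"
      using belowD[OF f] by (intro mono) (auto simp: bcontfun_const)
    then show "ennreal (\<Lambda> f) \<le> 1" by (simp add: one)
  qed
  have "(\<lambda>_. 1) \<in> below UNIV" by (auto intro!: belowI bcontfun_const)
  from content_upper[OF this] show "1 \<le> content UNIV" by (simp add: one)
qed

text \<open>A test function for the union is the increasing limit of its minima with finite sums of
  bumps supported in the single sets. The remainder decreases to zero, so the Daniell axiom makes
  its mean negligible, and each bump is a test function for one of the sets.\<close>

lemma content_UN:
  assumes U: "\<And>i::nat. open (U i)"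
  shows "content (\<Union>i. U i) \<le> (\<Sum>i. content (U i))"
  unfolding content_def[of "\<Union>i. U i"]
proof (rule SUP_least)
  fix f assume f: "f \<in> below (\<Union>i. U i)"
  \<comment> \<open>One index serves as both the number of bumps and their steepness, so that
    \<open>g\<close> is a single increasing sequence.\<close>
  define g where "g n x = min (f x) (\<Sum>i<n. open_bump (U i) n x)" for n x
  have g: "g n \<in> bcontfun" for n
    unfolding g_def using belowD(1)[OF f]
    by (intro bcontfun_min bcontfun_sum) (auto intro: open_bump_bcontfun)
  have gf: "(\<lambda>n. \<Lambda> (\<lambda>x. f x - g n x)) \<longlonglongrightarrow> 0"
  proof (rule daniell)
    show "(\<lambda>x. f x - g n x) \<in> bcontfun" for n
      using g belowD(1)[OF f] by (rule bcontfun_diff[rotated])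
    show "f x - g (Suc n) x \<le> f x - g n x" for n x
    proof -
      have "(\<Sum>i<n. open_bump (U i) n x) \<le> (\<Sum>i<n. open_bump (U i) (Suc n) x)"
        by (intro sum_mono open_bump_mono) auto
      also have "\<dots> \<le> (\<Sum>i<Suc n. open_bump (U i) (Suc n) x)"
        by (simp add: open_bump_bounds)
      finally show ?thesis by (auto simp: g_def min_def)
    qed
    show "(\<lambda>n. f x - g n x) \<longlonglongrightarrow> 0" for x
    proof (cases "x \<in> (\<Union>i. U i)")
      case False
      then have "f x = 0" using belowD(4)[OF f] by auto
      then have "f x - g n x = 0" for n
        by (simp add: g_def sum_nonneg open_bump_bounds)
      then show ?thesis by simp
    next
      case True
      then obtain i where i: "x \<in> U i" by auto
      obtain N where N: "\<And>n. n \<ge> N \<Longrightarrow> open_bump (U i) n x = 1"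
        using open_bump_inside[OF U i] by blast
      \<comment> \<open>The bound \<open>Suc i\<close> puts the bump of \<open>U i\<close> into the
        sum over indices below n, and N makes it equal to 1 at x.\<close>
      have "f x - g n x = 0" if "n \<ge> max N (Suc i)" for n
      proof -
        have "1 \<le> (\<Sum>j<n. open_bump (U j) n x)"
          using member_le_sum[of i "{..<n}" "\<lambda>j. open_bump (U j) n x"] N[of n] that
          by (auto simp: open_bump_bounds)
        then show ?thesis using belowD(3)[OF f, of x] by (simp add: g_def)
      qed
      then have "eventually (\<lambda>n. f x - g n x = 0) sequentially"
        unfolding eventually_sequentially by blast
      then show ?thesis by (rule tendsto_eventually)
    qed
  qed
  show "ennreal (\<Lambda> f) \<le> (\<Sum>i. content (U i))"
  proof (rule ennreal_le_epsilon)
    fix e :: real assume e: "0 < e"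
    from order_tendstoD(2)[OF gf this] obtain n where n: "\<Lambda> (\<lambda>x. f x - g n x) < e"
      by (auto dest: eventually_happens)
    have "\<Lambda> (g n) \<le> \<Lambda> (\<lambda>x. \<Sum>i<n. open_bump (U i) n x)"
      using g by (intro mono bcontfun_sum open_bump_bcontfun) (auto simp: g_def)
    also have "\<dots> = (\<Sum>i<n. \<Lambda> (open_bump (U i) n))"
      by (intro sum open_bump_bcontfun)
    finally have "ennreal (\<Lambda> (g n)) \<le> ennreal (\<Sum>i<n. \<Lambda> (open_bump (U i) n))"
      by (rule ennreal_leI)
    also have "\<dots> = (\<Sum>i<n. ennreal (\<Lambda> (open_bump (U i) n)))"
      by (intro sum_ennreal[symmetric] nonneg open_bump_bcontfun) (auto simp: open_bump_bounds)
    also have "\<dots> \<le> (\<Sum>i<n. content (U i))"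
      by (intro sum_mono content_upper belowI open_bump_bcontfun)
        (auto simp: open_bump_bounds open_bump_outside)
    also have "\<dots> \<le> (\<Sum>i. content (U i))"
      by (rule sum_le_suminf) auto
    finally have gn: "ennreal (\<Lambda> (g n)) \<le> (\<Sum>i. content (U i))" .
    have "\<Lambda> f = \<Lambda> (g n) + \<Lambda> (\<lambda>x. f x - g n x)"
      using diff[OF belowD(1)[OF f] g] by simp
    also have "\<dots> \<le> \<Lambda> (g n) + e" using n by simp
    finally have "ennreal (\<Lambda> f) \<le> ennreal (\<Lambda> (g n) + e)" by (rule ennreal_leI)
    also have "\<dots> = ennreal (\<Lambda> (g n)) + ennreal e"
      using e belowD(2)[OF f] 
      by (intro ennreal_plus nonneg g) (auto simp: g_def sum_nonneg open_bump_bounds)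
    also have "\<dots> \<le> (\<Sum>i. content (U i)) + ennreal e" using gn by (rule add_right_mono)
    finally show "ennreal (\<Lambda> f) \<le> (\<Sum>i. content (U i)) + ennreal e" .
  qed
qed

lemma outer_open: "open U \<Longrightarrow> outer U = content U"
  unfolding outer_def by (rule antisym) (auto intro!: INF_lower INF_greatest content_mono)

lemma outer_le: "open U \<Longrightarrow> A \<subseteq> U \<Longrightarrow> outer A \<le> content U"
  unfolding outer_def by (rule INF_lower) auto

lemma outer_close: "outer A < e \<Longrightarrow> \<exists>U. open U \<and> A \<subseteq> U \<and> content U < e"
  unfolding outer_def INF_less_iff by auto

lemma outer_mono: "A \<subseteq> B \<Longrightarrow> outer A \<le> outer B"
  unfolding outer_def by (rule INF_superset_mono) auto

lemma outer_UN: "outer (\<Union>i::nat. A i) \<le> (\<Sum>i. outer (A i))"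
proof (rule ennreal_le_epsilon)
  fix e :: real assume "0 < e" "(\<Sum>n. outer (A n)) < top"
  then have *: "\<And>n. outer (A n) < outer (A n) + e * (1/2)^Suc n"
    by (auto simp add: less_top dest!: ennreal_suminf_lessD)
  obtain U where U: "\<And>n. open (U n)" "\<And>n. A n \<subseteq> U n"
    "\<And>n. content (U n) \<le> outer (A n) + e * (1/2)^(Suc n)"
    by (metis less_imp_le outer_close[OF *])
  have "outer (\<Union>i. A i) \<le> content (\<Union>i. U i)"
    using U by (intro outer_le) auto
  also have "\<dots> \<le> (\<Sum>i. content (U i))" using U by (intro content_UN)
  also have "\<dots> \<le> (\<Sum>n. outer (A n) + e * (1/2) ^ Suc n)"
    using U by (intro suminf_le) auto
  also have "... = (\<Sum>n. outer (A n)) + (\<Sum>n. ennreal e * ennreal ((1/2) ^ Suc n))"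
    using \<open>0 < e\<close> by (subst suminf_add[symmetric])
                     (auto simp del: ennreal_suminf_cmult simp add: ennreal_mult[symmetric])
  also have "\<dots> = (\<Sum>n. outer (A n)) + e"
    unfolding ennreal_suminf_cmult
    by (subst suminf_ennreal_eq[OF zero_le_power power_half_series]) auto
  finally show "outer (\<Union>i. A i) \<le> (\<Sum>n. outer (A n)) + e" .
qed

lemma outer_measure_space: "outer_measure_space (Pow UNIV) outer"
  unfolding outer_measure_space_def positive_def increasing_def countably_subadditive_def
  using outer_UN by (auto simp: outer_open content_empty intro: outer_mono)

lemma outer_Un: "outer (A \<union> B) \<le> outer A + outer B"
proof -
  have "outer (\<Union>i. binaryset A B i) \<le> (\<Sum>i. outer (binaryset A B i))" by (rule outer_UN)
  also have "\<dots> = outer A + outer B"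
    by (rule suminf_binaryset_eq) (simp add: outer_open content_empty)
  finally show ?thesis by (simp add: UN_binaryset_eq)
qed

text \<open>The test functions near the supremum for \<open>W \<inter> U\<close> are shifted down by \<open>e\<close> so that they
  vanish on a neighbourhood of \<open>W - U\<close>.\<close>

lemma content_split:
  assumes "open U" "open W"
  shows "content (W \<inter> U) + outer (W - U) \<le> content W"
proof -
  have "ennreal (\<Lambda> f) + outer (W - U) \<le> content W" if f: "f \<in> below (W \<inter> U)" for f
  proof (rule ennreal_le_epsilon)
    fix e :: real assume e: "0 < e"
    define V where "V = {x. f x < e} \<inter> W"
    have cont: "continuous_on UNIV f" using belowD(1)[OF f] by (simp add: bcontfun_def)
    have V: "open V" unfolding V_def
      using assms cont by (intro open_Int) (auto intro!: open_Collect_less continuous_intros)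
    have WV: "W - U \<subseteq> V" using belowD(4)[OF f] e by (auto simp: V_def)
    define f' where "f' x = max 0 (f x - e)" for x
    have f': "f' \<in> bcontfun" unfolding f'_def
      using belowD(1)[OF f] by (intro bcontfun_max bcontfun_diff bcontfun_const)
    have "ennreal (\<Lambda> f') + ennreal (\<Lambda> g) \<le> content W" if g: "g \<in> below V" for g
    proof -
      have "(\<lambda>x. f' x + g x) \<in> below W"
      proof (rule belowI)
        show "(\<lambda>x. f' x + g x) \<in> bcontfun" using f' belowD(1)[OF g] by (rule bcontfun_add)
        show "0 \<le> f' x + g x" for x using belowD(2)[OF g] by (simp add: f'_def)
        \<comment> \<open>The two summands are never positive together: \<open>f'\<close> vanishes
          where \<open>f x < e\<close>, and g vanishes outside V, in particular where
          \<open>f x\<close> is at least e.\<close>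
        show "f' x + g x \<le> 1" for x
          using belowD(3)[OF g, of x] belowD(4)[OF g, of x] belowD(3)[OF f, of x] e
            belowD(4)[OF f, of x]
          by (cases "f x < e") (auto simp: f'_def V_def)
        show "f' x + g x = 0" if "x \<notin> W" for x
          using belowD(4)[OF g, of x] belowD(4)[OF f, of x] e that by (auto simp: f'_def V_def)
      qed
      from content_upper[OF this] show ?thesis
        using belowD[OF g] f' add[OF f' belowD(1)[OF g]]
        by (subst ennreal_plus[symmetric]) (auto simp: f'_def intro!: nonneg)
    qed
    then have "(SUP g\<in>below V. ennreal (\<Lambda> f') + ennreal (\<Lambda> g)) \<le> content W"
      by (rule SUP_least)
    also have "(SUP g\<in>below V. ennreal (\<Lambda> f') + ennreal (\<Lambda> g)) = ennreal (\<Lambda> f') + content V"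
      unfolding content_def using zero_below by (intro ennreal_SUP_add_right[symmetric]) auto
    finally have 1: "ennreal (\<Lambda> f') + content V \<le> content W" .
    have "\<Lambda> f \<le> \<Lambda> (\<lambda>x. f' x + e)"
      by (intro mono bcontfun_add bcontfun_const f' belowD(1)[OF f]) (auto simp: f'_def)
    also have "\<dots> = \<Lambda> f' + e" using f' by (simp add: add bcontfun_const const)
    finally have "ennreal (\<Lambda> f) \<le> ennreal (\<Lambda> f' + e)" by (rule ennreal_leI)
    also have "\<dots> = ennreal (\<Lambda> f') + ennreal e"
      using e f' by (intro ennreal_plus nonneg) (auto simp: f'_def)
    finally have "ennreal (\<Lambda> f) + outer (W - U) \<le> (ennreal (\<Lambda> f') + ennreal e) + content V"
      using outer_le[OF V WV] by (intro add_mono)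
    also have "\<dots> = (ennreal (\<Lambda> f') + content V) + ennreal e" by (simp add: ac_simps)
    also have "\<dots> \<le> content W + ennreal e" using 1 by (rule add_right_mono)
    finally show "ennreal (\<Lambda> f) + outer (W - U) \<le> content W + ennreal e" .
  qed
  then have "(SUP f\<in>below (W \<inter> U). ennreal (\<Lambda> f) + outer (W - U)) \<le> content W"
    by (rule SUP_least)
  also have "(SUP f\<in>below (W \<inter> U). ennreal (\<Lambda> f) + outer (W - U)) = content (W \<inter> U) + outer (W - U)"
    unfolding content_def using zero_below by (intro ennreal_SUP_add_left) auto
  finally show ?thesis .
qed

text \<open>One inequality is subadditivity. For the other, an arbitrary set is replaced by an open
  superset W, where \<open>content_split\<close> applies; the infimum over W gives the
  claim.\<close>

lemma open_in_lambda_system: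
  assumes "open U"
  shows "U \<in> lambda_system UNIV (Pow UNIV) outer"
proof -
  have "outer (U \<inter> A) + outer ((UNIV - U) \<inter> A) = outer A" for A
  proof (rule antisym)
    have "outer A \<le> outer (U \<inter> A \<union> ((UNIV - U) \<inter> A))" by (rule outer_mono) auto
    also have "\<dots> \<le> outer (U \<inter> A) + outer ((UNIV - U) \<inter> A)" by (rule outer_Un)
    finally show "outer A \<le> outer (U \<inter> A) + outer ((UNIV - U) \<inter> A)" .
    have "outer (U \<inter> A) + outer ((UNIV - U) \<inter> A) \<le> content W" if W: "open W" "A \<subseteq> W" for W
    proof -
      have "outer (U \<inter> A) + outer ((UNIV - U) \<inter> A) \<le> content (W \<inter> U) + outer (W - U)"
        using W assms by (intro add_mono outer_le outer_mono) auto
      also have "\<dots> \<le> content W" using W assms by (intro content_split)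
      finally show ?thesis .
    qed
    then show "outer (U \<inter> A) + outer ((UNIV - U) \<inter> A) \<le> outer A"
      unfolding outer_def[of A] by (intro INF_greatest) auto
  qed
  then show ?thesis by (simp add: lambda_system_def)
qed

section \<open>The representing probability measure\<close>

definition riesz_measure :: "'a measure" where
  "riesz_measure = measure_of UNIV (sets borel) outer"

lemma sets_riesz_measure [measurable_cong, simp]: "sets riesz_measure = sets borel"
  unfolding riesz_measure_def by (metis sets.sets_measure_of_eq space_borel)

lemma space_riesz_measure [simp]: "space riesz_measure = UNIV"
  by (metis sets_eq_imp_space_eq sets_riesz_measure space_borel)

text \<open>Caratheodory's lemma makes the sets splitting \<open>outer\<close> a sigma-algebra on
  which \<open>outer\<close> is a measure. It contains the open sets, hence all Borel sets, so
  restricting \<open>outer\<close> to them is legitimate.\<close>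

lemma emeasure_riesz_measure:
  assumes "A \<in> sets borel"
  shows "emeasure riesz_measure A = outer A"
proof -
  let ?L = "lambda_system UNIV (Pow UNIV) outer"
  interpret P: sigma_algebra UNIV "Pow UNIV :: 'a set set" by (rule sigma_algebra_Pow)
  have L: "measure_space UNIV ?L outer"
    by (rule P.caratheodory_lemma[OF outer_measure_space])
  then have sL: "sigma_algebra UNIV ?L" by (simp add: measure_space_def)
  have "sigma_sets UNIV {S. open S} \<subseteq> ?L"
    using open_in_lambda_system by (intro sigma_algebra.sigma_sets_subset[OF sL]) blast
  then have "sets borel \<subseteq> ?L" by (simp add: sets_borel)
  then have M: "measure_space UNIV (sets borel) outer"
    using measure_down[OF L, of "sets borel"] sets.sigma_algebra_axioms[of borel] by simp
  show ?thesis
    unfolding riesz_measure_def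
    using M assms sets.sigma_sets_eq[of "borel :: 'a measure"]
    by (intro emeasure_measure_of[OF refl]) (auto simp: measure_space_def)
qed

lemma prob_space_riesz_measure: "prob_space riesz_measure"
  by (rule prob_spaceI) (simp add: emeasure_riesz_measure outer_open content_UNIV)

lemma integrable_riesz_measure:
  fixes f :: "'a \<Rightarrow> real"
  assumes "f \<in> bcontfun"
  shows "integrable riesz_measure f"
proof -
  interpret prob_space riesz_measure by (rule prob_space_riesz_measure)
  from assms obtain B where "continuous_on UNIV f" "\<And>x. \<bar>f x\<bar> \<le> B"
    by (auto simp: bcontfun_real_iff)
  then show ?thesis
    by (intro integrable_const_bound[of _ B]) (auto simp: measurable_cong_sets[OF sets_riesz_measure refl]
        intro: borel_measurable_continuous_onI)
qed

text \<open>A discrete layer-cake argument: \<open>n * f\<close> is cut into n horizontal slices of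
  height 1. The slice \<open>c i\<close> is a test function for the open set where
  \<open>n * f\<close> exceeds i, so its mean is at most the measure of that set, and the indicators
  of these sets sum to at most \<open>n * f + 1\<close>.\<close>

lemma mean_le_integral:
  assumes f: "f \<in> bcontfun" and f01: "\<And>x. 0 \<le> f x" "\<And>x. f x \<le> 1"
  shows "\<Lambda> f \<le> (\<integral>x. f x \<partial>riesz_measure)"
proof (rule field_le_epsilon)
  interpret prob_space riesz_measure by (rule prob_space_riesz_measure)
  fix e :: real assume "0 < e"
  obtain n where "1 / e < real n" using reals_Archimedean2 by blast
  with \<open>0 < e\<close> have n: "0 < n" by (intro gr0I) (auto simp: field_simps)
  with \<open>0 < e\<close> \<open>1 / e < real n\<close> have n_less: "1 / real n < e" by (simp add: field_simps)
  define c where "c i x = min 1 (max 0 (real n * f x - real i))" for i x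
  have cont: "continuous_on UNIV f" using f by (simp add: bcontfun_def)
  have c: "c i \<in> bcontfun" for i
    unfolding c_def using f by (intro bcontfun_min bcontfun_max bcontfun_diff bcontfun_cmult bcontfun_const)
  have slices: "(\<Sum>i<m. min 1 (max 0 (y - real i))) = y" if "0 \<le> y" "y \<le> real m" for m y
    using that
  proof (induction m arbitrary: y)
    case 0
    then show ?case by simp
  next
    case (Suc m)
    have "(\<Sum>i<m. min 1 (max 0 (y - real i))) = min y (real m)"
    proof (cases "y \<le> real m")
      case True
      then show ?thesis using Suc by simp
    next
      case False
      then have "(\<Sum>i<m. min 1 (max 0 (y - real i))) = (\<Sum>i<m. 1)"
        by (intro sum.cong) auto
      then show ?thesis using False by simp
    qed
    then show ?case using Suc.prems by (auto simp: min_def max_def)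
  qed
  define S where "S i = {x. real i < real n * f x}" for i
  have S: "open (S i)" for i
    unfolding S_def using cont by (intro open_Collect_less continuous_intros)
  then have S': "S i \<in> sets borel" for i by simp
  have cS: "\<Lambda> (c i) \<le> measure riesz_measure (S i)" for i
  proof -
    have "ennreal (\<Lambda> (c i)) \<le> content (S i)"
      by (intro content_upper belowI c) (auto simp: c_def S_def)
    also have "\<dots> = ennreal (measure riesz_measure (S i))"
      using S S' by (simp add: emeasure_riesz_measure outer_open flip: emeasure_eq_measure)
    finally show ?thesis by simp
  qed
  \<comment> \<open>The indicator of y > i is below the i-th slice of y + 1, which costs the
    additive 1. As y + 1 may reach n + 1, \<open>slices\<close> is used with
    \<open>Suc n\<close>.\<close>
  have layer: "(\<Sum>i<n. indicator (S i) x) \<le> real n * f x + 1" for x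
  proof -
    have *: "indicator (S i) x \<le> min 1 (max 0 ((real n * f x + 1) - real i))" for i
      by (auto simp: S_def indicator_def)
    have "(\<Sum>i<n. indicator (S i) x) \<le> (\<Sum>i<Suc n. min 1 (max 0 ((real n * f x + 1) - real i)))"
      by (intro order_trans[OF sum_mono[OF *]]) simp
    also have "\<dots> = real n * f x + 1"
      using f01[of x] by (intro slices) (auto simp: mult_left_le)
    finally show ?thesis .
  qed
  have "real n * \<Lambda> f = \<Lambda> (\<lambda>x. \<Sum>i<n. c i x)"
    unfolding cmult[OF f, symmetric] c_def
    using f01 by (intro arg_cong[of _ _ \<Lambda>] ext slices[symmetric]) (auto simp: mult_left_le)
  also have "\<dots> = (\<Sum>i<n. \<Lambda> (c i))" by (intro sum c)
  also have "\<dots> \<le> (\<Sum>i<n. measure riesz_measure (S i))" by (intro sum_mono cS)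
  also have "\<dots> = (\<integral>x. (\<Sum>i<n. indicator (S i) x) \<partial>riesz_measure)"
    using S' by (subst Bochner_Integration.integral_sum) (auto simp: emeasure_eq_measure)
  also have "\<dots> \<le> (\<integral>x. real n * f x + 1 \<partial>riesz_measure)"
    using S' integrable_riesz_measure[OF f]
    by (intro integral_mono layer Bochner_Integration.integrable_sum Bochner_Integration.integrable_add
        integrable_mult_right) (auto simp: emeasure_eq_measure)
  also have "\<dots> = real n * (\<integral>x. f x \<partial>riesz_measure) + 1"
    using integrable_riesz_measure[OF f] by (simp add: prob_space[simplified])
  finally have "\<Lambda> f \<le> (\<integral>x. f x \<partial>riesz_measure) + 1 / real n"
    using n by (simp add: field_simps)
  then show "\<Lambda> f \<le> (\<integral>x. f x \<partial>riesz_measure) + e" using n_less by simp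
qed

text \<open>The one-sided estimate is applied to a function g with values in [0,1] and to 1 - g,
  which gives equality; an affine rescaling carries f to such a g.\<close>

theorem integral_riesz_measure:
  assumes f: "f \<in> bcontfun"
  shows "(\<integral>x. f x \<partial>riesz_measure) = \<Lambda> f"
proof -
  interpret prob_space riesz_measure by (rule prob_space_riesz_measure)
  from f obtain B' where B': "\<And>x. \<bar>f x\<bar> \<le> B'"
    by (auto simp: bcontfun_real_iff)
  \<comment> \<open>The added 1 makes the bound strictly positive, so that it may be divided
    by.\<close>
  define B where "B = B' + 1"
  have B: "\<bar>f x\<bar> \<le> B" for x
    using B'[of x] by (simp add: B_def)
  have B_pos: "0 < B"
    using B'[of undefined] abs_ge_zero[of "f undefined"] by (simp add: B_def)
  define g where "g x = 1 / (2 * B) * (f x + B)" for x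
  have g: "g \<in> bcontfun" unfolding g_def using f by (intro bcontfun_cmult bcontfun_add bcontfun_const)
  have g0: "0 \<le> g x" for x unfolding g_def
    using B[of x] B_pos by (intro mult_nonneg_nonneg) auto
  have g1: "g x \<le> 1" for x unfolding g_def
    using B[of x] B_pos by (simp add: field_simps)
  have "\<Lambda> g \<le> (\<integral>x. g x \<partial>riesz_measure)" using g g0 g1 by (rule mean_le_integral)
  moreover have "\<Lambda> (\<lambda>x. 1 - g x) \<le> (\<integral>x. 1 - g x \<partial>riesz_measure)"
    using g g0 g1 by (intro mean_le_integral bcontfun_diff bcontfun_const) auto
  then have "1 - \<Lambda> g \<le> 1 - (\<integral>x. g x \<partial>riesz_measure)"
    using integrable_riesz_measure[OF g] g
    by (simp add: diff bcontfun_const one prob_space[simplified])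
  ultimately have "(\<integral>x. g x \<partial>riesz_measure) = \<Lambda> g" by simp
  moreover have "f = (\<lambda>x. (2 * B) * g x - B)" using B_pos by (auto simp: g_def)
  moreover have "\<Lambda> (\<lambda>x. (2 * B) * g x - B) = (2 * B) * \<Lambda> g - B"
    using g by (simp add: diff cmult const bcontfun_const bcontfun_cmult)
  moreover have "(\<integral>x. (2 * B) * g x - B \<partial>riesz_measure) = (2 * B) * (\<integral>x. g x \<partial>riesz_measure) - B"
    using integrable_riesz_measure[OF g] by (simp add: prob_space[simplified])
  ultimately show ?thesis by simp
qed

end

section \<open>Smooth functions and concave truncations\<close>

text \<open>The additive constant is allowed because the test functions used later agree with \<rho>
  only up to a constant.\<close>

lemma frechet_derivative_cong_open:
  fixes f g :: "real ^ 'n \<Rightarrow> real"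
  assumes "open S" "x \<in> S" "\<And>y. y \<in> S \<Longrightarrow> f y = g y - c"
  shows "frechet_derivative f (at x) = frechet_derivative g (at x)"
proof -
  have "(f has_derivative D) (at x) \<longleftrightarrow> (g has_derivative D) (at x)" for D
  proof
    assume "(f has_derivative D) (at x)"
    from has_derivative_add[OF this has_derivative_const[of c]]
    have "((\<lambda>y. f y + c) has_derivative D) (at x)" by simp
    then show "(g has_derivative D) (at x)"
      by (rule has_derivative_transform_within_open[OF _ assms(1,2)]) (simp add: assms(3))
  next
    assume "(g has_derivative D) (at x)"
    from has_derivative_diff[OF this has_derivative_const[of c]]
    have "((\<lambda>y. g y - c) has_derivative D) (at x)" by simp
    then show "(f has_derivative D) (at x)"
      by (rule has_derivative_transform_within_open[OF _ assms(1,2)]) (simp add: assms(3))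
  qed
  then show ?thesis by (simp add: frechet_derivative_def)
qed

lemma Ck_on_cong:
  assumes "open S" "\<And>x. x \<in> S \<Longrightarrow> f x = g x" "Ck_on n S f"
  shows "Ck_on n S g"
  using assms(2,3)
proof (induction n arbitrary: f g)
  case 0
  then show ?case using continuous_on_cong[OF refl, of S f g] by simp
next
  case (Suc n)
  have eq: "frechet_derivative f (at x) = frechet_derivative g (at x)" if "x \<in> S" for x
    using Suc.prems(1) by (intro frechet_derivative_cong_open[OF assms(1) that, where c=0]) simp
  have "g differentiable (at x)" if "x \<in> S" for x
  proof -
    have "(f has_derivative frechet_derivative f (at x)) (at x)"
      using Suc.prems(2) that by (simp add: frechet_derivative_works)
    then have "(g has_derivative frechet_derivative f (at x)) (at x)"
      by (rule has_derivative_transform_within_open[OF _ assms(1) that]) (simp add: Suc.prems(1))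
    then show ?thesis by (rule differentiableI)
  qed
  moreover have "Ck_on n S (\<lambda>x. frechet_derivative g (at x) v)" for v
    by (rule Suc.IH[of "\<lambda>x. frechet_derivative f (at x) v"]) (use Suc.prems eq in auto)
  ultimately show ?case by simp
qed

lemma Ck_on_SucI:
  assumes "open S" "\<And>x. x \<in> S \<Longrightarrow> (f has_derivative D x) (at x)"
    "\<And>v. Ck_on n S (\<lambda>x. D x v)"
  shows "Ck_on (Suc n) S f"
proof -
  have "Ck_on n S (\<lambda>x. frechet_derivative f (at x) v)" for v
    using assms by (intro Ck_on_cong[OF assms(1) _ assms(3)[of v]]) (metis frechet_derivative_at)
  then show ?thesis using assms by (auto intro: differentiableI)
qed

lemma Ck_on_SucD:
  assumes "Ck_on (Suc n) S f"
  shows "x \<in> S \<Longrightarrow> (f has_derivative frechet_derivative f (at x)) (at x)"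
    "Ck_on n S (\<lambda>x. frechet_derivative f (at x) v)"
  using assms by (auto simp: frechet_derivative_works)

lemma Ck_on_mono_Suc: "Ck_on (Suc n) S f \<Longrightarrow> Ck_on n S f"
proof (induction n arbitrary: f)
  case 0
  then show ?case by (auto intro!: continuous_at_imp_continuous_on differentiable_imp_continuous_within)
next
  case (Suc n)
  from Suc.prems have "\<forall>v. Ck_on (Suc n) S (\<lambda>x. frechet_derivative f (at x) v)"
    by (subst (asm) Ck_on.simps(2)) simp
  with Suc.IH Suc.prems show ?case by auto
qed

lemma Ck_on_const: "open S \<Longrightarrow> Ck_on n S (\<lambda>_. c)"
proof (induction n arbitrary: c)
  case (Suc n)
  then show ?case
    by (intro Ck_on_SucI[where D="\<lambda>_ _. 0"]) auto
qed simp

lemma Ck_on_add: "open S \<Longrightarrow> Ck_on n S f \<Longrightarrow> Ck_on n S g \<Longrightarrow> Ck_on n S (\<lambda>x. f x + g x)"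
proof (induction n arbitrary: f g)
  case (Suc n)
  show ?case
    by (rule Ck_on_SucI[OF Suc.prems(1) has_derivative_add[OF Ck_on_SucD(1)[OF Suc.prems(2)] Ck_on_SucD(1)[OF Suc.prems(3)]]])
      (assumption | intro Suc.IH Suc.prems(1) Suc.prems(2,3)[THEN Ck_on_SucD(2)])+
qed (auto intro: continuous_intros)

lemma Ck_on_mult: "open S \<Longrightarrow> Ck_on n S f \<Longrightarrow> Ck_on n S g \<Longrightarrow> Ck_on n S (\<lambda>x. f x * g x)"
proof (induction n arbitrary: f g)
  case (Suc n)
  show ?case
    by (rule Ck_on_SucI[OF Suc.prems(1) has_derivative_mult[OF Ck_on_SucD(1)[OF Suc.prems(2)] Ck_on_SucD(1)[OF Suc.prems(3)]]])
      (assumption | intro Ck_on_add Suc.IH Suc.prems(1) Suc.prems(2,3)[THEN Ck_on_mono_Suc] Suc.prems(2,3)[THEN Ck_on_SucD(2)])+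
qed (auto intro: continuous_intros)

lemma Ck_on_Un:
  assumes "open S" "open T" "Ck_on n S f" "Ck_on n T f"
  shows "Ck_on n (S \<union> T) f"
  using assms(3,4)
  by (induction n arbitrary: f) (auto intro: continuous_on_open_Un[OF assms(1,2)])

section \<open>Smoothness on the real line, with derivatives supplied as witnesses\<close>

primrec Dk_on :: "nat \<Rightarrow> real set \<Rightarrow> (real \<Rightarrow> real) \<Rightarrow> bool" where
  "Dk_on 0 T \<phi> \<longleftrightarrow> continuous_on T \<phi>"
| "Dk_on (Suc n) T \<phi> \<longleftrightarrow>
     (\<exists>\<phi>'. (\<forall>s\<in>T. (\<phi> has_real_derivative \<phi>' s) (at s)) \<and> Dk_on n T \<phi>')"

lemma Dk_on_SucI:
  "(\<And>s. s \<in> T \<Longrightarrow> (\<phi> has_real_derivative \<phi>' s) (at s)) \<Longrightarrow> Dk_on n T \<phi>' \<Longrightarrow> Dk_on (Suc n) T \<phi>"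
  by auto

lemma Dk_on_SucE:
  assumes "Dk_on (Suc n) T \<phi>"
  obtains \<phi>' where "\<And>s. s \<in> T \<Longrightarrow> (\<phi> has_real_derivative \<phi>' s) (at s)" "Dk_on n T \<phi>'"
  using assms by auto

lemma Dk_on_mono_Suc: "Dk_on (Suc n) T \<phi> \<Longrightarrow> Dk_on n T \<phi>"
proof (induction n arbitrary: \<phi>)
  case 0
  then show ?case
    by (metis Dk_on.simps(1) Dk_on_SucE DERIV_isCont continuous_at_imp_continuous_on)
next
  case (Suc n)
  from Suc.prems obtain \<phi>' where
    "\<And>s. s \<in> T \<Longrightarrow> (\<phi> has_real_derivative \<phi>' s) (at s)" "Dk_on (Suc n) T \<phi>'"
    by (metis Dk_on_SucE)
  then show ?case using Suc.IH by (intro Dk_on_SucI)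
qed

lemma Dk_on_const: "Dk_on n T (\<lambda>_. c)"
proof (induction n arbitrary: c)
  case (Suc n)
  show ?case by (rule Dk_on_SucI[where \<phi>'="\<lambda>_. 0"]) (simp, rule Suc.IH)
qed (simp add: continuous_on_const)

lemma Dk_on_add: "Dk_on n T \<phi> \<Longrightarrow> Dk_on n T \<psi> \<Longrightarrow> Dk_on n T (\<lambda>s. \<phi> s + \<psi> s)"
proof (induction n arbitrary: \<phi> \<psi>)
  case (Suc n)
  then obtain \<phi>' \<psi>' where *:
    "\<And>s. s \<in> T \<Longrightarrow> (\<phi> has_real_derivative \<phi>' s) (at s)" "Dk_on n T \<phi>'"
    "\<And>s. s \<in> T \<Longrightarrow> (\<psi> has_real_derivative \<psi>' s) (at s)" "Dk_on n T \<psi>'"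
    by (metis Dk_on_SucE)
  then show ?case using Suc.IH[OF *(2,4)]
    by (intro Dk_on_SucI[where \<phi>'="\<lambda>s. \<phi>' s + \<psi>' s"]) (auto intro!: derivative_eq_intros)
qed (auto intro: continuous_intros)

lemma Dk_on_mult: "Dk_on n T \<phi> \<Longrightarrow> Dk_on n T \<psi> \<Longrightarrow> Dk_on n T (\<lambda>s. \<phi> s * \<psi> s)"
proof (induction n arbitrary: \<phi> \<psi>)
  case (Suc n)
  then obtain \<phi>' \<psi>' where *:
    "\<And>s. s \<in> T \<Longrightarrow> (\<phi> has_real_derivative \<phi>' s) (at s)" "Dk_on n T \<phi>'"
    "\<And>s. s \<in> T \<Longrightarrow> (\<psi> has_real_derivative \<psi>' s) (at s)" "Dk_on n T \<psi>'"
    by (metis Dk_on_SucE)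
  have "Dk_on n T (\<lambda>s. \<phi>' s * \<psi> s + \<phi> s * \<psi>' s)"
    by (intro Dk_on_add Suc.IH * Suc.prems[THEN Dk_on_mono_Suc])
  with * show ?case
    by (intro Dk_on_SucI[where \<phi>'="\<lambda>s. \<phi>' s * \<psi> s + \<phi> s * \<psi>' s"]) (auto intro!: derivative_eq_intros)
qed (auto intro: continuous_intros)

lemma Dk_on_inverse:
  "Dk_on n T \<phi> \<Longrightarrow> (\<And>s. s \<in> T \<Longrightarrow> \<phi> s \<noteq> 0) \<Longrightarrow> Dk_on n T (\<lambda>s. inverse (\<phi> s))"
proof (induction n arbitrary: \<phi>)
  case (Suc n)
  then obtain \<phi>' where *:
    "\<And>s. s \<in> T \<Longrightarrow> (\<phi> has_real_derivative \<phi>' s) (at s)" "Dk_on n T \<phi>'"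
    by (metis Dk_on_SucE)
  have i: "Dk_on n T (\<lambda>s. inverse (\<phi> s))"
    using Suc.IH[OF Dk_on_mono_Suc[OF Suc.prems(1)]] Suc.prems(2) by blast
  have "Dk_on n T (\<lambda>s. (-1) * (inverse (\<phi> s) * \<phi>' s * inverse (\<phi> s)))"
    using * i by (intro Dk_on_mult Dk_on_const)
  with * Suc.prems(2) show ?case
    by (intro Dk_on_SucI[where \<phi>'="\<lambda>s. (-1) * (inverse (\<phi> s) * \<phi>' s * inverse (\<phi> s))"])
      (auto intro!: derivative_eq_intros)
qed (auto intro: continuous_intros)

lemma Dk_on_affine: "Dk_on n UNIV \<phi> \<Longrightarrow> Dk_on n UNIV (\<lambda>s. \<phi> (a * s + b))"
proof (induction n arbitrary: \<phi>)
  case 0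
  have "continuous_on UNIV (\<lambda>s. a * s + b)" by (intro continuous_intros)
  with 0 show ?case
    using continuous_on_compose2[of UNIV \<phi> UNIV "\<lambda>s. a * s + b"] by simp
next
  case (Suc n)
  then obtain \<phi>' where *:
    "\<And>s. (\<phi> has_real_derivative \<phi>' s) (at s)" "Dk_on n UNIV \<phi>'"
    by (metis Dk_on_SucE UNIV_I)
  have "Dk_on n UNIV (\<lambda>s. a * \<phi>' (a * s + b))"
    by (intro Dk_on_mult Dk_on_const Suc.IH *)
  moreover have "((\<lambda>s. \<phi> (a * s + b)) has_real_derivative a * \<phi>' (a * s + b)) (at s)" for s
  proof -
    have "((\<lambda>s. a * s + b) has_real_derivative a) (at s)" by (auto intro!: derivative_eq_intros)
    from DERIV_chain2[OF *(1) this] show ?thesis by (simp add: mult.commute)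
  qed
  ultimately show ?case by (intro Dk_on_SucI)
qed

lemma Dk_on_powr: "Dk_on n {0<..} (\<lambda>s. s powr a)"
proof (induction n arbitrary: a)
  case 0
  then show ?case by (auto intro!: continuous_intros)
next
  case (Suc n)
  have "Dk_on n {0<..} (\<lambda>s. a * s powr (a - 1))"
    by (intro Dk_on_mult Dk_on_const Suc.IH)
  then show ?case
    by (rule Dk_on_SucI[rotated]) (auto intro!: derivative_eq_intros)
qed

text \<open>The derivative of the composite is a product of a directional derivative of f with
  \<open>\<phi>'\<close> composed with the same f, so the induction varies \<phi> only and closes by
  the product rule.\<close>

lemma Ck_on_compose:
  assumes "open S" "Dk_on n T \<phi>" "Ck_on n S f" "f ` S \<subseteq> T"
  shows "Ck_on n S (\<lambda>x. \<phi> (f x))"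
  using assms(2-4)
proof (induction n arbitrary: \<phi>)
  case 0
  then show ?case by (auto intro: continuous_on_compose2)
next
  case (Suc n)
  then obtain \<phi>' where *:
    "\<And>s. s \<in> T \<Longrightarrow> (\<phi> has_real_derivative \<phi>' s) (at s)" "Dk_on n T \<phi>'"
    by (metis Dk_on_SucE)
  show ?case
  proof (rule Ck_on_SucI[OF assms(1)])
    show "((\<lambda>x. \<phi> (f x)) has_derivative (\<lambda>v. frechet_derivative f (at x) v * \<phi>' (f x))) (at x)"
      if "x \<in> S" for x
    proof -
      have "f x \<in> T" using Suc.prems(3) that by (rule subsetD[OF _ imageI])
      then have "(\<phi> has_derivative (\<lambda>v. v * \<phi>' (f x))) (at (f x))"
        using *(1) unfolding has_field_derivative_def mult.commute[of _ "\<phi>' (f x)"] by blast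
      from has_derivative_compose[OF Ck_on_SucD(1)[OF Suc.prems(2) that] this]
      show ?thesis .
    qed
    show "Ck_on n S (\<lambda>x. frechet_derivative f (at x) v * \<phi>' (f x))" for v
      by (rule Ck_on_mult[OF assms(1) Ck_on_SucD(2)[OF Suc.prems(2)]
            Suc.IH[OF *(2) Ck_on_mono_Suc[OF Suc.prems(2)] Suc.prems(3)]])
  qed
qed

section \<open>Flat functions, smooth steps and concave truncations\<close>

lemma tendsto_poly_times_exp_minus: "((\<lambda>x::real. poly p x * exp (- x)) \<longlongrightarrow> 0) at_top"
proof -
  have "((\<lambda>x. \<Sum>i\<le>degree p. coeff p i * (x ^ i / exp x)) \<longlongrightarrow> (\<Sum>i\<le>degree p. coeff p i * 0)) at_top"
    by (intro tendsto_sum tendsto_mult tendsto_const tendsto_power_div_exp_0)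
  also have "(\<lambda>x. \<Sum>i\<le>degree p. coeff p i * (x ^ i / exp x)) = (\<lambda>x. poly p x * exp (- x))"
    by (simp only: poly_altdef sum_distrib_right exp_minus divide_inverse mult.assoc)
  finally show ?thesis by simp
qed

text \<open>The polynomial factor makes the family closed under differentiation, so a single
  induction shows that exp(-1/x), extended by 0, is smooth.\<close>

definition flat :: "real poly \<Rightarrow> real \<Rightarrow> real" where
  "flat p x = (if 0 < x then poly p (1 / x) * exp (- (1 / x)) else 0)"

text \<open>With y = 1/x the derivative of p(y) exp(-y) is y^2 (p - p')(y) exp(-y), which explains
  the new polynomial.\<close>

lemma flat_has_derivative:
  "(flat p has_real_derivative flat ([:0, 0, 1:] * (p - pderiv p)) x) (at x)"
proof -
  let ?q = "[:0, 0, 1:] * (p - pderiv p)"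
  consider "x > 0" | "x < 0" | "x = 0" by linarith
  then show ?thesis
  proof cases
    case 1
    have inv: "((\<lambda>x. 1 / x) has_real_derivative - (1 / x\<^sup>2)) (at x)"
      using 1 by (auto intro!: derivative_eq_intros simp: power2_eq_square)
    have "((\<lambda>x. poly p (1 / x) * exp (- (1 / x))) has_real_derivative
        (- (1 / x\<^sup>2)) * poly (pderiv p) (1 / x) * exp (- (1 / x)) +
        poly p (1 / x) * (exp (- (1 / x)) * (1 / x\<^sup>2))) (at x)"
      using DERIV_mult[OF DERIV_chain2[OF poly_DERIV inv] DERIV_chain2[OF DERIV_exp DERIV_minus[OF inv]]]
      by (simp add: mult.commute add.commute)
    also have "(- (1 / x\<^sup>2)) * poly (pderiv p) (1 / x) * exp (- (1 / x)) +
        poly p (1 / x) * (exp (- (1 / x)) * (1 / x\<^sup>2)) = flat ?q x"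
      using 1 by (simp add: flat_def power2_eq_square algebra_simps)
    finally show ?thesis
      by (rule has_field_derivative_transform_within_open[where S="{0<..}"]) (use 1 in \<open>auto simp: flat_def\<close>)
  next
    case 2
    have "((\<lambda>x. 0) has_real_derivative 0) (at x)" by simp
    then have "(flat p has_real_derivative 0) (at x)"
      by (rule has_field_derivative_transform_within_open[where S="{..<0}"]) (use 2 in \<open>auto simp: flat_def\<close>)
    then show ?thesis using 2 by (simp add: flat_def)
  next
    case 3
    \<comment> \<open>The extra factor \<open>[:0, 1:]\<close> is the 1/h of the difference quotient
      at 0; the exponential beats the resulting polynomial in 1/h.\<close>
    have "((\<lambda>h. poly ([:0, 1:] * p) (inverse h) * exp (- inverse h)) \<longlongrightarrow> 0) (at_right 0)"
      by (rule filterlim_compose[OF tendsto_poly_times_exp_minus filterlim_inverse_at_top_right])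
    then have "((\<lambda>h. flat p h / h) \<longlongrightarrow> 0) (at_right 0)"
      by (rule Lim_transform_eventually)
        (auto simp: eventually_at_filter flat_def field_simps)
    moreover have "((\<lambda>h. flat p h / h) \<longlongrightarrow> 0) (at_left 0)"
      by (rule tendsto_eventually) (auto simp: eventually_at_filter flat_def)
    ultimately have "((\<lambda>h. flat p h / h) \<longlongrightarrow> 0) (at 0)"
      by (simp add: filterlim_split_at)
    then show ?thesis using 3 by (simp add: DERIV_def flat_def)
  qed
qed

lemma Dk_on_flat: "Dk_on n UNIV (flat p)"
proof (induction n arbitrary: p)
  case 0
  then show ?case
    using flat_has_derivative by (auto intro!: continuous_at_imp_continuous_on intro: DERIV_isCont)
next
  case (Suc n)
  show ?case by (rule Dk_on_SucI[OF flat_has_derivative Suc.IH])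
qed

text \<open>The usual smooth transition from 1 to 0 across [M, 2 M]. It is used as a slope, so its
  monotonicity becomes concavity of an antiderivative.\<close>

definition smooth_step :: "real \<Rightarrow> real \<Rightarrow> real" where
  "smooth_step M s = flat 1 (2 * M - s) / (flat 1 (2 * M - s) + flat 1 (s - M))"

lemma flat_1: "flat 1 x = (if 0 < x then exp (- (1 / x)) else 0)"
  by (simp add: flat_def)

lemma flat_1_nonneg: "0 \<le> flat 1 x" by (simp add: flat_1)

lemma flat_1_mono: "x \<le> y \<Longrightarrow> flat 1 x \<le> flat 1 y"
  by (auto simp: flat_1 field_simps)

lemma smooth_step_denominator: "0 < M \<Longrightarrow> 0 < flat 1 (2 * M - s) + flat 1 (s - M)"
  by (cases "s < 2 * M") (auto simp: flat_1 add_pos_nonneg)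

lemma smooth_step_eq_1: "0 < M \<Longrightarrow> s \<le> M \<Longrightarrow> smooth_step M s = 1"
  by (simp add: smooth_step_def flat_1)

lemma smooth_step_eq_0: "2 * M \<le> s \<Longrightarrow> smooth_step M s = 0"
  by (simp add: smooth_step_def flat_1)

lemma smooth_step_bounds: "0 < M \<Longrightarrow> 0 \<le> smooth_step M s \<and> smooth_step M s \<le> 1"
  using smooth_step_denominator[of M s]
  by (simp add: smooth_step_def divide_simps flat_1_nonneg)

lemma smooth_step_antimono:
  assumes "0 < M" "s \<le> t"
  shows "smooth_step M t \<le> smooth_step M s"
proof -
  have "flat 1 (2 * M - t) * flat 1 (s - M) \<le> flat 1 (2 * M - s) * flat 1 (t - M)"
    using assms by (intro mult_mono flat_1_mono flat_1_nonneg) auto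
  then show ?thesis
    using smooth_step_denominator[OF assms(1)] by (simp add: smooth_step_def divide_simps algebra_simps)
qed

lemma Dk_on_smooth_step:
  assumes "0 < M"
  shows "Dk_on n UNIV (smooth_step M)"
proof -
  have 1: "Dk_on n UNIV (\<lambda>s. flat 1 (2 * M - s))" "Dk_on n UNIV (\<lambda>s. flat 1 (s - M))"
    using Dk_on_affine[OF Dk_on_flat, of n 1 "-1" "2 * M"] Dk_on_affine[OF Dk_on_flat, of n 1 1 "- M"]
    by simp_all
  have "Dk_on n UNIV (\<lambda>s. flat 1 (2 * M - s) * inverse (flat 1 (2 * M - s) + flat 1 (s - M)))"
    using smooth_step_denominator[OF assms] by (intro Dk_on_mult Dk_on_inverse Dk_on_add 1) (auto simp: less_le)
  also have "(\<lambda>s. flat 1 (2 * M - s) * inverse (flat 1 (2 * M - s) + flat 1 (s - M))) = smooth_step M"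
    by (auto simp: smooth_step_def divide_inverse)
  finally show ?thesis .
qed

lemma continuous_antiderivative:
  fixes \<kappa> :: "real \<Rightarrow> real"
  assumes "continuous_on UNIV \<kappa>"
  obtains \<Phi> where "\<And>s. (\<Phi> has_real_derivative \<kappa> s) (at s)"
proof
  fix s :: real
  \<comment> \<open>The interval contains the base point 0 and has s in its interior, so the
    one-sided statement at its ends never interferes.\<close>
  have "((\<lambda>u. LBINT y=ereal 0..ereal u. \<kappa> y) has_vector_derivative \<kappa> s) (at s within {- \<bar>s\<bar> - 1..\<bar>s\<bar> + 1})"
    by (rule interval_integral_FTC2) (auto intro: continuous_on_subset[OF assms subset_UNIV])
  moreover have "at s within {- \<bar>s\<bar> - 1..\<bar>s\<bar> + 1} = at s"
    by (intro at_within_interior) auto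
  ultimately show "((\<lambda>u. LBINT y=ereal 0..ereal u. \<kappa> y) has_real_derivative \<kappa> s) (at s)"
    by (simp add: has_real_derivative_iff_has_vector_derivative)
qed

text \<open>An antiderivative of \<open>smooth_step M\<close>, normalised to fix M. Slope 1 up to M
  gives the identity there, slope 0 beyond 2 M gives a constant, and the decreasing slope gives the
  tangent inequality, which is the form in which concavity is used.\<close>

lemma smooth_concave_truncation:
  assumes M: "0 < M"
  obtains \<phi> where "\<And>n. Dk_on n UNIV \<phi>"
    "\<And>s. (\<phi> has_real_derivative smooth_step M s) (at s)"
    "\<And>s. s \<le> M \<Longrightarrow> \<phi> s = s" "\<And>s. 2 * M \<le> s \<Longrightarrow> \<phi> s = \<phi> (2 * M)"
    "\<And>r s. \<phi> s \<le> \<phi> r + smooth_step M r * (s - r)"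
    "\<And>r s. r \<le> s \<Longrightarrow> \<phi> r \<le> \<phi> s"
proof -
  have cont: "continuous_on UNIV (smooth_step M)" using Dk_on_smooth_step[OF M, of 0] by simp
  obtain \<Phi> where \<Phi>: "\<And>s. (\<Phi> has_real_derivative smooth_step M s) (at s)"
    using continuous_antiderivative[OF cont] by blast
  define \<phi> where "\<phi> s = \<Phi> s - \<Phi> M + M" for s
  have \<phi>: "(\<phi> has_real_derivative smooth_step M s) (at s)" for s
    unfolding \<phi>_def by (auto intro!: derivative_eq_intros \<Phi>)
  have mvt: "\<exists>z\<ge>r. z \<le> s \<and> \<phi> s - \<phi> r = (s - r) * smooth_step M z" if "r \<le> s" for r s
  proof (cases "r = s")
    case False
    with that have "r < s" by simp
    from MVT2[OF this \<phi>] show ?thesis using less_imp_le by metis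
  qed auto
  show ?thesis
  proof (rule that[of \<phi>])
    show "Dk_on n UNIV \<phi>" for n
      by (rule Dk_on_mono_Suc) (rule Dk_on_SucI[OF \<phi> Dk_on_smooth_step[OF M]])
    show "\<phi> s = s" if le: "s \<le> M" for s
    proof -
      obtain z where "z \<le> M" "\<phi> M - \<phi> s = (M - s) * smooth_step M z" using mvt[OF le] by blast
      then show ?thesis using smooth_step_eq_1[OF M, of z] by (simp add: \<phi>_def)
    qed
    show "\<phi> s = \<phi> (2 * M)" if le: "2 * M \<le> s" for s
    proof -
      obtain z where "2 * M \<le> z" "\<phi> s - \<phi> (2 * M) = (s - 2 * M) * smooth_step M z"
        using mvt[OF le] by blast
      then show ?thesis using smooth_step_eq_0[of M z] by simp
    qed
    show "\<phi> r \<le> \<phi> s" if le: "r \<le> s" for r s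
    proof -
      obtain z where "\<phi> s - \<phi> r = (s - r) * smooth_step M z" using mvt[OF le] by blast
      moreover have "0 \<le> (s - r) * smooth_step M z"
        using le smooth_step_bounds[OF M, of z] by (intro mult_nonneg_nonneg) auto
      ultimately show ?thesis by linarith
    qed
    show "\<phi> s \<le> \<phi> r + smooth_step M r * (s - r)" for r s
    proof (cases "r \<le> s")
      case True
      then obtain z where z: "r \<le> z" "\<phi> s - \<phi> r = (s - r) * smooth_step M z" using mvt[of r s] by blast
      then have "(s - r) * smooth_step M z \<le> (s - r) * smooth_step M r"
        using True smooth_step_antimono[OF M] by (intro mult_left_mono) auto
      with z show ?thesis by (simp add: mult.commute)
    next
      case False
      then obtain z where z: "z \<le> r" "\<phi> r - \<phi> s = (r - s) * smooth_step M z" using mvt[of s r] by auto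
      then have "(r - s) * smooth_step M r \<le> (r - s) * smooth_step M z"
        using False smooth_step_antimono[OF M] by (intro mult_left_mono) auto
      with z show ?thesis by (simp add: algebra_simps)
    qed
  qed (rule \<phi>)
qed

section \<open>Dunkl operators on continuously differentiable functions\<close>

definition grad :: "(real ^ 'n \<Rightarrow> real) \<Rightarrow> real ^ 'n \<Rightarrow> real ^ 'n" where
  "grad f x = (\<chi> i. frechet_derivative f (at x) (axis i 1))"

lemma frechet_derivative_eq_grad:
  assumes "Ck_on 1 UNIV f"
  shows "frechet_derivative f (at x) v = grad f x \<bullet> v"
proof -
  have "f differentiable (at x)" using assms by simp
  then have lin: "linear (frechet_derivative f (at x))"
    by (rule linear_frechet_derivative)
  have "frechet_derivative f (at x) v = frechet_derivative f (at x) (\<Sum>i\<in>UNIV. (v $ i) *\<^sub>R axis i 1)"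
    by (simp add: basis_expansion[of v, unfolded scalar_mult_eq_scaleR])
  also have "\<dots> = grad f x \<bullet> v"
    by (simp add: linear_sum[OF lin] linear_scale[OF lin] grad_def inner_vec_def mult.commute)
  finally show ?thesis .
qed

lemma has_derivative_grad:
  assumes "Ck_on 1 UNIV f"
  shows "(f has_derivative (\<lambda>v. grad f x \<bullet> v)) (at x)"
proof -
  have "(f has_derivative frechet_derivative f (at x)) (at x)"
    using assms by (simp add: frechet_derivative_works)
  also have "frechet_derivative f (at x) = (\<lambda>v. grad f x \<bullet> v)"
    using frechet_derivative_eq_grad[OF assms] by blast
  finally show ?thesis .
qed

lemma continuous_on_grad:
  assumes "Ck_on 1 UNIV f"
  shows "continuous_on A (grad f)"
  using assms unfolding grad_def
  by (intro continuous_on_vec_lambda) (auto intro: continuous_on_subset)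

lemma C1_continuous_on: "Ck_on 1 UNIV f \<Longrightarrow> continuous_on A f"
  by (auto intro!: continuous_at_imp_continuous_on differentiable_imp_continuous_within)

lemma grad_mean_value:
  assumes "Ck_on 1 UNIV f"
  shows "\<exists>\<xi>\<in>closed_segment x y. f y - f x = grad f \<xi> \<bullet> (y - x)"
proof -
  have d: "((\<lambda>s. f (x + s *\<^sub>R (y - x))) has_real_derivative grad f (x + s *\<^sub>R (y - x)) \<bullet> (y - x)) (at s)" for s
  proof -
    have "((\<lambda>s. x + s *\<^sub>R (y - x)) has_derivative (\<lambda>t. t *\<^sub>R (y - x))) (at s)"
      by (auto intro!: derivative_eq_intros)
    from has_derivative_compose[OF this has_derivative_grad[OF assms]]
    show ?thesis by (simp add: has_field_derivative_def mult_commute_abs)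
  qed
  obtain s where s: "0 < s" "s < 1"
    "f (x + 1 *\<^sub>R (y - x)) - f (x + 0 *\<^sub>R (y - x)) = (1 - 0) * (grad f (x + s *\<^sub>R (y - x)) \<bullet> (y - x))"
    using MVT2[of 0 1, OF _ d] by auto
  then show ?thesis
    by (intro bexI[of _ "x + s *\<^sub>R (y - x)"])
      (auto simp: closed_segment_def algebra_simps intro!: exI[of _ s])
qed

lemma grad_lipschitz:
  assumes "Ck_on 1 UNIV f" "\<And>x. norm (grad f x) \<le> B"
  shows "\<bar>f y - f x\<bar> \<le> B * norm (y - x)"
proof -
  obtain \<xi> where \<xi>: "f y - f x = grad f \<xi> \<bullet> (y - x)"
    using grad_mean_value[OF assms(1)] by blast
  have "\<bar>f y - f x\<bar> \<le> norm (grad f \<xi>) * norm (y - x)"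
    unfolding \<xi> by (rule Cauchy_Schwarz_ineq2)
  also have "\<dots> \<le> B * norm (y - x)" by (intro mult_right_mono assms(2)) simp
  finally show ?thesis .
qed

section \<open>Reflections and the finite reflection group\<close>

lemma linear_reflection: "linear (reflection \<alpha>)"
  by (intro linearI) (auto simp: reflection_def inner_add_right algebra_simps add_divide_distrib)

lemma norm_reflection: "norm (reflection \<alpha> x) = norm x"
proof (cases "\<alpha> = 0")
  case False
  then have "reflection \<alpha> x \<bullet> reflection \<alpha> x = x \<bullet> x"
    by (simp add: reflection_def inner_diff_left inner_diff_right inner_commute field_simps)
  then show ?thesis by (simp add: norm_eq_sqrt_inner)
qed (simp add: reflection_def)

lemma dist_reflection: "dist (reflection \<alpha> x) (reflection \<alpha> y) = dist x y"
  using norm_reflection[of \<alpha> "x - y"] by (simp add: dist_norm linear_diff[OF linear_reflection])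

lemma continuous_on_reflection: "continuous_on A (reflection \<alpha>)"
  by (rule linear_continuous_on) (simp add: linear_conv_bounded_linear[symmetric] linear_reflection)

lemma reflection_group_linear: "g \<in> reflection_group R \<Longrightarrow> linear g"
proof (induction rule: reflection_group.induct)
  case id
  then show ?case by (rule linear_id)
next
  case (comp \<alpha> g)
  then show ?case by (intro linear_compose linear_reflection)
qed

text \<open>An element is determined by its restriction to R: it is linear, so it is known on
  \<open>span R\<close>, and it fixes every vector orthogonal to R. These restrictions are self-maps
  of the finite set R.\<close>

lemma finite_reflection_group:
  fixes R :: "(real ^ 'n) set"
  assumes "root_system R"
  shows "finite (reflection_group R)"
proof -
  have R: "finite R" "\<And>\<alpha>. \<alpha> \<in> R \<Longrightarrow> reflection \<alpha> ` R = R"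
    using assms by (auto simp: root_system_def)
  have perm: "g ` R \<subseteq> R" if "g \<in> reflection_group R" for g
    using that
  proof (induction rule: reflection_group.induct)
    case (comp \<alpha> g)
    have "reflection \<alpha> ` (g ` R) \<subseteq> reflection \<alpha> ` R" using comp by (intro image_mono)
    then show ?case using R(2)[OF comp(1)] by (simp add: image_comp)
  qed simp
  have fixes_orth: "g z = z" if "g \<in> reflection_group R" "\<And>\<alpha>. \<alpha> \<in> R \<Longrightarrow> \<alpha> \<bullet> z = 0" for g z
    using that by (induction rule: reflection_group.induct) (auto simp: reflection_def)
  have "inj_on (\<lambda>g. restrict g R) (reflection_group R)"
  proof (rule inj_onI)
    fix g h assume gh: "g \<in> reflection_group R" "h \<in> reflection_group R" "restrict g R = restrict h R"
    then have eq: "g \<alpha> = h \<alpha>" if "\<alpha> \<in> R" for \<alpha> using that by (metis restrict_apply')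
    have lin: "linear g" "linear h" using gh by (auto intro: reflection_group_linear)
    show "g = h"
    proof
      fix x
      obtain y z where yz: "y \<in> span R" "\<And>w. w \<in> span R \<Longrightarrow> orthogonal z w" "x = y + z"
        using orthogonal_subspace_decomp_exists[of R x] by blast
      have "g y = h y" using linear_eq_on[OF lin yz(1)] eq by blast
      moreover have "\<alpha> \<bullet> z = 0" if "\<alpha> \<in> R" for \<alpha>
        using yz(2)[OF span_base[OF that]] by (simp add: orthogonal_def inner_commute)
      then have "g z = z" "h z = z" using fixes_orth gh by auto
      ultimately show "g x = h x" by (simp add: yz(3) linear_add[OF lin(1)] linear_add[OF lin(2)])
    qed
  qed
  moreover have "(\<lambda>g. restrict g R) ` reflection_group R \<subseteq> R \<rightarrow>\<^sub>E R"
  proof (rule image_subsetI)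
    fix g assume "g \<in> reflection_group R"
    from perm[OF this] show "restrict g R \<in> R \<rightarrow>\<^sub>E R"
      by (simp add: restrict_PiE_iff image_subset_iff)
  qed
  then have "finite ((\<lambda>g. restrict g R) ` reflection_group R)"
    by (rule finite_subset) (intro finite_PiE R)
  ultimately show ?thesis by (rule finite_imageD[rotated])
qed

section \<open>Difference quotients and the Dunkl gradient\<close>

locale dunkl_data =
  fixes R Rp :: "(real ^ 'n) set" and k :: "real ^ 'n \<Rightarrow> real"
  assumes root_system: "root_system R" and normalised: "normalised R"
    and positive_subsystem: "positive_subsystem R Rp"
    and multiplicity: "multiplicity_function R k"
begin

abbreviation "\<gamma> \<equiv> (\<Sum>\<alpha>\<in>Rp. k \<alpha>)"

lemma Rp_subset: "Rp \<subseteq> R"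
  using positive_subsystem by (auto simp: positive_subsystem_def)

lemma finite_Rp: "finite Rp"
  using root_system Rp_subset by (auto simp: root_system_def intro: finite_subset)

lemma norm_root: "\<alpha> \<in> Rp \<Longrightarrow> norm \<alpha> = sqrt 2"
  using normalised Rp_subset by (metis normalised_def norm_ge_zero real_sqrt_unique subsetD)

lemma inner_root: "\<alpha> \<in> Rp \<Longrightarrow> \<alpha> \<bullet> \<alpha> = 2"
  by (simp add: dot_square_norm norm_root)

lemma k_nonneg: "\<alpha> \<in> Rp \<Longrightarrow> 0 \<le> k \<alpha>"
  using multiplicity Rp_subset by (auto simp: multiplicity_function_def)

lemma reflection_root: "\<alpha> \<in> Rp \<Longrightarrow> reflection \<alpha> x = x - (\<alpha> \<bullet> x) *\<^sub>R \<alpha>"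
  by (simp add: reflection_def inner_root)

text \<open>By the normalisation, x minus its reflection is \<alpha> times the denominator of the
  quotient, so the mean value theorem leaves a directional derivative along \<alpha>, free of the
  singular denominator.\<close>

lemma quotient_off_hyperplane:
  assumes \<alpha>: "\<alpha> \<in> Rp" and C1: "Ck_on 1 UNIV f" and x: "\<alpha> \<bullet> x \<noteq> 0"
  shows "\<exists>\<xi>\<in>closed_segment x (reflection \<alpha> x). (f x - f (reflection \<alpha> x)) / (\<alpha> \<bullet> x) = grad f \<xi> \<bullet> \<alpha>"
proof -
  obtain \<xi> where "\<xi> \<in> closed_segment (reflection \<alpha> x) x"
    "f x - f (reflection \<alpha> x) = grad f \<xi> \<bullet> (x - reflection \<alpha> x)"
    using grad_mean_value[OF C1] by blast
  then show ?thesis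
    using x by (intro bexI[of _ \<xi>]) (auto simp: reflection_root[OF \<alpha>] closed_segment_commute)
qed

text \<open>The reflection is an isometry fixing x, so both endpoints lie in a ball about x, which
  is convex. With x near y this gives the continuous extension; with x = 0 it confines mean value
  points to a centred ball.\<close>

lemma dist_segment_reflection:
  assumes "\<alpha> \<in> Rp" "\<alpha> \<bullet> x = 0" "\<xi> \<in> closed_segment y (reflection \<alpha> y)"
  shows "dist \<xi> x \<le> dist y x"
proof -
  have "reflection \<alpha> x = x" using assms by (simp add: reflection_root)
  then have "dist (reflection \<alpha> y) x = dist y x" using dist_reflection[of \<alpha> y x] by simp
  then have "closed_segment y (reflection \<alpha> y) \<subseteq> cball x (dist y x)"
    by (intro closed_segment_subset) (auto simp: dist_commute)
  then show ?thesis using assms(3) by (auto simp: dist_commute)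
qed

lemma dunkl_quotient_on_hyperplane:
  assumes \<alpha>: "\<alpha> \<in> Rp" and C1: "Ck_on 1 UNIV f" and x: "\<alpha> \<bullet> x = 0"
  shows "dunkl_quotient \<alpha> f x = grad f x \<bullet> \<alpha>"
proof -
  have "((\<lambda>y. (f y - f (reflection \<alpha> y)) / (\<alpha> \<bullet> y)) \<longlongrightarrow> grad f x \<bullet> \<alpha>) (at x within {y. \<alpha> \<bullet> y \<noteq> 0})"
    unfolding tendsto_iff
  proof (intro allI impI)
    fix e :: real assume "0 < e"
    have "continuous_on UNIV (\<lambda>z. grad f z \<bullet> \<alpha>)"
      by (intro continuous_intros continuous_on_grad C1)
    with \<open>0 < e\<close> obtain d where d: "0 < d"
      "\<And>z. dist z x < d \<Longrightarrow> dist (grad f z \<bullet> \<alpha>) (grad f x \<bullet> \<alpha>) < e"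
      unfolding continuous_on_iff by (metis UNIV_I)
    have "dist ((f y - f (reflection \<alpha> y)) / (\<alpha> \<bullet> y)) (grad f x \<bullet> \<alpha>) < e"
      if "\<alpha> \<bullet> y \<noteq> 0" "dist y x < d" for y
      using quotient_off_hyperplane[OF \<alpha> C1 that(1)] dist_segment_reflection[OF \<alpha> x, of _ y] that(2) d(2)
      by fastforce
    then show "\<forall>\<^sub>F y in at x within {y. \<alpha> \<bullet> y \<noteq> 0}.
        dist ((f y - f (reflection \<alpha> y)) / (\<alpha> \<bullet> y)) (grad f x \<bullet> \<alpha>) < e"
      using d(1) by (auto simp: eventually_at)
  qed
  moreover have "at x within {y. \<alpha> \<bullet> y \<noteq> 0} \<noteq> bot"
  proof -
    have "x islimpt {y. \<alpha> \<bullet> y \<noteq> 0}"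
      unfolding islimpt_approachable
    proof (intro allI impI)
      fix e :: real assume "0 < e"
      \<comment> \<open>The witness moves along \<alpha>: the inner product becomes e, while the
        displacement has length (e/2) sqrt 2 < e. That x is a limit point makes the value of
        \<open>Lim\<close> unique.\<close>
      then show "\<exists>y\<in>{y. \<alpha> \<bullet> y \<noteq> 0}. y \<noteq> x \<and> dist y x < e"
        using x inner_root[OF \<alpha>] norm_root[OF \<alpha>]
        by (intro bexI[of _ "x + (e / 2) *\<^sub>R \<alpha>"])
          (auto simp: dist_norm inner_add_right sqrt2_less_2)
    qed
    then show ?thesis by (simp add: trivial_limit_within)
  qed
  ultimately show ?thesis using x by (simp add: dunkl_quotient_def tendsto_Lim)
qed

lemma dunkl_quotient_mean:
  assumes \<alpha>: "\<alpha> \<in> Rp" and C1: "Ck_on 1 UNIV f"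
  shows "\<exists>\<xi>\<in>closed_segment x (reflection \<alpha> x). dunkl_quotient \<alpha> f x = grad f \<xi> \<bullet> \<alpha>"
proof (cases "\<alpha> \<bullet> x = 0")
  case True
  then show ?thesis using dunkl_quotient_on_hyperplane[OF \<alpha> C1] by auto
next
  case False
  then show ?thesis using quotient_off_hyperplane[OF \<alpha> C1] by (simp add: dunkl_quotient_def)
qed

lemma continuous_on_dunkl_quotient:
  assumes \<alpha>: "\<alpha> \<in> Rp" and C1: "Ck_on 1 UNIV f"
  shows "continuous_on UNIV (dunkl_quotient \<alpha> f)"
proof (rule continuous_at_imp_continuous_on, intro ballI)
  fix x
  show "isCont (dunkl_quotient \<alpha> f) x"
  proof (cases "\<alpha> \<bullet> x = 0")
    case True
    show ?thesis unfolding continuous_at_eps_delta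
    proof (intro allI impI)
      fix e :: real assume "0 < e"
      have "continuous_on UNIV (\<lambda>z. grad f z \<bullet> \<alpha>)"
        by (intro continuous_intros continuous_on_grad C1)
      with \<open>0 < e\<close> obtain d where d: "0 < d"
        "\<And>z. dist z x < d \<Longrightarrow> dist (grad f z \<bullet> \<alpha>) (grad f x \<bullet> \<alpha>) < e"
        unfolding continuous_on_iff by (metis UNIV_I)
      have "dist (dunkl_quotient \<alpha> f y) (dunkl_quotient \<alpha> f x) < e" if "dist y x < d" for y
        using dunkl_quotient_mean[OF \<alpha> C1, of y] dist_segment_reflection[OF \<alpha> True, of _ y] that d(2)
        unfolding dunkl_quotient_on_hyperplane[OF \<alpha> C1 True] by fastforce
      with d(1) show "\<exists>d>0. \<forall>y. dist y x < d \<longrightarrow> dist (dunkl_quotient \<alpha> f y) (dunkl_quotient \<alpha> f x) < e"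
        by blast
    qed
  next
    case False
    let ?S = "{y. \<alpha> \<bullet> y \<noteq> 0}"
    have "open ?S" by (intro open_Collect_neq continuous_intros)
    have "continuous_on ?S (\<lambda>y. (f y - f (reflection \<alpha> y)) / (\<alpha> \<bullet> y))"
      by (intro continuous_intros C1_continuous_on[OF C1] continuous_on_reflection
          continuous_on_compose2[OF C1_continuous_on[OF C1, of UNIV]]) auto
    then have "continuous_on ?S (dunkl_quotient \<alpha> f)"
      by (rule continuous_on_cong[THEN iffD1, rotated 2]) (auto simp: dunkl_quotient_def)
    then show ?thesis
      using \<open>open ?S\<close> False by (simp add: continuous_on_eq_continuous_at)
  qed
qed

text \<open>Only the gradient on the ball of radius \<open>norm x\<close> enters, since 0 lies on
  every reflecting hyperplane. This locality allows the bound to be used at a maximum point over a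
  ball.\<close>

lemma abs_dunkl_quotient_le:
  assumes \<alpha>: "\<alpha> \<in> Rp" and C1: "Ck_on 1 UNIV f"
    and B: "\<And>y. norm y \<le> norm x \<Longrightarrow> norm (grad f y) \<le> B"
  shows "\<bar>dunkl_quotient \<alpha> f x\<bar> \<le> B * sqrt 2"
proof -
  obtain \<xi> where \<xi>: "\<xi> \<in> closed_segment x (reflection \<alpha> x)" "dunkl_quotient \<alpha> f x = grad f \<xi> \<bullet> \<alpha>"
    using dunkl_quotient_mean[OF \<alpha> C1] by blast
  have "norm \<xi> \<le> norm x"
    using dist_segment_reflection[OF \<alpha>, of 0 \<xi> x] \<xi>(1) by simp
  then have "norm (grad f \<xi>) \<le> B" by (rule B)
  then have "norm (grad f \<xi>) * norm \<alpha> \<le> B * sqrt 2"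
    by (simp add: norm_root[OF \<alpha>])
  then show ?thesis
    unfolding \<xi>(2) using Cauchy_Schwarz_ineq2[of "grad f \<xi>" \<alpha>] by simp
qed

lemma dunkl_gradient_eq:
  "dunkl_gradient Rp k f x = grad f x + (\<Sum>\<alpha>\<in>Rp. (k \<alpha> * dunkl_quotient \<alpha> f x) *\<^sub>R \<alpha>)"
  by (simp add: vec_eq_iff dunkl_gradient_def dunkl_op_def grad_def mult_ac)

lemma norm_dunkl_part_le:
  assumes C1: "Ck_on 1 UNIV f" and B: "\<And>y. norm y \<le> norm x \<Longrightarrow> norm (grad f y) \<le> B"
  shows "norm (\<Sum>\<alpha>\<in>Rp. (k \<alpha> * dunkl_quotient \<alpha> f x) *\<^sub>R \<alpha>) \<le> 2 * \<gamma> * B"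
proof -
  have "norm (\<Sum>\<alpha>\<in>Rp. (k \<alpha> * dunkl_quotient \<alpha> f x) *\<^sub>R \<alpha>) \<le> (\<Sum>\<alpha>\<in>Rp. 2 * k \<alpha> * B)"
  proof (rule sum_norm_le)
    fix \<alpha> assume \<alpha>: "\<alpha> \<in> Rp"
    have "norm ((k \<alpha> * dunkl_quotient \<alpha> f x) *\<^sub>R \<alpha>) = k \<alpha> * \<bar>dunkl_quotient \<alpha> f x\<bar> * sqrt 2"
      using k_nonneg[OF \<alpha>] by (simp add: norm_root[OF \<alpha>] abs_mult)
    also have "\<dots> \<le> k \<alpha> * (B * sqrt 2) * sqrt 2"
      using k_nonneg[OF \<alpha>] abs_dunkl_quotient_le[OF \<alpha> C1 B]
      by (intro mult_right_mono mult_left_mono) auto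
    also have "k \<alpha> * (B * sqrt 2) * sqrt 2 = k \<alpha> * B * (sqrt 2 * sqrt 2)"
      by (simp only: mult.assoc)
    also have "\<dots> = 2 * k \<alpha> * B" by (simp only: real_sqrt_mult_self abs_numeral mult.commute mult.left_commute)
    finally show "norm ((k \<alpha> * dunkl_quotient \<alpha> f x) *\<^sub>R \<alpha>) \<le> 2 * k \<alpha> * B" .
  qed
  then show ?thesis by (simp add: sum_distrib_left sum_distrib_right)
qed

text \<open>The gradient hypothesis evaluates the semigroup at
  \<open>Bcontfun (sym_Gamma R Rp k f)\<close>; this term stands for the intended function only once
  membership in \<open>bcontfun\<close> is known.\<close>

lemma sym_Gamma_bcontfun:
  assumes C1: "Ck_on 1 UNIV f" and B: "\<And>x. norm (grad f x) \<le> B"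
  shows "sym_Gamma R Rp k f \<in> bcontfun"
proof -
  have cont: "continuous_on UNIV (dunkl_gradient Rp k f)"
    unfolding dunkl_gradient_eq
    by (intro continuous_intros continuous_on_grad continuous_on_dunkl_quotient C1)
  have "continuous_on UNIV (\<lambda>x. dunkl_gradient Rp k f (g x))" if "g \<in> reflection_group R" for g
    using reflection_group_linear[OF that]
    by (intro continuous_on_compose2[OF cont] linear_continuous_on) (auto simp: linear_conv_bounded_linear)
  then have 1: "continuous_on UNIV (sym_Gamma R Rp k f)"
    unfolding sym_Gamma_def by (intro continuous_intros) auto
  have "norm (dunkl_gradient Rp k f x) \<le> B + 2 * \<gamma> * B" for x
    unfolding dunkl_gradient_eq using norm_dunkl_part_le[OF C1, of x B] B
    by (intro norm_triangle_mono) auto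
  then have "sym_Gamma R Rp k f x \<le> (\<Sum>g\<in>reflection_group R. (B + 2 * \<gamma> * B)\<^sup>2)" for x
    unfolding sym_Gamma_def by (intro sum_mono power_mono) auto
  moreover have "0 \<le> sym_Gamma R Rp k f x" for x
    unfolding sym_Gamma_def by (intro sum_nonneg) auto
  ultimately show ?thesis
    using 1 by (intro bcontfun_normI[where b="\<Sum>g\<in>reflection_group R. (B + 2 * \<gamma> * B)\<^sup>2"]) auto
qed

lemma norm_dunkl_gradient_le_sym_Gamma: "(norm (dunkl_gradient Rp k f x))\<^sup>2 \<le> sym_Gamma R Rp k f x"
proof -
  \<comment> \<open>The gradient at x itself is the summand of the identity; the redundant
    abstraction displays that group element for \<open>member_le_sum\<close>.\<close>
  have "(norm (dunkl_gradient Rp k f ((\<lambda>a. a) x)))\<^sup>2 \<le> sym_Gamma R Rp k f x"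
    unfolding sym_Gamma_def
    by (rule member_le_sum[where f="\<lambda>g. (norm (dunkl_gradient Rp k f (g x)))\<^sup>2"])
      (simp_all add: reflection_group.id[unfolded id_def] finite_reflection_group[OF root_system])
  then show ?thesis by simp
qed

text \<open>On a ball the reflections preserve the region, so at a maximum point of the norm of the
  ordinary gradient the reflection part of the Dunkl gradient is at most \<open>2 * \<gamma> < 1\<close> times
  the ordinary gradient.\<close>

lemma norm_grad_le:
  assumes C1: "Ck_on 1 UNIV f" and \<gamma>: "\<gamma> < 1 / 2"
    and e: "\<And>x. norm (dunkl_gradient Rp k f x) \<le> e"
  shows "norm (grad f x) \<le> e / (1 - 2 * \<gamma>)"
proof -
  have "continuous_on (cball 0 (norm x)) (\<lambda>y. norm (grad f y))"
    by (intro continuous_intros continuous_on_grad C1)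
  from continuous_attains_sup[OF compact_cball _ this]
  obtain z where z: "norm z \<le> norm x" "\<And>y. norm y \<le> norm x \<Longrightarrow> norm (grad f y) \<le> norm (grad f z)"
    by (auto simp: dist_norm)
  have eq: "grad f z = dunkl_gradient Rp k f z - (\<Sum>\<alpha>\<in>Rp. (k \<alpha> * dunkl_quotient \<alpha> f z) *\<^sub>R \<alpha>)"
    by (simp add: dunkl_gradient_eq)
  have "norm (grad f z) \<le> norm (dunkl_gradient Rp k f z) +
      norm (\<Sum>\<alpha>\<in>Rp. (k \<alpha> * dunkl_quotient \<alpha> f z) *\<^sub>R \<alpha>)"
    by (subst eq) (rule norm_triangle_ineq4)
  also have "\<dots> \<le> e + 2 * \<gamma> * norm (grad f z)"
    using z by (intro add_mono e norm_dunkl_part_le[OF C1]) (auto intro: order_trans)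
  finally have "norm (grad f z) \<le> e + 2 * \<gamma> * norm (grad f z)" .
  then have "norm (grad f z) \<le> e / (1 - 2 * \<gamma>)"
    using \<gamma> by (simp add: pos_le_divide_eq algebra_simps)
  then show ?thesis using z(2)[of x] by simp
qed

end

text \<open>The points at which one Dunkl operator sees only values of its argument on U. Roots of
  multiplicity zero are left out, since the Lyapunov condition controls reflected values only for
  the others.\<close>

definition reflection_interior ::
  "(real ^ 'n) set \<Rightarrow> (real ^ 'n \<Rightarrow> real) \<Rightarrow> (real ^ 'n) set \<Rightarrow> (real ^ 'n) set" where
  "reflection_interior Rp k U = {y \<in> U. \<forall>\<alpha>\<in>Rp. k \<alpha> \<noteq> 0 \<longrightarrow> reflection \<alpha> y \<in> U}"

lemma open_reflection_interior:
  assumes "finite Rp" "open U"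
  shows "open (reflection_interior Rp k U)"
proof -
  have "reflection_interior Rp k U = U \<inter> (\<Inter>\<alpha>\<in>{\<alpha>\<in>Rp. k \<alpha> \<noteq> 0}. reflection \<alpha> -` U)"
    by (auto simp: reflection_interior_def)
  also have "open \<dots>"
    using assms by (intro open_Int open_INT ballI open_vimage continuous_on_reflection) auto
  finally show ?thesis .
qed

text \<open>Comparing differences rather than the functions makes additive constants cancel. The two
  limits are compared by their defining predicates, so the equality holds whether or not they
  exist.\<close>

lemma dunkl_quotient_cong:
  assumes "open U" "y \<in> U" "\<And>z. z \<in> U \<Longrightarrow> f z - f (reflection \<alpha> z) = h z - h (reflection \<alpha> z)"
  shows "dunkl_quotient \<alpha> f y = dunkl_quotient \<alpha> h y"
proof -
  have "\<forall>\<^sub>F z in at y within {z. \<alpha> \<bullet> z \<noteq> 0}.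
      (f z - f (reflection \<alpha> z)) / (\<alpha> \<bullet> z) = (h z - h (reflection \<alpha> z)) / (\<alpha> \<bullet> z)"
    unfolding eventually_at_topological using assms by auto
  then have "((\<lambda>z. (f z - f (reflection \<alpha> z)) / (\<alpha> \<bullet> z)) \<longlongrightarrow> l) (at y within {z. \<alpha> \<bullet> z \<noteq> 0}) \<longleftrightarrow>
      ((\<lambda>z. (h z - h (reflection \<alpha> z)) / (\<alpha> \<bullet> z)) \<longlongrightarrow> l) (at y within {z. \<alpha> \<bullet> z \<noteq> 0})" for l
    by (rule filterlim_cong[OF refl refl])
  then have "Lim (at y within {z. \<alpha> \<bullet> z \<noteq> 0}) (\<lambda>z. (f z - f (reflection \<alpha> z)) / (\<alpha> \<bullet> z)) =
      Lim (at y within {z. \<alpha> \<bullet> z \<noteq> 0}) (\<lambda>z. (h z - h (reflection \<alpha> z)) / (\<alpha> \<bullet> z))"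
    unfolding Topological_Spaces.Lim_def by presburger
  then show ?thesis
    using assms(3)[OF assms(2)] by (simp add: dunkl_quotient_def)
qed

lemma dunkl_op_cong:
  assumes "finite Rp" "open U" "\<And>y. y \<in> U \<Longrightarrow> f y = h y - c" "y \<in> reflection_interior Rp k U"
  shows "dunkl_op Rp k i f y = dunkl_op Rp k i h y"
proof -
  have y: "y \<in> U" using assms(4) by (simp add: reflection_interior_def)
  have "frechet_derivative f (at y) = frechet_derivative h (at y)"
    using assms y by (intro frechet_derivative_cong_open[of U])
  moreover have terms: "k \<alpha> * \<alpha> $ i * dunkl_quotient \<alpha> f y = k \<alpha> * \<alpha> $ i * dunkl_quotient \<alpha> h y"
    if "\<alpha> \<in> Rp" for \<alpha>
  proof (cases "k \<alpha> = 0")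
    case False
    have "dunkl_quotient \<alpha> f y = dunkl_quotient \<alpha> h y"
    proof (rule dunkl_quotient_cong)
      show "open (reflection_interior Rp k U)" using assms by (intro open_reflection_interior)
      show "f z - f (reflection \<alpha> z) = h z - h (reflection \<alpha> z)"
        if "z \<in> reflection_interior Rp k U" for z
        using that False \<open>\<alpha> \<in> Rp\<close> assms(3) by (simp add: reflection_interior_def)
    qed (rule assms(4))
    then show ?thesis by simp
  qed simp
  ultimately show ?thesis
    unfolding dunkl_op_def by (intro arg_cong2[of _ _ _ _ "(+)"] sum.cong refl terms) simp
qed

text \<open>The first Dunkl operator removes the constant c, so the second one compares functions
  that coincide outright. Two nested operators reach the reflections of reflections, which is why
  the interior is taken twice.\<close>

lemma dunkl_L_cong:
  assumes "finite Rp" "open U" "\<And>y. y \<in> U \<Longrightarrow> f y = h y - c"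
    "x \<in> reflection_interior Rp k (reflection_interior Rp k U)"
  shows "dunkl_L Rp k b f x = dunkl_L Rp k b h x"
proof -
  let ?U = "reflection_interior Rp k U"
  have 1: "dunkl_op Rp k i f y = dunkl_op Rp k i h y" if "y \<in> ?U" for y i
    by (rule dunkl_op_cong[of _ U _ _ c]) (use assms that in auto)
  have "dunkl_op Rp k i (dunkl_op Rp k i f) x = dunkl_op Rp k i (dunkl_op Rp k i h) x" for i
    using 1 assms by (intro dunkl_op_cong[where U="?U" and c=0] open_reflection_interior) auto
  moreover have "x \<in> ?U" using assms(4) by (simp add: reflection_interior_def[of Rp k ?U])
  ultimately show ?thesis
    using 1 by (simp add: dunkl_L_def dunkl_laplacian_def dunkl_gradient_def)
qed

section \<open>Markov semigroups and their generators\<close>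

lemma nonincreasing_of_right_derivative:
  fixes w :: "real \<Rightarrow> real"
  assumes "0 \<le> T" "continuous_on {0..T} w"
    and der: "\<And>t. 0 \<le> t \<Longrightarrow> t < T \<Longrightarrow> (w has_real_derivative d t) (at_right t)"
    and le: "\<And>t. 0 \<le> t \<Longrightarrow> t < T \<Longrightarrow> d t \<le> 0"
  shows "w T \<le> w 0"
proof (rule field_le_epsilon)
  fix e :: real assume "0 < e"
  \<comment> \<open>Dividing by T + 1 keeps the slope positive and its total effect below e, also
    for T = 0.\<close>
  define a where "a = e / (T + 1)"
  have a: "0 < a" "a * T \<le> e"
    using \<open>0 < e\<close> assms(1) by (auto simp: a_def field_simps)
  define g where "g t = w t - a * t" for t
  have "g T \<le> g 0"
  proof (rule ccontr)
    assume gT: "\<not> g T \<le> g 0"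
    have cont: "continuous_on {0..T} g" unfolding g_def by (intro continuous_intros assms(2))
    define K where "K = {0..T} \<inter> g -` {..g 0}"
    have "closed K" unfolding K_def by (rule continuous_closed_preimage[OF cont]) auto
    then have "compact K"
      using compact_Int_closed[OF compact_Icc, of K 0 T] by (simp add: K_def Int_absorb2 flip: Int_assoc)
    moreover have "K \<noteq> {}" using assms(1) by (auto simp: K_def)
    ultimately obtain \<tau> where "\<tau> \<in> K" "\<And>t. t \<in> K \<Longrightarrow> t \<le> \<tau>"
      using compact_attains_sup by metis
    then have \<tau>: "\<tau> \<in> {0..T}" "g \<tau> \<le> g 0"
      "\<And>t. t \<in> {0..T} \<Longrightarrow> g t \<le> g 0 \<Longrightarrow> t \<le> \<tau>"
      by (simp_all add: K_def)
    have \<tau>T: "0 \<le> \<tau>" "\<tau> < T" using \<tau>(1,2) gT by (auto simp: less_le)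
    have "(g has_real_derivative d \<tau> - a) (at_right \<tau>)"
      unfolding g_def by (auto intro!: derivative_eq_intros der \<tau>T)
    moreover have "d \<tau> - a < 0" using le[OF \<tau>T] a by simp
    ultimately obtain \<delta> where \<delta>: "\<delta> > 0" "\<And>h. h > 0 \<Longrightarrow> h < \<delta> \<Longrightarrow> g (\<tau> + h) < g \<tau>"
      using has_real_derivative_neg_dec_right[of g "d \<tau> - a" \<tau> "{\<tau><..}"] by auto
    define h where "h = min (\<delta> / 2) (T - \<tau>)"
    have h: "0 < h" "h < \<delta>" "\<tau> + h \<le> T" using \<delta> \<tau>T by (auto simp: h_def)
    from \<delta>(2)[OF h(1,2)] \<tau>(2) have "g (\<tau> + h) \<le> g 0" by simp
    with \<tau>(3)[of "\<tau> + h"] h \<tau>T show False by auto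
  qed
  then show "w T \<le> w 0 + e" using a by (simp add: g_def)
qed

lemma gronwall_right_derivative:
  fixes u :: "real \<Rightarrow> real"
  assumes "0 \<le> T" "continuous_on {0..T} u" "0 < c" "0 \<le> A"
    and der: "\<And>t. 0 \<le> t \<Longrightarrow> t < T \<Longrightarrow> (u has_real_derivative v t) (at_right t)"
    and le: "\<And>t. 0 \<le> t \<Longrightarrow> t < T \<Longrightarrow> v t \<le> A - c * u t"
    and u0: "0 \<le> u 0"
  shows "u T \<le> u 0 + A / c"
proof -
  define w where "w t = exp (c * t) * (u t - A / c)" for t
  have "w T \<le> w 0"
  proof (rule nonincreasing_of_right_derivative[OF assms(1)])
    show "continuous_on {0..T} w" unfolding w_def by (intro continuous_intros assms(2))
    fix t assume t: "0 \<le> t" "t < T"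
    show "(w has_real_derivative exp (c * t) * (v t - (A - c * u t))) (at_right t)"
      unfolding w_def using \<open>0 < c\<close>
      by (auto intro!: derivative_eq_intros der t simp: field_simps)
    show "exp (c * t) * (v t - (A - c * u t)) \<le> 0"
      using le[OF t] by (intro mult_nonneg_nonpos) auto
  qed
  then have "u T - A / c \<le> exp (- (c * T)) * (u 0 - A / c)"
    by (simp add: w_def exp_minus field_simps)
  also have "\<dots> \<le> exp (- (c * T)) * u 0"
    using assms by (intro mult_left_mono) auto
  also have "\<dots> \<le> u 0"
    using assms by (intro mult_left_le_one_le) auto
  finally show ?thesis by simp
qed

locale markov =
  fixes P :: "real \<Rightarrow> ((real ^ 'n) \<Rightarrow>\<^sub>C real) \<Rightarrow> ((real ^ 'n) \<Rightarrow>\<^sub>C real)"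
  assumes markov: "markov_semigroup P"
begin

text \<open>The semigroup acting on plain functions; only meaningful for bounded continuous ones.\<close>

definition Q :: "real \<Rightarrow> (real ^ 'n \<Rightarrow> real) \<Rightarrow> real ^ 'n \<Rightarrow> real" where
  "Q t f = apply_bcontfun (P t (Bcontfun f))"

lemma Q_apply: "Q t (apply_bcontfun f) = apply_bcontfun (P t f)"
  by (simp add: Q_def apply_bcontfun_inverse)

lemma Q_bcontfun: "Q t f \<in> bcontfun"
  by (simp add: Q_def apply_bcontfun)

lemma Q_zero: "f \<in> bcontfun \<Longrightarrow> Q 0 f = f"
  using markov by (simp add: markov_semigroup_def Q_def Bcontfun_inverse)

lemma Q_semigroup: "0 \<le> s \<Longrightarrow> 0 \<le> t \<Longrightarrow> Q (s + t) f = Q s (Q t f)"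
  using markov by (simp add: markov_semigroup_def Q_def apply_bcontfun_inverse)

lemma linear_P: "0 \<le> t \<Longrightarrow> linear (P t)"
  using markov by (simp add: markov_semigroup_def)

lemma Q_const: "0 \<le> t \<Longrightarrow> Q t (\<lambda>_. c) x = c"
proof -
  assume t: "0 \<le> t"
  have "Bcontfun (\<lambda>_::real ^ 'n. c) = c *\<^sub>R const_bcontfun 1"
    by (rule bcontfun_eqI) (simp add: Bcontfun_inverse bcontfun_const)
  then show ?thesis
    using markov t by (simp add: Q_def linear_scale[OF linear_P] markov_semigroup_def)
qed

lemma Q_add:
  assumes "0 \<le> t" "f \<in> bcontfun" "g \<in> bcontfun"
  shows "Q t (\<lambda>x. f x + g x) x = Q t f x + Q t g x"
proof -
  have "Bcontfun (\<lambda>x. f x + g x) = Bcontfun f + Bcontfun g"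
    using assms by (intro bcontfun_eqI) (simp add: Bcontfun_inverse bcontfun_add)
  then show ?thesis using assms by (simp add: Q_def linear_add[OF linear_P])
qed

lemma Q_cmult:
  assumes "0 \<le> t" "f \<in> bcontfun"
  shows "Q t (\<lambda>x. c * f x) x = c * Q t f x"
proof -
  have "Bcontfun (\<lambda>x. c * f x) = c *\<^sub>R Bcontfun f"
    using assms by (intro bcontfun_eqI) (simp add: Bcontfun_inverse bcontfun_cmult)
  then show ?thesis using assms by (simp add: Q_def linear_scale[OF linear_P])
qed

lemma Q_diff:
  assumes "0 \<le> t" "f \<in> bcontfun" "g \<in> bcontfun"
  shows "Q t (\<lambda>x. f x - g x) x = Q t f x - Q t g x"
  using Q_add[OF assms(1,2) bcontfun_cmult[OF assms(3), of "-1"]] Q_cmult[OF assms(1,3), of "-1"]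
  by simp

lemma Q_nonneg:
  assumes "0 \<le> t" "f \<in> bcontfun" "\<And>x. 0 \<le> f x"
  shows "0 \<le> Q t f x"
  using markov assms by (simp add: markov_semigroup_def Q_def Bcontfun_inverse)

lemma Q_mono:
  assumes "0 \<le> t" "f \<in> bcontfun" "g \<in> bcontfun" "\<And>x. f x \<le> g x"
  shows "Q t f x \<le> Q t g x"
  using Q_nonneg[OF assms(1) bcontfun_diff[OF assms(3,2)], of x] assms by (simp add: Q_diff)

lemma abs_Q_le:
  assumes "0 \<le> t" "f \<in> bcontfun" "g \<in> bcontfun" "\<And>x. \<bar>f x\<bar> \<le> g x"
  shows "\<bar>Q t f x\<bar> \<le> Q t g x"
proof -
  have "Q t f x \<le> Q t g x"
    using assms(4) by (intro Q_mono assms(1-3)) (auto simp: abs_le_iff)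
  moreover have "Q t (\<lambda>x. (-1) * f x) x \<le> Q t g x"
    using assms(4) by (intro Q_mono assms(1-3) bcontfun_cmult) (auto simp: abs_le_iff)
  ultimately show ?thesis using Q_cmult[OF assms(1,2), of "-1" x] by simp
qed

lemma continuous_on_P: "continuous_on {0..} (\<lambda>t. apply_bcontfun (P t f) x)"
  using markov by (simp add: markov_semigroup_def)

lemma abs_P_le_norm: "0 \<le> t \<Longrightarrow> \<bar>apply_bcontfun (P t f) x\<bar> \<le> norm f"
  using abs_Q_le[of t "apply_bcontfun f" "\<lambda>_. norm f" x] norm_bounded[of f]
  by (simp add: Q_apply Q_const bcontfun_const apply_bcontfun)

text \<open>The generator gives a uniform limit at time 0. The increment at time t is
  \<open>P t\<close> applied to the increment at 0, and \<open>P t\<close> does not increase the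
  supremum norm, so the limit carries over to t.\<close>

lemma P_has_right_derivative:
  assumes fg: "(f, g) \<in> generator_graph P" and t: "0 \<le> t"
  shows "((\<lambda>t. apply_bcontfun (P t f) x) has_real_derivative apply_bcontfun (P t g) x) (at_right t)"
proof -
  have lim: "((\<lambda>h. (P h f - f) /\<^sub>R h) \<longlongrightarrow> g) (at_right 0)"
    using fg by (simp add: generator_graph_def)
  have "((\<lambda>h. (apply_bcontfun (P (h + t) f) x - apply_bcontfun (P t f) x) / h) \<longlongrightarrow>
      apply_bcontfun (P t g) x) (at_right 0)"
  proof (rule LIM_zero_cancel, rule Lim_null_comparison)
    show "((\<lambda>h. norm ((P h f - f) /\<^sub>R h - g)) \<longlongrightarrow> 0) (at_right 0)"
      using lim by (intro tendsto_norm_zero LIM_zero)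
    have "norm ((apply_bcontfun (P (h + t) f) x - apply_bcontfun (P t f) x) / h - apply_bcontfun (P t g) x)
        \<le> norm ((P h f - f) /\<^sub>R h - g)" if "0 < h" for h
    proof -
      have "P (h + t) f = P t (P h f)"
        using markov t that by (metis add.commute comp_apply less_imp_le markov_semigroup_def)
      then have "(apply_bcontfun (P (h + t) f) x - apply_bcontfun (P t f) x) / h - apply_bcontfun (P t g) x
          = apply_bcontfun (P t ((P h f - f) /\<^sub>R h - g)) x"
        using linear_P[OF t] by (simp add: linear_diff linear_scale divide_inverse mult.commute)
      then show ?thesis using abs_P_le_norm[OF t] by simp
    qed
    then show "\<forall>\<^sub>F h in at_right 0. norm ((apply_bcontfun (P (h + t) f) x - apply_bcontfun (P t f) x) / h
        - apply_bcontfun (P t g) x) \<le> norm ((P h f - f) /\<^sub>R h - g)"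
      by (auto simp: eventually_at_filter)
  qed
  then show ?thesis
    unfolding has_field_derivative_iff by (subst filterlim_at_right_to_0) simp
qed

lemma generator_graph_diff:
  assumes "(f1, g1) \<in> generator_graph P" "(f2, g2) \<in> generator_graph P"
  shows "(f1 - a *\<^sub>R f2, g1 - a *\<^sub>R g2) \<in> generator_graph P"
proof -
  have "((\<lambda>h. (P h f1 - f1) /\<^sub>R h - a *\<^sub>R ((P h f2 - f2) /\<^sub>R h)) \<longlongrightarrow> g1 - a *\<^sub>R g2) (at_right 0)"
    using assms by (intro tendsto_intros) (auto simp: generator_graph_def)
  moreover have "\<forall>\<^sub>F h in at_right 0. (P h f1 - f1) /\<^sub>R h - a *\<^sub>R ((P h f2 - f2) /\<^sub>R h) =
      (P h (f1 - a *\<^sub>R f2) - (f1 - a *\<^sub>R f2)) /\<^sub>R h"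
    using linear_P
    by (auto simp: eventually_at_filter linear_diff linear_scale algebra_simps)
  ultimately show ?thesis
    unfolding generator_graph_def by (auto elim: Lim_transform_eventually)
qed

text \<open>Comparing f with the constant \<open>f x\<close> shows that its value at x cannot rise
  under the semigroup. Since constants are preserved, the maximum may have either sign.\<close>

lemma positive_maximum_principle:
  assumes fg: "(f, g) \<in> generator_graph P"
    and max: "\<And>y. apply_bcontfun f y \<le> apply_bcontfun f x"
  shows "apply_bcontfun g x \<le> 0"
proof -
  have P0: "P 0 = id" using markov by (simp add: markov_semigroup_def)
  have "((\<lambda>t. apply_bcontfun (P t f) x) has_real_derivative apply_bcontfun g x) (at_right 0)"
    using P_has_right_derivative[OF fg, of 0 x] by (simp add: P0)
  then have "((\<lambda>t. (apply_bcontfun (P t f) x - apply_bcontfun f x) / t) \<longlongrightarrow> apply_bcontfun g x) (at_right 0)"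
    by (simp add: has_field_derivative_iff P0)
  moreover have "apply_bcontfun (P t f) x \<le> apply_bcontfun f x" if "0 < t" for t
    using Q_mono[of t "apply_bcontfun f" "\<lambda>_. apply_bcontfun f x" x] max that
    by (simp add: Q_apply Q_const bcontfun_const apply_bcontfun)
  then have "\<forall>\<^sub>F t in at_right 0. (apply_bcontfun (P t f) x - apply_bcontfun f x) / t \<le> 0"
    by (auto simp: eventually_at_filter divide_le_0_iff)
  ultimately show ?thesis by (rule tendsto_upperbound) simp
qed

end

section \<open>Tightness from a Lyapunov function\<close>

lemma sqrt_tangent:
  fixes a b :: real
  assumes "0 < a" "0 \<le> b"
  shows "sqrt b \<le> sqrt a + (b - a) / (2 * sqrt a)"
proof -
  define q where "q = sqrt a"
  have q: "0 < q" "a = q * q" using assms by (auto simp: q_def)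
  have "2 * (sqrt a * sqrt b) \<le> a + b"
    using arith_geo_mean_sqrt[of a b] assms by (simp add: real_sqrt_mult)
  then have "2 * q * sqrt b \<le> q * q + b"
    unfolding q_def[symmetric] q(2)[symmetric] by (simp only: mult.assoc)
  then have "sqrt b \<le> q + (b - q * q) / (2 * q)"
    using q(1) by (simp add: field_simps)
  then have "sqrt b \<le> q + (b - a) / (2 * q)" unfolding q(2)[symmetric] .
  then show ?thesis unfolding q_def .
qed

locale lyapunov_markov = dunkl_data R Rp k + markov P
  for R Rp :: "(real ^ 'n) set" and k :: "real ^ 'n \<Rightarrow> real"
    and P :: "real \<Rightarrow> ((real ^ 'n) \<Rightarrow>\<^sub>C real) \<Rightarrow> ((real ^ 'n) \<Rightarrow>\<^sub>C real)" +
  fixes b :: "real ^ 'n \<Rightarrow> real ^ 'n" and \<rho> :: "real ^ 'n \<Rightarrow> ennreal" and C1 C2 :: real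
  assumes generates: "generates (dunkl_L Rp k b) P"
    and continuous_\<rho>: "continuous_on UNIV \<rho>"
    and smooth_\<rho>: "smooth_on {x. \<rho> x \<noteq> \<infinity>} (\<lambda>x. enn2real (\<rho> x))"
    and reflection_\<rho>: "\<And>x \<alpha>. \<rho> x \<noteq> \<infinity> \<Longrightarrow> \<alpha> \<in> Rp \<Longrightarrow> k \<alpha> \<noteq> 0 \<Longrightarrow> \<rho> (reflection \<alpha> x) \<noteq> \<infinity>"
    and compact_sublevel: "\<And>M. 0 < M \<Longrightarrow> compact {x. \<rho> x \<le> ennreal M}"
    and C1: "0 < C1" and C2: "0 < C2"
    and L_le: "\<And>x. \<rho> x \<noteq> \<infinity> \<Longrightarrow> dunkl_L Rp k b (\<lambda>y. enn2real (\<rho> y)) x \<le> C1 - C2 * enn2real (\<rho> x)"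
begin

section \<open>Compactly supported test functions built from \<rho>\<close>

abbreviation r :: "real ^ 'n \<Rightarrow> real" where "r x \<equiv> enn2real (\<rho> x)"

abbreviation D :: "(real ^ 'n) set" where "D \<equiv> {x. \<rho> x \<noteq> \<infinity>}"

lemma \<rho>_le_iff: "\<rho> x \<noteq> \<infinity> \<Longrightarrow> 0 \<le> M \<Longrightarrow> \<rho> x \<le> ennreal M \<longleftrightarrow> r x \<le> M"
  by (cases "\<rho> x") auto

lemma open_D: "open D"
proof -
  have "D = \<rho> -` (- {\<infinity>})" by auto
  then show ?thesis by (simp only:) (rule open_vimage[OF _ continuous_\<rho>], rule open_Compl, simp)
qed

text \<open>The constant c is meant to be the eventual value of \<phi>. Subtracting it makes the
  function vanish far out, so extension by 0 to infinite \<rho> is smooth and the support is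
  compact.\<close>

definition cutoff_test :: "(real \<Rightarrow> real) \<Rightarrow> real \<Rightarrow> real ^ 'n \<Rightarrow> real" where
  "cutoff_test \<phi> c x = (if \<rho> x = \<infinity> then 0 else \<phi> (r x) - c)"

lemma open_superlevel: "0 < M \<Longrightarrow> open (- {x. \<rho> x \<le> ennreal M})"
  using compact_imp_closed[OF compact_sublevel] by (simp add: open_Compl)

lemma cutoff_test_eq_0:
  assumes "0 < M" "\<And>s. M \<le> s \<Longrightarrow> \<phi> s = c" "\<not> \<rho> x \<le> ennreal M"
  shows "cutoff_test \<phi> c x = 0"
proof (cases "\<rho> x = \<infinity>")
  case False
  then have "M \<le> r x" using assms(1,3) \<rho>_le_iff[of x M] by simp
  then show ?thesis using assms(2) by (simp add: cutoff_test_def)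
qed (simp add: cutoff_test_def)

text \<open>Two open sets cover the space: D, where the function is a composition with the smooth
  \<open>r\<close>, and the complement of a sublevel set, where it is zero. Points of infinite
  \<rho> belong to the second.\<close>

lemma cutoff_test_smooth:
  assumes smooth: "\<And>n. Ck_on n D (\<lambda>x. \<phi> (r x))"
    and M: "0 < M" "\<And>s. M \<le> s \<Longrightarrow> \<phi> s = c"
  shows "smooth_on UNIV (cutoff_test \<phi> c)"
  unfolding smooth_on_def
proof
  fix n
  let ?V = "- {x. \<rho> x \<le> ennreal M}"
  have "Ck_on n D (\<lambda>x. \<phi> (r x) + (- c))"
    by (rule Ck_on_add[OF open_D smooth Ck_on_const[OF open_D]])
  then have 1: "Ck_on n D (cutoff_test \<phi> c)"
    by (rule Ck_on_cong[OF open_D, rotated]) (simp add: cutoff_test_def)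
  have "Ck_on n ?V (cutoff_test \<phi> c)"
    by (rule Ck_on_cong[OF open_superlevel[OF M(1)] _ Ck_on_const[OF open_superlevel[OF M(1)], of _ 0]])
      (simp add: cutoff_test_eq_0[of M \<phi> c, OF M])
  from Ck_on_Un[OF open_D open_superlevel[OF M(1)] 1 this]
  have "Ck_on n (D \<union> ?V) (cutoff_test \<phi> c)" .
  also have "D \<union> ?V = UNIV" by (auto simp: top_unique)
  finally show "Ck_on n UNIV (cutoff_test \<phi> c)" .
qed

lemma cutoff_test_support:
  assumes M: "0 < M" "\<And>s. M \<le> s \<Longrightarrow> \<phi> s = c"
  shows "{x. cutoff_test \<phi> c x \<noteq> 0} \<subseteq> {x. \<rho> x \<le> ennreal M}"
  using cutoff_test_eq_0[of M \<phi> c, OF M] by blast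

lemma cutoff_test_bcontfun:
  assumes smooth: "\<And>n. Ck_on n D (\<lambda>x. \<phi> (r x))"
    and M: "0 < M" "\<And>s. M \<le> s \<Longrightarrow> \<phi> s = c"
  shows "cutoff_test \<phi> c \<in> bcontfun"
proof -
  have "Ck_on 0 UNIV (cutoff_test \<phi> c)"
    using cutoff_test_smooth[of \<phi> M c, OF assms] unfolding smooth_on_def by blast
  then have cont: "continuous_on UNIV (cutoff_test \<phi> c)" by simp
  have "bounded (cutoff_test \<phi> c ` {x. \<rho> x \<le> ennreal M})"
    by (intro compact_imp_bounded compact_continuous_image continuous_on_subset[OF cont]
        compact_sublevel M(1)) auto
  then have "bounded (insert 0 (cutoff_test \<phi> c ` {x. \<rho> x \<le> ennreal M}))" by simp
  moreover have "range (cutoff_test \<phi> c) \<subseteq> insert 0 (cutoff_test \<phi> c ` {x. \<rho> x \<le> ennreal M})"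
    using cutoff_test_support[of M \<phi> c, OF M] by blast
  ultimately have "bounded (range (cutoff_test \<phi> c))" by (rule bounded_subset)
  with cont show ?thesis by (simp add: bcontfun_def)
qed

text \<open>Compact sublevel sets make the cutoff an admissible test function, which is how the
  classical operator becomes the generator of the semigroup.\<close>

lemma cutoff_test_generator:
  assumes smooth: "\<And>n. Ck_on n D (\<lambda>x. \<phi> (r x))"
    and M: "0 < M" "\<And>s. M \<le> s \<Longrightarrow> \<phi> s = c"
  obtains g where "(Bcontfun (cutoff_test \<phi> c), g) \<in> generator_graph P"
    "\<And>x. apply_bcontfun g x = dunkl_L Rp k b (cutoff_test \<phi> c) x"
proof -
  let ?f = "Bcontfun (cutoff_test \<phi> c)"
  have f: "apply_bcontfun ?f = cutoff_test \<phi> c"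
    using cutoff_test_bcontfun[of \<phi> M c, OF assms] by (rule Bcontfun_inverse)
  have sub: "closure {x. cutoff_test \<phi> c x \<noteq> 0} \<subseteq> {x. \<rho> x \<le> ennreal M}"
    using cutoff_test_support[of M \<phi> c, OF M] compact_imp_closed[OF compact_sublevel[OF M(1)]]
    by (rule closure_minimal)
  have "compact ({x. \<rho> x \<le> ennreal M} \<inter> closure {x. cutoff_test \<phi> c x \<noteq> 0})"
    by (rule compact_Int_closed[OF compact_sublevel[OF M(1)] closed_closure])
  then have "compact (closure {x. cutoff_test \<phi> c x \<noteq> 0})"
    by (simp only: Int_absorb1[OF sub])
  then have "smooth_on UNIV (apply_bcontfun ?f) \<and> compact (closure {x. apply_bcontfun ?f x \<noteq> 0})"
    using cutoff_test_smooth[of \<phi> M c, OF assms] by (simp add: f)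
  then obtain g where "(?f, g) \<in> generator_graph P"
    "\<forall>x. apply_bcontfun g x = dunkl_L Rp k b (apply_bcontfun ?f) x"
    using generates unfolding generates_def by blast
  then show ?thesis using that by (simp add: f)
qed

lemma Ck_on_r: "Ck_on n D r"
  using smooth_\<rho> by (simp add: smooth_on_def)

lemma Ck_on_compose_r: "(\<And>n. Dk_on n UNIV \<phi>) \<Longrightarrow> Ck_on n D (\<lambda>x. \<phi> (r x))"
  using Ck_on_compose[OF open_D _ Ck_on_r, of n UNIV \<phi>] by simp

text \<open>The test function agreeing with \<open>\<rho>\<close> up to a constant near every point that
  \<open>L \<rho> x\<close> looks at.\<close>

lemma local_copy_of_\<rho>:
  assumes x: "\<rho> x \<noteq> \<infinity>"
  obtains M where "M0 \<le> M" "0 < M" "r x < M"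
    "\<And>\<phi> c. (\<And>s. s \<le> M \<Longrightarrow> \<phi> s = s) \<Longrightarrow>
      dunkl_L Rp k b (cutoff_test \<phi> c) x = dunkl_L Rp k b r x"
proof -
  define A where "A y = (\<lambda>\<alpha>. reflection \<alpha> y) ` {\<alpha>\<in>Rp. k \<alpha> \<noteq> 0}" for y
  \<comment> \<open>The finitely many points from which L takes values at x: x, its reflections, and
    their reflections.\<close>
  define F where "F = insert x (A x \<union> (\<Union>y\<in>A x. A y))"
  have "finite F" using finite_Rp by (auto simp: F_def A_def)
  have F: "\<rho> y \<noteq> \<infinity>" if "y \<in> F" for y
    using that x reflection_\<rho> by (auto simp: F_def A_def)
  define M where "M = max M0 0 + 1 + (\<Sum>y\<in>F. r y)"
  have rM: "r y < M" if "y \<in> F" for y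
    using member_le_sum[OF that, of r] \<open>finite F\<close> by (auto simp: M_def)
  have S: "0 \<le> (\<Sum>y\<in>F. r y)" by (intro sum_nonneg) simp
  have M: "0 < M" "M0 \<le> M" using S by (auto simp: M_def)
  define U where "U = {y. \<rho> y < ennreal M}"
  have "open U"
    unfolding U_def using continuous_\<rho> by (intro open_Collect_less continuous_intros)
  have FU: "y \<in> U" if "y \<in> F" for y
    using rM[OF that] F[OF that] M(1) unfolding U_def by (cases "\<rho> y") (auto simp: ennreal_less_iff)
  show ?thesis
  proof (rule that[OF M(2,1) rM])
    show "x \<in> F" by (simp add: F_def)
    fix \<phi> :: "real \<Rightarrow> real" and c assume \<phi>: "\<And>s. s \<le> M \<Longrightarrow> \<phi> s = s"
    show "dunkl_L Rp k b (cutoff_test \<phi> c) x = dunkl_L Rp k b r x"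
    proof (rule dunkl_L_cong[OF finite_Rp \<open>open U\<close>, of _ _ c])
      show "cutoff_test \<phi> c y = r y - c" if "y \<in> U" for y
        using that M(1) \<phi> \<rho>_le_iff[of y M] by (auto simp: U_def cutoff_test_def less_imp_le)
      show "x \<in> reflection_interior Rp k (reflection_interior Rp k U)"
        using FU by (auto simp: reflection_interior_def F_def A_def)
    qed
  qed
qed

text \<open>The chain rule inequality for concave \<open>\<phi>\<close>: the difference of \<open>\<phi> \<circ> \<rho>\<close> and
  \<open>\<phi>' (\<rho> x)\<close> times a test function that equals \<open>\<rho>\<close> near \<open>x\<close> has its maximum at \<open>x\<close>, so
  that no formula for \<open>L\<close> is needed.\<close>

lemma generator_cutoff_le:
  assumes smooth: "\<And>n. Ck_on n D (\<lambda>x. \<phi> (r x))"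
    and M: "0 < M" "\<And>s. M \<le> s \<Longrightarrow> \<phi> s = c"
    and slope: "\<And>s t. 0 \<le> s \<Longrightarrow> 0 \<le> t \<Longrightarrow> \<phi> t \<le> \<phi> s + \<phi>' s * (t - s)"
      "\<And>s. 0 \<le> s \<Longrightarrow> 0 \<le> \<phi>' s"
    and fg: "(Bcontfun (cutoff_test \<phi> c), g) \<in> generator_graph P"
  shows "\<rho> x = \<infinity> \<Longrightarrow> apply_bcontfun g x \<le> 0"
    and "\<rho> x \<noteq> \<infinity> \<Longrightarrow> apply_bcontfun g x \<le> \<phi>' (r x) * (C1 - C2 * r x)"
proof -
  have f: "apply_bcontfun (Bcontfun (cutoff_test \<phi> c)) = cutoff_test \<phi> c"
    using cutoff_test_bcontfun[of \<phi> M c, OF smooth M] by (rule Bcontfun_inverse)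
  {
    assume x: "\<rho> x = \<infinity>"
    \<comment> \<open>At a point of infinite \<rho> the test function is 0, which is its maximum
      once \<phi> never exceeds c. The slope inequality taken at a point beyond both M and s gives
      this.\<close>
    have "\<phi> s \<le> c" if "0 \<le> s" for s
    proof -
      define t where "t = max M s"
      have "\<phi> s \<le> \<phi> t + \<phi>' t * (s - t)" using that M(1) by (intro slope) (auto simp: t_def)
      moreover have "\<phi>' t * (s - t) \<le> 0"
        using that M(1) slope(2)[of t] by (intro mult_nonneg_nonpos) (auto simp: t_def)
      moreover have "\<phi> t = c" by (rule M(2)) (simp add: t_def)
      ultimately show ?thesis by simp
    qed
    then have "cutoff_test \<phi> c y \<le> cutoff_test \<phi> c x" for y
      using x by (simp add: cutoff_test_def)
    then show "apply_bcontfun g x \<le> 0"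
      using positive_maximum_principle[OF fg, of x] by (simp add: f)
  }
  {
    assume x: "\<rho> x \<noteq> \<infinity>"
    obtain M' where M': "M \<le> M'" "0 < M'" "r x < M'"
      and copy: "\<And>\<psi> c. (\<And>s. s \<le> M' \<Longrightarrow> \<psi> s = s) \<Longrightarrow>
        dunkl_L Rp k b (cutoff_test \<psi> c) x = dunkl_L Rp k b r x"
      using local_copy_of_\<rho>[OF x] by blast
    obtain \<psi> where \<psi>: "\<And>n. Dk_on n UNIV \<psi>" "\<And>s. s \<le> M' \<Longrightarrow> \<psi> s = s"
      "\<And>s. 2 * M' \<le> s \<Longrightarrow> \<psi> s = \<psi> (2 * M')" "\<And>s t. s \<le> t \<Longrightarrow> \<psi> s \<le> \<psi> t"
      by (rule smooth_concave_truncation[OF M'(2)]) (rule that)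
    define c' where "c' = \<psi> (2 * M')"
    have M'2: "0 < 2 * M'" using M'(2) by simp
    note \<psi>c = M'2 \<psi>(3)[folded c'_def]
    note \<psi>_smooth = Ck_on_compose_r[OF \<psi>(1)]
    obtain g' where g': "(Bcontfun (cutoff_test \<psi> c'), g') \<in> generator_graph P"
      "\<And>x. apply_bcontfun g' x = dunkl_L Rp k b (cutoff_test \<psi> c') x"
      using cutoff_test_generator[of \<psi> "2 * M'" c', OF \<psi>_smooth \<psi>c] by blast
    have f': "apply_bcontfun (Bcontfun (cutoff_test \<psi> c')) = cutoff_test \<psi> c'"
      using cutoff_test_bcontfun[of \<psi> "2 * M'" c', OF \<psi>_smooth \<psi>c] by (rule Bcontfun_inverse)
    let ?a = "\<phi>' (r x)"
    have a: "0 \<le> ?a" by (rule slope) simp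
    \<comment> \<open>Below \<open>M'\<close> the function \<psi> is the identity and this is the
      tangent inequality. Above, \<phi> has become constant while \<psi> is at least
      \<open>M'\<close>, so the case s = \<open>M'\<close> suffices.\<close>
    have above: "\<phi> s - ?a * \<psi> s \<le> \<phi> (r x) - ?a * r x" if "0 \<le> s" for s
    proof (cases "s \<le> M'")
      case True
      then show ?thesis using slope(1)[of "r x" s] that \<psi>(2)[OF True] by (simp add: algebra_simps)
    next
      case False
      have "?a * M' \<le> ?a * \<psi> s"
        using \<psi>(4)[of M' s] \<psi>(2)[of M'] False a by (intro mult_left_mono) auto
      moreover have "\<phi> s = \<phi> M'" using M(2)[of s] M(2)[of M'] M' False by simp
      ultimately show ?thesis
        using slope(1)[of "r x" M'] M'(2) by (simp add: algebra_simps)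
    qed
    \<comment> \<open>Where \<rho> is infinite both test functions vanish, as at the finite level 2
      \<open>M'\<close>; this instance therefore covers those points.\<close>
    have "c - ?a * c' \<le> \<phi> (r x) - ?a * r x"
      using above[of "2 * M'"] M' M(2)[of "2 * M'"] by (simp add: c'_def)
    then have "cutoff_test \<phi> c y - ?a * cutoff_test \<psi> c' y \<le> cutoff_test \<phi> c x - ?a * cutoff_test \<psi> c' x" for y
      using above[of "r y"] x \<psi>(2)[of "r x"] M'(3) by (simp add: cutoff_test_def algebra_simps)
    then have "apply_bcontfun (g - ?a *\<^sub>R g') x \<le> 0"
      by (intro positive_maximum_principle[OF generator_graph_diff[OF fg g'(1)]]) (simp add: f f')
    then have "apply_bcontfun g x \<le> ?a * dunkl_L Rp k b r x"
      using g'(2)[of x] copy[OF \<psi>(2)] by simp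
    also have "\<dots> \<le> ?a * (C1 - C2 * r x)"
      by (intro mult_left_mono L_le x a)
    finally show "apply_bcontfun g x \<le> \<phi>' (r x) * (C1 - C2 * r x)" .
  }
qed

text \<open>The slope lies between 0 and 1, so dropping the drift leaves a generator value of at
  most C1, hence growth at rate C1. The estimate does not depend on the truncation level.\<close>

lemma truncated_\<rho>_growth:
  assumes M: "0 < M" and t: "0 \<le> t" and x: "\<rho> x \<noteq> \<infinity>"
    and \<phi>: "\<And>n. Dk_on n UNIV \<phi>" "\<And>s. s \<le> M \<Longrightarrow> \<phi> s = s"
      "\<And>s. 2 * M \<le> s \<Longrightarrow> \<phi> s = c" "\<And>s t. \<phi> t \<le> \<phi> s + smooth_step M s * (t - s)"
  shows "Q t (cutoff_test \<phi> c) x + c \<le> r x + C1 * t"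
proof -
  have M2: "0 < 2 * M" using M by simp
  note smooth = Ck_on_compose_r[OF \<phi>(1)]
  let ?f = "Bcontfun (cutoff_test \<phi> c)"
  obtain g where g: "(?f, g) \<in> generator_graph P"
    using cutoff_test_generator[of \<phi> "2 * M" c, OF smooth M2 \<phi>(3)] by blast
  have bc: "cutoff_test \<phi> c \<in> bcontfun"
    by (rule cutoff_test_bcontfun[of \<phi> "2 * M" c, OF smooth M2 \<phi>(3)])
  have gC: "apply_bcontfun g y \<le> C1" for y
  proof (cases "\<rho> y = \<infinity>")
    case True
    then show ?thesis
      using generator_cutoff_le(1)[of \<phi> "2 * M" c "smooth_step M", OF smooth M2 \<phi>(3) \<phi>(4) _ g True]
        smooth_step_bounds[OF M] C1 by force
  next
    case False
    have "apply_bcontfun g y \<le> smooth_step M (r y) * (C1 - C2 * r y)"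
      using generator_cutoff_le(2)[of \<phi> "2 * M" c "smooth_step M", OF smooth M2 \<phi>(3) \<phi>(4) _ g False]
        smooth_step_bounds[OF M] by blast
    also have "\<dots> \<le> smooth_step M (r y) * C1"
      using smooth_step_bounds[OF M, of "r y"] C2 by (intro mult_left_mono) auto
    also have "\<dots> \<le> 1 * C1"
      using smooth_step_bounds[OF M, of "r y"] C1 by (intro mult_right_mono) auto
    finally show ?thesis by simp
  qed
  define w where "w s = apply_bcontfun (P s ?f) x - C1 * s" for s
  have "w t \<le> w 0"
  proof (rule nonincreasing_of_right_derivative[OF t])
    show "continuous_on {0..t} w"
      unfolding w_def by (intro continuous_intros continuous_on_subset[OF continuous_on_P]) auto
    fix s :: real assume s: "0 \<le> s"
    show "(w has_real_derivative apply_bcontfun (P s g) x - C1) (at_right s)"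
      unfolding w_def using P_has_right_derivative[OF g s, of x] by (auto intro!: derivative_eq_intros)
    have "Q s (apply_bcontfun g) x \<le> Q s (\<lambda>_. C1) x"
      by (intro Q_mono s gC bcontfun_const apply_bcontfun)
    then show "apply_bcontfun (P s g) x - C1 \<le> 0" using s by (simp add: Q_apply Q_const)
  qed
  moreover have "apply_bcontfun (P 0 ?f) x = \<phi> (r x) - c"
    using Q_zero[OF bc] x by (simp add: Q_def cutoff_test_def)
  moreover have "\<phi> (r x) \<le> r x"
    using \<phi>(4)[of "r x" M] \<phi>(2)[of M] smooth_step_eq_1[OF M, of M] by simp
  ultimately show ?thesis by (simp add: w_def Q_def)
qed

lemma Ck_on_sqrt_truncation:
  assumes M: "0 < M" and \<phi>: "\<And>n. Dk_on n UNIV \<phi>" "\<And>s. s \<le> M \<Longrightarrow> \<phi> s = s"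
    "\<And>s t. s \<le> t \<Longrightarrow> \<phi> s \<le> \<phi> t"
  shows "Ck_on n D (\<lambda>x. sqrt (1 + \<phi> (r x)))"
proof -
  have \<phi>0: "0 \<le> \<phi> s" if "0 \<le> s" for s using \<phi>(2)[of 0] \<phi>(3)[of 0 s] M that by simp
  have "Ck_on n D (\<lambda>x. 1 + \<phi> (r x))"
    by (rule Ck_on_add[OF open_D Ck_on_const[OF open_D] Ck_on_compose_r[OF \<phi>(1)]])
  then have "Ck_on n D (\<lambda>x. (1 + \<phi> (r x)) powr (1 / 2))"
    by (rule Ck_on_compose[OF open_D Dk_on_powr, of n "\<lambda>x. 1 + \<phi> (r x)"])
      (auto intro!: add_pos_nonneg \<phi>0)
  moreover have "(1 + \<phi> (r x)) powr (1 / 2) = sqrt (1 + \<phi> (r x))" for x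
    by (rule powr_half_sqrt) (intro add_nonneg_nonneg \<phi>0, auto)
  ultimately show ?thesis by simp
qed

text \<open>Below M the drift of sqrt(1 + \<rho>) is at most a constant minus C2/2 times itself.
  Beyond M that restoring term is added artificially and paid for by B times the truncated \<rho>,
  whose average is controlled by \<open>truncated_\<rho>_growth\<close>.\<close>

lemma truncated_sqrt_\<rho>_bound:
  assumes M: "1 \<le> M" and T: "0 \<le> T" and x: "\<rho> x \<noteq> \<infinity>"
    and \<phi>: "\<And>n. Dk_on n UNIV \<phi>" "\<And>s. s \<le> M \<Longrightarrow> \<phi> s = s"
      "\<And>s. 2 * M \<le> s \<Longrightarrow> \<phi> s = c" "\<And>s t. \<phi> t \<le> \<phi> s + smooth_step M s * (t - s)"
      "\<And>s t. s \<le> t \<Longrightarrow> \<phi> s \<le> \<phi> t"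
  shows "Q T (cutoff_test (\<lambda>s. sqrt (1 + \<phi> s)) (sqrt (1 + c))) x + sqrt (1 + c)
    \<le> sqrt (1 + r x) + (C1 + C2) / C2 + (r x + C1 * T) / sqrt M"
proof -
  let ?\<theta> = "\<lambda>s. sqrt (1 + \<phi> s)" and ?d = "sqrt (1 + c)"
  let ?\<theta>' = "\<lambda>s. smooth_step M s / (2 * sqrt (1 + \<phi> s))"
  have M0: "0 < M" and M2: "0 < 2 * M" using M by auto
  have \<phi>0: "0 \<le> \<phi> s" if "0 \<le> s" for s using \<phi>(2)[of 0] \<phi>(5)[of 0 s] M that by simp
  have cM: "M \<le> c" using \<phi>(2)[of M] \<phi>(5)[of M "2 * M"] \<phi>(3)[of "2 * M"] M by simp
  note \<phi>_smooth = Ck_on_compose_r[OF \<phi>(1)]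
  have smooth: "Ck_on n D (\<lambda>x. ?\<theta> (r x))" for n
    by (rule Ck_on_sqrt_truncation[OF M0 \<phi>(1,2,5)])
  have \<theta>c: "?\<theta> s = ?d" if "2 * M \<le> s" for s using \<phi>(3)[OF that] by simp
  have slope: "?\<theta> t \<le> ?\<theta> s + ?\<theta>' s * (t - s)" if "0 \<le> s" "0 \<le> t" for s t
  proof -
    have "?\<theta> t \<le> ?\<theta> s + (\<phi> t - \<phi> s) / (2 * ?\<theta> s)"
      using sqrt_tangent[of "1 + \<phi> s" "1 + \<phi> t"] \<phi>0[OF that(1)] \<phi>0[OF that(2)] by simp
    also have "(\<phi> t - \<phi> s) / (2 * ?\<theta> s) \<le> (smooth_step M s * (t - s)) / (2 * ?\<theta> s)"
      using \<phi>(4)[of t s] \<phi>0[OF that(1)] by (intro divide_right_mono) auto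
    finally show ?thesis by simp
  qed
  have slope0: "0 \<le> ?\<theta>' s" if "0 \<le> s" for s
    using smooth_step_bounds[OF M0, of s] \<phi>0[OF that] by simp
  let ?f = "Bcontfun (cutoff_test ?\<theta> ?d)"
  obtain g where g: "(?f, g) \<in> generator_graph P"
    using cutoff_test_generator[of ?\<theta> "2 * M" ?d, OF smooth M2 \<theta>c] by blast
  have bc1: "cutoff_test \<phi> c \<in> bcontfun"
    by (rule cutoff_test_bcontfun[of \<phi> "2 * M" c, OF \<phi>_smooth M2 \<phi>(3)])
  have bc: "cutoff_test ?\<theta> ?d \<in> bcontfun"
    by (rule cutoff_test_bcontfun[of ?\<theta> "2 * M" ?d, OF smooth M2 \<theta>c])
  \<comment> \<open>A collects C1/2 and the C2/2 lost in replacing \<rho> / sqrt(1 + \<rho>) by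
    sqrt(1 + \<rho>) - 1. Divided by the Gronwall rate C2/2, A and B give the two constants of the
    claim, (C1 + C2)/C2 and 1 / sqrt M.\<close>
  define A B where "A = (C1 + C2) / 2" and "B = C2 / (2 * sqrt M)"
  have AB: "C1 / 2 + C2 / 2 = A" "0 \<le> A" "0 \<le> B"
    using C1 C2 M by (auto simp: A_def B_def add_divide_distrib)
  have big: "C2 / 2 * sqrt (1 + p) \<le> C2 / 2 + B * p" if "M \<le> p" for p
  proof -
    have "sqrt (1 + p) \<le> 1 + sqrt p" using sqrt_add_le_add_sqrt[of 1 p] that M by simp
    also have "sqrt p \<le> p / sqrt M"
    proof -
      have "sqrt M * sqrt p \<le> sqrt p * sqrt p" using that M by (intro mult_right_mono) auto
      then show ?thesis using that M by (simp add: field_simps)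
    qed
    finally have "C2 / 2 * sqrt (1 + p) \<le> C2 / 2 * (1 + p / sqrt M)"
      using C2 by (intro mult_left_mono) auto
    also have "\<dots> = C2 / 2 + B * p" using M by (simp add: B_def field_simps)
    finally show ?thesis .
  qed
  have gle: "apply_bcontfun g y \<le> A - C2 / 2 * (cutoff_test ?\<theta> ?d y + ?d) + B * (cutoff_test \<phi> c y + c)" for y
  proof (cases "\<rho> y = \<infinity>")
    case True
    have "apply_bcontfun g y \<le> 0"
      by (rule generator_cutoff_le(1)[of ?\<theta> "2 * M" ?d ?\<theta>', OF smooth M2 \<theta>c slope slope0 g True])
    moreover have "cutoff_test ?\<theta> ?d y + ?d = ?d" "cutoff_test \<phi> c y + c = c"
      using True by (auto simp: cutoff_test_def)
    ultimately show ?thesis using big[OF cM] C1 AB(1) by simp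
  next
    case False
    have *: "apply_bcontfun g y \<le> ?\<theta>' (r y) * (C1 - C2 * r y)"
      by (rule generator_cutoff_le(2)[of ?\<theta> "2 * M" ?d ?\<theta>', OF smooth M2 \<theta>c slope slope0 g False])
    have root: "1 \<le> sqrt (1 + \<phi> (r y))" using \<phi>0[of "r y"] by simp
    have \<theta>'_le: "?\<theta>' (r y) * C1 \<le> C1 / 2"
    proof -
      have "?\<theta>' (r y) \<le> 1 / (2 * 1)"
        using root smooth_step_bounds[OF M0, of "r y"] by (intro frac_le) auto
      then show ?thesis using mult_right_mono[of "?\<theta>' (r y)" "1 / 2" C1] C1 by simp
    qed
    have eq: "cutoff_test ?\<theta> ?d y + ?d = sqrt (1 + \<phi> (r y))" "cutoff_test \<phi> c y + c = \<phi> (r y)"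
      using False by (auto simp: cutoff_test_def)
    show ?thesis
    proof (cases "r y \<le> M")
      case True
      let ?q = "sqrt (1 + r y)"
      have q: "1 \<le> ?q" "?q * ?q = 1 + r y" by auto
      have "apply_bcontfun g y \<le> C1 / 2 - C2 / 2 * (r y / ?q)"
        using * \<theta>'_le \<phi>(2)[OF True] smooth_step_eq_1[OF M0 True]
        by (simp add: algebra_simps diff_divide_distrib)
      also have "r y / ?q = ?q - 1 / ?q"
      proof -
        have "s / p = p - 1 / p" if "0 < p" "p * p = 1 + s" for p s :: real
          using that by (simp add: field_simps)
        from this[of ?q "r y"] show ?thesis using q by linarith
      qed
      also have "C1 / 2 - C2 / 2 * (?q - 1 / ?q) \<le> C1 / 2 - C2 / 2 * (?q - 1)"
      proof -
        have "1 / ?q \<le> 1 / 1" by (rule frac_le) (use q(1) in linarith)+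
        then show ?thesis using C2 by (intro diff_left_mono mult_left_mono) auto
      qed
      also have "\<dots> = A - C2 / 2 * ?q" by (simp add: A_def field_simps)
      also have "\<dots> \<le> A - C2 / 2 * ?q + B * r y" using AB(3) by simp
      finally show ?thesis unfolding eq using \<phi>(2)[OF True] by simp
    next
      case False
      have "apply_bcontfun g y \<le> C1 / 2"
      proof -
        have "0 \<le> ?\<theta>' (r y) * (C2 * r y)"
          using C2 by (intro mult_nonneg_nonneg slope0) auto
        then show ?thesis
          using * \<theta>'_le right_diff_distrib[of "?\<theta>' (r y)" C1 "C2 * r y"] by linarith
      qed
      moreover have "M \<le> \<phi> (r y)" using \<phi>(5)[of M "r y"] \<phi>(2)[of M] False by simp
      ultimately show ?thesis unfolding eq using big[of "\<phi> (r y)"] AB(1) by linarith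
    qed
  qed
  \<comment> \<open>The time T replaces the running time in the growth bound, so that the
    inhomogeneity is constant as Gronwall requires.\<close>
  let ?A' = "A + B * (r x + C1 * T)"
  define u where "u s = Q s (cutoff_test ?\<theta> ?d) x + ?d" for s
  have "u T \<le> u 0 + ?A' / (C2 / 2)"
  proof (rule gronwall_right_derivative[OF T])
    show "continuous_on {0..T} u" unfolding u_def Q_def
      by (intro continuous_intros continuous_on_subset[OF continuous_on_P]) auto
    show "0 < C2 / 2" using C2 by simp
    show "0 \<le> ?A'" using C1 T AB by (intro add_nonneg_nonneg mult_nonneg_nonneg) auto
    show "0 \<le> u 0" using x \<phi>0[of "r x"] by (simp add: u_def Q_zero[OF bc] cutoff_test_def)
    fix s assume s: "0 \<le> s" "s < T"
    show "(u has_real_derivative apply_bcontfun (P s g) x) (at_right s)"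
      unfolding u_def Q_def using P_has_right_derivative[OF g s(1), of x]
      by (auto intro!: derivative_eq_intros)
    have bcs: "(\<lambda>y. cutoff_test ?\<theta> ?d y + ?d) \<in> bcontfun" "(\<lambda>y. cutoff_test \<phi> c y + c) \<in> bcontfun"
      by (intro bcontfun_add bc bc1 bcontfun_const)+
    have "Q s (apply_bcontfun g) x \<le> Q s (\<lambda>y. A - C2 / 2 * (cutoff_test ?\<theta> ?d y + ?d)
        + B * (cutoff_test \<phi> c y + c)) x"
      by (intro Q_mono s gle apply_bcontfun bcontfun_add[OF bcontfun_diff] bcontfun_const bcontfun_cmult bcs)
    also have "\<dots> = A - C2 / 2 * u s + B * (Q s (cutoff_test \<phi> c) x + c)"
      using s(1) bc bc1 bcs
      by (simp only: Q_add[OF s(1)] Q_diff[OF s(1)] Q_cmult[OF s(1)] Q_const[OF s(1)] u_def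
          bcontfun_add bcontfun_diff bcontfun_cmult bcontfun_const)
    also have "\<dots> \<le> A - C2 / 2 * u s + B * (r x + C1 * T)"
    proof -
      have "Q s (cutoff_test \<phi> c) x + c \<le> r x + C1 * s"
        by (rule truncated_\<rho>_growth[OF M0 s(1) x \<phi>(1-4)])
      also have "\<dots> \<le> r x + C1 * T" using s C1 by simp
      finally show ?thesis using AB(3) by (intro add_left_mono mult_left_mono) auto
    qed
    finally show "apply_bcontfun (P s g) x \<le> ?A' - C2 / 2 * u s" by (simp add: Q_apply)
  qed
  moreover have "u 0 = sqrt (1 + \<phi> (r x))"
    using x by (simp add: u_def Q_zero[OF bc] cutoff_test_def)
  moreover have "\<phi> (r x) \<le> r x"
    using \<phi>(4)[of "r x" M] \<phi>(2)[of M] smooth_step_eq_1[OF M0, of M] by simp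
  then have "sqrt (1 + \<phi> (r x)) \<le> sqrt (1 + r x)" by simp
  moreover have "?A' / (C2 / 2) = (C1 + C2) / C2 + (r x + C1 * T) / sqrt M"
    using C2 M by (simp add: A_def B_def field_simps)
  ultimately have "u T \<le> sqrt (1 + r x) + (C1 + C2) / C2 + (r x + C1 * T) / sqrt M" by linarith
  then show ?thesis unfolding u_def .
qed

text \<open>The semigroup acts on continuous functions only, so h dominates the indicator of the
  complement of S. For fixed t, comparing h with truncations at levels M tending to infinity removes
  the term depending on t, leaving a bound valid at all times.\<close>

lemma uniformly_tight:
  assumes \<delta>: "0 < \<delta>" and B: "0 \<le> B"
  obtains S h where "compact S" "h \<in> bcontfun" "\<And>y. 0 \<le> h y" "\<And>y. y \<notin> S \<Longrightarrow> 1 \<le> h y"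
    "\<And>t x. 0 \<le> t \<Longrightarrow> \<rho> x \<le> ennreal B \<Longrightarrow> Q t h x \<le> \<delta>"
proof -
  define X where "X = sqrt (1 + B) + (C1 + C2) / C2"
  \<comment> \<open>Chosen so that \<open>sqrt (1 + K)\<close> is at least X / \<delta>: a Markov
    inequality with X as the uniform bound for the average of sqrt(1 + \<rho>).\<close>
  define K where "K = (X / \<delta>)\<^sup>2 + 1"
  have X: "0 \<le> X" using B C1 C2 by (simp add: X_def)
  have K: "0 < K" by (simp add: K_def add_nonneg_pos)
  have XK: "X / \<delta> \<le> sqrt (1 + K)" by (rule real_le_rsqrt) (simp add: K_def)
  \<comment> \<open>Taking the minimum before \<open>enn2real\<close> keeps the value finite, hence
    continuous, and prevents infinite \<rho> from being sent to 0.\<close>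
  define m where "m y = enn2real (min (\<rho> y) (ennreal K))" for y
  have m: "0 \<le> m y" "m y \<le> K" for y
    using K by (auto simp: m_def intro!: enn2real_leI)
  have "(m \<longlongrightarrow> m y) (at y)" for y
    unfolding m_def
  proof (rule tendsto_enn2real)
    have "ennreal (enn2real (min (\<rho> y) (ennreal K))) = min (\<rho> y) (ennreal K)"
      by (simp add: min_less_iff_disj)
    moreover have "(\<rho> \<longlongrightarrow> \<rho> y) (at y)"
      using continuous_\<rho> by (simp add: continuous_on_def)
    ultimately show "((\<lambda>y. min (\<rho> y) (ennreal K)) \<longlongrightarrow> ennreal (enn2real (min (\<rho> y) (ennreal K)))) (at y)"
      by (simp only:) (intro tendsto_min tendsto_const)
  qed simp
  then have cont: "continuous_on UNIV m" by (simp add: continuous_on_def)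
  define h where "h y = sqrt (1 + m y) / sqrt (1 + K)" for y
  have h0: "0 \<le> h y" for y using m K by (simp add: h_def)
  have "continuous_on UNIV h" unfolding h_def using cont K by (intro continuous_intros) auto
  then have h: "h \<in> bcontfun"
    by (rule bcontfun_real_I[where B=1]) (use h0 m K in \<open>auto simp: h_def\<close>)
  have h1: "1 \<le> h y" if "y \<notin> {x. \<rho> x \<le> ennreal K}" for y
    using that K by (simp add: h_def m_def min_absorb2)
  have tail: "Q t h x \<le> \<delta>" if t: "0 \<le> t" and x: "\<rho> x \<le> ennreal B" for t x
  proof -
    have fin: "\<rho> x \<noteq> \<infinity>" using x by (auto simp: top_unique)
    have rB: "r x \<le> B" using x \<rho>_le_iff[OF fin B] by simp
    have "sqrt (1 + K) * Q t h x \<le> X"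
    proof (rule field_le_epsilon)
      fix e :: real assume e: "0 < e"
      define Y where "Y = r x + C1 * t"
      have Y: "0 \<le> Y" using t C1 by (simp add: Y_def)
      \<comment> \<open>This level is chosen after t: it makes the error \<open>Y / sqrt M\<close>
        at most e, and lying above K it lets the truncated \<rho> dominate m.\<close>
      define M where "M = max K (max 1 ((Y / e)\<^sup>2))"
      have M: "K \<le> M" "1 \<le> M" by (auto simp: M_def)
      have M0: "0 < M" using M by simp
      have "Y / e \<le> sqrt M" by (rule real_le_rsqrt) (simp add: M_def)
      then have YM: "Y / sqrt M \<le> e" using e M0 by (simp add: field_simps)
      obtain \<phi> where \<phi>: "\<And>n. Dk_on n UNIV \<phi>" "\<And>s. s \<le> M \<Longrightarrow> \<phi> s = s"
        "\<And>s. 2 * M \<le> s \<Longrightarrow> \<phi> s = \<phi> (2 * M)" "\<And>s t. \<phi> t \<le> \<phi> s + smooth_step M s * (t - s)"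
        "\<And>s t. s \<le> t \<Longrightarrow> \<phi> s \<le> \<phi> t"
        by (rule smooth_concave_truncation[OF M0]) (rule that)
      define c where "c = \<phi> (2 * M)"
      let ?w = "cutoff_test (\<lambda>s. sqrt (1 + \<phi> s)) (sqrt (1 + c))"
      note \<phi>c = \<phi>(3)[folded c_def]
      have "K \<le> c" using \<phi>(5)[of K "2 * M"] \<phi>(2)[OF M(1)] M M0 by (simp add: c_def)
      have M2: "0 < 2 * M" using M0 by simp
      have bc: "?w \<in> bcontfun"
      proof (rule cutoff_test_bcontfun[of "\<lambda>s. sqrt (1 + \<phi> s)" "2 * M" "sqrt (1 + c)", OF _ M2])
        show "Ck_on n D (\<lambda>x. sqrt (1 + \<phi> (r x)))" for n
          by (rule Ck_on_sqrt_truncation[OF M0 \<phi>(1,2,5)])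
      qed (simp add: \<phi>c)
      have "sqrt (1 + K) * h y \<le> ?w y + sqrt (1 + c)" for y
      proof -
        have hy: "sqrt (1 + K) * h y = sqrt (1 + m y)" using K by (simp add: h_def)
        show ?thesis
        proof (cases "\<rho> y = \<infinity>")
          case True
          then show ?thesis using hy m(2)[of y] \<open>K \<le> c\<close> by (simp add: cutoff_test_def)
        next
          case False
          have "m y \<le> r y"
            using False by (auto simp: m_def less_top intro!: enn2real_mono)
          then have "m y \<le> \<phi> (r y)"
            using \<phi>(5)[of "m y" "r y"] \<phi>(2)[of "m y"] m(2)[of y] M(1) by simp
          then show ?thesis using hy False by (simp add: cutoff_test_def)
        qed
      qed
      then have "Q t (\<lambda>y. sqrt (1 + K) * h y) x \<le> Q t (\<lambda>y. ?w y + sqrt (1 + c)) x"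
        by (intro Q_mono t bcontfun_cmult h bcontfun_add bc bcontfun_const)
      then have "sqrt (1 + K) * Q t h x \<le> Q t ?w x + sqrt (1 + c)"
        by (simp only: Q_cmult[OF t h] Q_add[OF t bc bcontfun_const] Q_const[OF t])
      also have "\<dots> \<le> sqrt (1 + r x) + (C1 + C2) / C2 + Y / sqrt M"
        unfolding Y_def by (rule truncated_sqrt_\<rho>_bound[OF M(2) t fin \<phi>(1,2) \<phi>c \<phi>(4,5)])
      also have "\<dots> \<le> X + e" using YM rB by (simp add: X_def add_mono)
      finally show "sqrt (1 + K) * Q t h x \<le> X + e" .
    qed
    also have "X \<le> sqrt (1 + K) * \<delta>" using XK \<delta> by (simp add: field_simps)
    finally show ?thesis using K by simp
  qed
  show ?thesis
    by (rule that[OF compact_sublevel[OF K] h h0 h1 tail])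
qed

end

section \<open>Convergence to an invariant measure\<close>

lemma dini_compact:
  fixes h :: "nat \<Rightarrow> 'a::topological_space \<Rightarrow> real"
  assumes S: "compact S" and cont: "\<And>n. continuous_on UNIV (h n)"
    and dec: "\<And>n x. h (Suc n) x \<le> h n x" and lim: "\<And>x. (\<lambda>n. h n x) \<longlonglongrightarrow> 0" and e: "0 < e"
  obtains N where "\<And>n x. N \<le> n \<Longrightarrow> x \<in> S \<Longrightarrow> h n x < e"
proof -
  have dec': "h n x \<le> h m x" if "m \<le> n" for m n x
    using that by (induction rule: dec_induct) (auto intro: order_trans dec)
  have op: "open {x. h n x < e}" for n
    using cont by (intro open_Collect_less continuous_on_const) 
  have cover: "S \<subseteq> (\<Union>n\<in>UNIV. {x. h n x < e})"
  proof
    fix x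
    have "\<forall>\<^sub>F n in sequentially. h n x < e" using order_tendstoD(2)[OF lim e] .
    then show "x \<in> (\<Union>n\<in>UNIV. {x. h n x < e})" by (auto dest: eventually_happens)
  qed
  obtain I where I: "finite I" "S \<subseteq> (\<Union>n\<in>I. {x. h n x < e})"
    by (rule compactE_image[OF S op cover]) (rule that)
  show ?thesis
  proof (rule that[of "Max (insert 0 I)"])
    fix n x assume n: "Max (insert 0 I) \<le> n" and "x \<in> S"
    then obtain m where m: "m \<in> I" "h m x < e" using I by auto
    then have "m \<le> n" using n I(1) by simp
    from dec'[OF this, of x] m(2) show "h n x < e" by simp
  qed
qed

text \<open>Bounded gradients make the symmetrised gradient form bounded, and bounded values make
  the class closed under products, as Stone-Weierstrass requires.\<close>

definition C1_bounded :: "(real ^ 'n \<Rightarrow> real) \<Rightarrow> bool" where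
  "C1_bounded f \<longleftrightarrow> f \<in> bcontfun \<and> Ck_on 1 UNIV f \<and> (\<exists>B. \<forall>x. norm (grad f x) \<le> B)"

lemma C1_boundedI:
  assumes d: "\<And>x. (f has_derivative (\<lambda>v. G x \<bullet> v)) (at x)" and cont: "continuous_on UNIV G"
    and B: "\<And>x. norm (G x) \<le> B" and f: "\<And>x. \<bar>f x\<bar> \<le> B'"
  shows "C1_bounded f"
proof -
  have fd: "frechet_derivative f (at x) = (\<lambda>v. G x \<bullet> v)" for x
    by (rule frechet_derivative_at[symmetric, OF d])
  have gr: "grad f x = G x" for x
    by (simp add: vec_eq_iff grad_def fd inner_axis)
  have "f differentiable (at x)" for x using d by (rule differentiableI)
  then have C1: "Ck_on 1 UNIV f"
    by (auto simp: fd intro!: continuous_intros cont)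
  have "f \<in> bcontfun"
    using C1_continuous_on[OF C1, of UNIV] f by (auto simp: bcontfun_real_iff)
  with C1 B show ?thesis by (auto simp: C1_bounded_def gr)
qed

lemma C1_boundedE:
  assumes "C1_bounded f"
  obtains B B' where "\<And>x. (f has_derivative (\<lambda>v. grad f x \<bullet> v)) (at x)" "continuous_on UNIV (grad f)"
    "continuous_on UNIV f" "\<And>x. norm (grad f x) \<le> B" "\<And>x. \<bar>f x\<bar> \<le> B'"
  using assms has_derivative_grad continuous_on_grad C1_continuous_on
  unfolding C1_bounded_def bcontfun_real_iff by metis

lemma C1_bounded_const: "C1_bounded (\<lambda>_. c)"
  by (rule C1_boundedI[where G="\<lambda>_. 0" and B=0 and B'="\<bar>c\<bar>"]) auto

lemma C1_bounded_add:
  assumes "C1_bounded f" "C1_bounded g"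
  shows "C1_bounded (\<lambda>x. f x + g x)"
proof -
  from assms(1) obtain B1 B1' where f: "\<And>x. (f has_derivative (\<lambda>v. grad f x \<bullet> v)) (at x)"
    "continuous_on UNIV (grad f)" "continuous_on UNIV f" "\<And>x. norm (grad f x) \<le> B1" "\<And>x. \<bar>f x\<bar> \<le> B1'"
    by (rule C1_boundedE) (rule that)
  from assms(2) obtain B2 B2' where g: "\<And>x. (g has_derivative (\<lambda>v. grad g x \<bullet> v)) (at x)"
    "continuous_on UNIV (grad g)" "continuous_on UNIV g" "\<And>x. norm (grad g x) \<le> B2" "\<And>x. \<bar>g x\<bar> \<le> B2'"
    by (rule C1_boundedE) (rule that)
  show ?thesis
  proof (rule C1_boundedI[where G="\<lambda>x. grad f x + grad g x" and B="B1 + B2" and B'="B1' + B2'"])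
    show "((\<lambda>x. f x + g x) has_derivative (\<lambda>v. (grad f x + grad g x) \<bullet> v)) (at x)" for x
      using has_derivative_add[OF f(1) g(1)] by (simp add: inner_add_left)
    show "continuous_on UNIV (\<lambda>x. grad f x + grad g x)" by (intro continuous_intros f g)
    show "norm (grad f x + grad g x) \<le> B1 + B2" for x by (intro norm_triangle_mono f g)
    show "\<bar>f x + g x\<bar> \<le> B1' + B2'" for x using f(5)[of x] g(5)[of x] by simp
  qed
qed

lemma C1_bounded_mult:
  assumes "C1_bounded f" "C1_bounded g"
  shows "C1_bounded (\<lambda>x. f x * g x)"
proof -
  from assms(1) obtain B1 B1' where f: "\<And>x. (f has_derivative (\<lambda>v. grad f x \<bullet> v)) (at x)"
    "continuous_on UNIV (grad f)" "continuous_on UNIV f" "\<And>x. norm (grad f x) \<le> B1" "\<And>x. \<bar>f x\<bar> \<le> B1'"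
    by (rule C1_boundedE) (rule that)
  from assms(2) obtain B2 B2' where g: "\<And>x. (g has_derivative (\<lambda>v. grad g x \<bullet> v)) (at x)"
    "continuous_on UNIV (grad g)" "continuous_on UNIV g" "\<And>x. norm (grad g x) \<le> B2" "\<And>x. \<bar>g x\<bar> \<le> B2'"
    by (rule C1_boundedE) (rule that)
  have pos: "0 \<le> B1'" "0 \<le> B2'"
    using f(5)[of 0] g(5)[of 0] abs_ge_zero[of "f 0"] abs_ge_zero[of "g 0"] by linarith+
  show ?thesis
  proof (rule C1_boundedI[where G="\<lambda>x. f x *\<^sub>R grad g x + g x *\<^sub>R grad f x"
        and B="B1' * B2 + B2' * B1" and B'="B1' * B2'"])
    show "((\<lambda>x. f x * g x) has_derivative (\<lambda>v. (f x *\<^sub>R grad g x + g x *\<^sub>R grad f x) \<bullet> v)) (at x)" for x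
      using has_derivative_mult[OF f(1) g(1)] by (simp add: inner_add_left mult.commute)
    show "continuous_on UNIV (\<lambda>x. f x *\<^sub>R grad g x + g x *\<^sub>R grad f x)" by (intro continuous_intros f g)
    show "norm (f x *\<^sub>R grad g x + g x *\<^sub>R grad f x) \<le> B1' * B2 + B2' * B1" for x
      using f g pos by (intro norm_triangle_mono) (auto intro!: mult_mono)
    show "\<bar>f x * g x\<bar> \<le> B1' * B2'" for x
      unfolding abs_mult using f g pos by (intro mult_mono) auto
  qed
qed

text \<open>Coordinates separate points but are unbounded; the arctangent keeps separation while
  bounding both value and gradient.\<close>

lemma C1_bounded_arctan: "C1_bounded (\<lambda>x::real ^ 'n. arctan (x $ i))"
proof (rule C1_boundedI[where G="\<lambda>x. (1 / (1 + (x $ i)\<^sup>2)) *\<^sub>R axis i 1" and B=1 and B'="pi / 2"])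
  fix x :: "real ^ 'n"
  have nz: "1 + (x $ i)\<^sup>2 \<noteq> 0" for x :: "real ^ 'n"
    using zero_le_power2[of "x $ i"] by linarith
  have lin: "((\<lambda>x::real ^ 'n. x $ i) has_derivative (\<lambda>v. v $ i)) (at x)"
    by (rule bounded_linear_imp_has_derivative[OF bounded_linear_vec_nth])
  have "(arctan has_derivative (\<lambda>s. inverse (1 + (x $ i)\<^sup>2) * s)) (at (x $ i))"
    using DERIV_arctan[of "x $ i"] by (simp add: has_field_derivative_def)
  from has_derivative_compose[OF lin this]
  show "((\<lambda>x::real ^ 'n. arctan (x $ i)) has_derivative
      (\<lambda>v. ((1 / (1 + (x $ i)\<^sup>2)) *\<^sub>R axis i 1) \<bullet> v)) (at x)"
    by (simp add: inner_axis' inverse_eq_divide)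
  show "continuous_on UNIV (\<lambda>x::real ^ 'n. (1 / (1 + (x $ i)\<^sup>2)) *\<^sub>R (axis i 1 :: real ^ 'n))"
    using nz by (intro continuous_intros) auto
  show "norm ((1 / (1 + (x $ i)\<^sup>2)) *\<^sub>R (axis i 1 :: real ^ 'n)) \<le> 1"
    by (simp add: norm_axis_1 divide_le_eq_1 add_pos_nonneg)
  show "\<bar>arctan (x $ i)\<bar> \<le> pi / 2"
    using arctan_bounded[of "x $ i"] by linarith
qed

lemma abs_sin_diff_le: "\<bar>sin a - sin b\<bar> \<le> \<bar>a - b\<bar>" for a b :: real
proof -
  have "\<bar>sin a - sin b\<bar> = 2 * (\<bar>sin ((a - b) / 2)\<bar> * \<bar>cos ((a + b) / 2)\<bar>)"
    by (simp add: sin_diff_sin abs_mult)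
  also have "\<dots> \<le> 2 * (\<bar>(a - b) / 2\<bar> * 1)"
    by (intro mult_left_mono mult_mono abs_sin_x_le_abs_x) auto
  finally show ?thesis by simp
qed

lemma C1_bounded_sin:
  assumes "C1_bounded f"
  shows "C1_bounded (\<lambda>x. c * sin (f x))"
proof -
  from assms obtain B B' where f: "\<And>x. (f has_derivative (\<lambda>v. grad f x \<bullet> v)) (at x)"
    "continuous_on UNIV (grad f)" "continuous_on UNIV f" "\<And>x. norm (grad f x) \<le> B" "\<And>x. \<bar>f x\<bar> \<le> B'"
    by (rule C1_boundedE) (rule that)
  have "0 \<le> B" using order_trans[OF norm_ge_zero f(4)] .
  show ?thesis
  proof (rule C1_boundedI[where G="\<lambda>x. (c * cos (f x)) *\<^sub>R grad f x" and B="\<bar>c\<bar> * B" and B'="\<bar>c\<bar>"])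
    fix x
    have "((\<lambda>s. c * sin s) has_derivative (\<lambda>s. (c * cos (f x)) * s)) (at (f x))"
      by (auto intro!: derivative_eq_intros simp: has_field_derivative_def[symmetric])
    from has_derivative_compose[OF f(1) this]
    show "((\<lambda>x. c * sin (f x)) has_derivative (\<lambda>v. ((c * cos (f x)) *\<^sub>R grad f x) \<bullet> v)) (at x)"
      by simp
    show "continuous_on UNIV (\<lambda>x. (c * cos (f x)) *\<^sub>R grad f x)" by (intro continuous_intros f)
    have "norm ((c * cos (f x)) *\<^sub>R grad f x) = (\<bar>c\<bar> * \<bar>cos (f x)\<bar>) * norm (grad f x)"
      by (simp add: abs_mult)
    also have "\<dots> \<le> (\<bar>c\<bar> * 1) * B"
      using \<open>0 \<le> B\<close> by (intro mult_mono f mult_left_mono) auto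
    finally show "norm ((c * cos (f x)) *\<^sub>R grad f x) \<le> \<bar>c\<bar> * B" by simp
    show "\<bar>c * sin (f x)\<bar> \<le> \<bar>c\<bar>"
      unfolding abs_mult by (rule mult_left_le) auto
  qed
qed

text \<open>Stone-Weierstrass is applied to \<open>arcsin (f / (2 * B))\<close>, so that composing the
  approximant with the sine keeps it bounded off the compact set.\<close>

lemma C1_bounded_approximation:
  assumes S: "compact S" and f: "continuous_on UNIV f" "\<And>x. \<bar>f x\<bar> \<le> B" and B: "0 < B" and e: "0 < e"
  obtains g where "C1_bounded g" "\<And>x. x \<in> S \<Longrightarrow> \<bar>f x - g x\<bar> \<le> e" "\<And>x. \<bar>g x\<bar> \<le> 2 * B"
proof -
  interpret function_ring_on "Collect C1_bounded" S
  proof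
    show "\<exists>f\<in>Collect C1_bounded. f x \<noteq> f y" if "x \<noteq> y" for x y :: "real ^ 'n"
    proof -
      from that obtain i where "x $ i \<noteq> y $ i" by (auto simp: vec_eq_iff)
      then show ?thesis
        by (intro bexI[of _ "\<lambda>x. arctan (x $ i)"]) (auto simp: C1_bounded_arctan arctan_eq_iff)
    qed
    show "continuous_on S f" if "f \<in> Collect C1_bounded" for f
      using that by (auto simp: C1_bounded_def bcontfun_def intro: continuous_on_subset)
  qed (auto simp: S C1_bounded_const C1_bounded_add C1_bounded_mult)
  have y: "- 1 \<le> f x / (2 * B) \<and> f x / (2 * B) \<le> 1" for x
    using f(2)[of x] B by (auto simp: field_simps abs_le_iff)
  have "continuous_on UNIV (\<lambda>x. arcsin (f x / (2 * B)))"
    using y B by (intro continuous_on_arcsin continuous_intros f) auto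
  then have "continuous_on S (\<lambda>x. arcsin (f x / (2 * B)))" by (rule continuous_on_subset) simp
  from Stone_Weierstrass_basic[OF this, of "e / (2 * B)"] obtain G where
    G: "C1_bounded G" "\<And>x. x \<in> S \<Longrightarrow> \<bar>arcsin (f x / (2 * B)) - G x\<bar> < e / (2 * B)"
    using e B by auto
  show ?thesis
  proof (rule that[of "\<lambda>x. (2 * B) * sin (G x)"])
    show "C1_bounded (\<lambda>x. (2 * B) * sin (G x))" by (rule C1_bounded_sin[OF G(1)])
    show "\<bar>(2 * B) * sin (G x)\<bar> \<le> 2 * B" for x
      using B by (simp add: abs_mult mult_left_le)
    fix x assume "x \<in> S"
    have "f x - (2 * B) * sin (G x) = (2 * B) * (sin (arcsin (f x / (2 * B))) - sin (G x))"
      using y[of x] B by (simp add: right_diff_distrib)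
    then have "\<bar>f x - (2 * B) * sin (G x)\<bar> = (2 * B) * \<bar>sin (arcsin (f x / (2 * B))) - sin (G x)\<bar>"
      using B by (simp only: abs_mult abs_numeral abs_of_pos)
    also have "\<dots> \<le> (2 * B) * \<bar>arcsin (f x / (2 * B)) - G x\<bar>"
      using B by (intro mult_left_mono abs_sin_diff_le) auto
    also have "\<dots> \<le> (2 * B) * (e / (2 * B))"
      using B G(2)[OF \<open>x \<in> S\<close>] by (intro mult_left_mono) auto
    finally show "\<bar>f x - (2 * B) * sin (G x)\<bar> \<le> e" using B by simp
  qed
qed

section \<open>Asymptotic constancy of the semigroup\<close>

locale contracting_lyapunov = lyapunov_markov R Rp k P b \<rho> C1 C2
  for R Rp :: "(real ^ 'n) set" and k P b \<rho> C1 C2 +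
  fixes \<eta> :: real
  assumes ex_finite: "\<exists>x. \<rho> x \<noteq> \<infinity>" and \<gamma>: "\<gamma> < 1 / 2" and \<eta>: "\<eta> < 0"
    and gradient_bound: "\<forall>t>0. \<forall>f. Ck_on 1 UNIV (apply_bcontfun f) \<and>
           bounded (range (sym_Gamma R Rp k (apply_bcontfun f))) \<longrightarrow>
           Ck_on 1 UNIV (apply_bcontfun (P t f)) \<and>
           (\<forall>x. sym_Gamma R Rp k (apply_bcontfun (P t f)) x
              \<le> exp (2 * \<eta> * t) *
                apply_bcontfun (P t (Bcontfun (sym_Gamma R Rp k (apply_bcontfun f)))) x)"
begin

lemma lipschitz_decay:
  assumes f: "C1_bounded f"
  obtains C where "0 \<le> C"
    "\<And>t x y. 0 < t \<Longrightarrow> \<bar>Q t f y - Q t f x\<bar> \<le> C * exp (\<eta> * t) * norm (y - x)"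
proof -
  from f obtain B where B: "f \<in> bcontfun" "Ck_on 1 UNIV f" "\<And>x. norm (grad f x) \<le> B"
    by (auto simp: C1_bounded_def)
  let ?S = "sym_Gamma R Rp k f"
  have S: "?S \<in> bcontfun" using B(2,3) by (rule sym_Gamma_bcontfun)
  then obtain A where A: "\<And>x. \<bar>?S x\<bar> \<le> A" by (auto simp: bcontfun_real_iff)
  have A0: "0 \<le> A" using order_trans[OF abs_ge_zero A] .
  have bf: "apply_bcontfun (Bcontfun f) = f" using B(1) by (rule Bcontfun_inverse)
  show ?thesis
  proof (rule that[of "sqrt A / (1 - 2 * \<gamma>)"])
    show "0 \<le> sqrt A / (1 - 2 * \<gamma>)" using A0 \<gamma> by simp
    fix t :: real and x y assume t: "0 < t"
    have "bounded (range ?S)" using S by (simp add: bcontfun_def)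
    \<comment> \<open>The gradient hypothesis supplies the regularity of the evolved function too;
      without it the Frechet derivatives in its gradient carry no information.\<close>
    then have C1: "Ck_on 1 UNIV (Q t f)"
      and \<Gamma>: "sym_Gamma R Rp k (Q t f) z \<le> exp (2 * \<eta> * t) * Q t ?S z" for z
      using gradient_bound t B(2) by (auto simp: Q_def bf simp del: Ck_on.simps One_nat_def
          dest!: spec[of _ t] spec[of _ "Bcontfun f"])
    have "norm (dunkl_gradient Rp k (Q t f) z) \<le> exp (\<eta> * t) * sqrt A" for z
    proof (rule power2_le_imp_le)
      have "Q t ?S z \<le> Q t (\<lambda>_. A) z"
        using t A by (intro Q_mono S bcontfun_const) (auto simp: abs_le_iff)
      then have "Q t ?S z \<le> A" using t by (simp add: Q_const)
      then have "exp (2 * \<eta> * t) * Q t ?S z \<le> exp (2 * \<eta> * t) * A" by (intro mult_left_mono) auto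
      also have "\<dots> = (exp (\<eta> * t) * sqrt A)\<^sup>2"
        using A0 exp_double[of "\<eta> * t"] by (simp add: power_mult_distrib mult.assoc)
      finally show "(norm (dunkl_gradient Rp k (Q t f) z))\<^sup>2 \<le> (exp (\<eta> * t) * sqrt A)\<^sup>2"
        using norm_dunkl_gradient_le_sym_Gamma[of "Q t f" z] \<Gamma>[of z] by linarith
    qed (use A0 in auto)
    then have "norm (grad (Q t f) z) \<le> exp (\<eta> * t) * sqrt A / (1 - 2 * \<gamma>)" for z
      by (rule norm_grad_le[OF C1 \<gamma>])
    from grad_lipschitz[OF C1 this]
    show "\<bar>Q t f y - Q t f x\<bar> \<le> sqrt A / (1 - 2 * \<gamma>) * exp (\<eta> * t) * norm (y - x)"
      by (simp add: mult.commute)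
  qed
qed

text \<open>The difference is the operator at time s applied to \<open>Q t f\<close> minus the
  constant \<open>Q t f y\<close>. On S that function is small by Lipschitz decay, off S it is at
  most 2 N times h, and tightness controls the average of h for every s.\<close>

lemma asymptotically_constant_C1:
  assumes f: "C1_bounded f" and B: "0 \<le> B" and e: "0 < e"
  obtains T where "0 < T" "\<And>s t x y. T \<le> t \<Longrightarrow> 0 \<le> s \<Longrightarrow> \<rho> x \<le> ennreal B \<Longrightarrow> \<rho> y \<le> ennreal B \<Longrightarrow>
    \<bar>Q (s + t) f x - Q t f y\<bar> \<le> e"
proof -
  have fb: "f \<in> bcontfun" using f by (simp add: C1_bounded_def)
  then obtain N' where N': "\<And>x. \<bar>f x\<bar> \<le> N'" by (auto simp: bcontfun_real_iff)
  define N where "N = N' + 1"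
  have N: "0 < N" "\<And>x. \<bar>f x\<bar> \<le> N"
    using N' order_trans[OF abs_ge_zero N'] by (auto simp: N_def intro: order_trans[OF N'])
  obtain C where C: "0 \<le> C"
    "\<And>t x y. 0 < t \<Longrightarrow> \<bar>Q t f y - Q t f x\<bar> \<le> C * exp (\<eta> * t) * norm (y - x)"
    using lipschitz_decay[OF f] by blast
  have "0 < e / (4 * N)" using e N by simp
  then obtain S h where S: "compact S" and h: "h \<in> bcontfun" "\<And>y. 0 \<le> h y" "\<And>y. y \<notin> S \<Longrightarrow> 1 \<le> h y"
    "\<And>t x. 0 \<le> t \<Longrightarrow> \<rho> x \<le> ennreal B \<Longrightarrow> Q t h x \<le> e / (4 * N)"
    using uniformly_tight[OF _ B] by blast
  \<comment> \<open>Compactness is available for positive levels only, and B may be 0; the larger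
    sublevel set still contains y.\<close>
  have "compact {x. \<rho> x \<le> ennreal (B + 1)}" using B by (intro compact_sublevel) auto
  then have "bounded (S \<union> {x. \<rho> x \<le> ennreal (B + 1)})"
    using S by (simp add: compact_imp_bounded)
  then obtain d where d: "0 < d" "\<And>z. z \<in> S \<union> {x. \<rho> x \<le> ennreal (B + 1)} \<Longrightarrow> norm z \<le> d"
    by (auto simp: bounded_pos)
  have "filterlim (\<lambda>t. \<eta> * t) at_bot at_top"
    using \<eta> by (intro filterlim_tendsto_neg_mult_at_bot[OF tendsto_const] filterlim_ident)
  then have "((\<lambda>t. C * exp (\<eta> * t) * (2 * d)) \<longlongrightarrow> C * 0 * (2 * d)) at_top"
    by (intro tendsto_intros filterlim_compose[OF exp_at_bot])
  then have "\<forall>\<^sub>F t in at_top. C * exp (\<eta> * t) * (2 * d) < e / 2"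
    using e by (intro order_tendstoD(2)) auto
  then obtain T' where T': "\<And>t. T' \<le> t \<Longrightarrow> C * exp (\<eta> * t) * (2 * d) < e / 2"
    by (auto simp: eventually_at_top_linorder)
  show ?thesis
  proof (rule that[of "max 1 T'"])
    fix s t :: real and x y
    assume t: "max 1 T' \<le> t" and s: "0 \<le> s" and x: "\<rho> x \<le> ennreal B" and y: "\<rho> y \<le> ennreal B"
    have t0: "0 < t" using t by simp
    have y': "\<rho> y \<le> ennreal (B + 1)" using y by (rule order_trans) (simp add: ennreal_leI)
    let ?c = "Q t f y"
    have fN: "\<bar>Q t f z\<bar> \<le> N" for z
      using abs_Q_le[of t f "\<lambda>_. N" z] t0 fb N by (simp add: bcontfun_const Q_const)
    have *: "\<bar>Q t f z - ?c\<bar> \<le> e / 2 + 2 * N * h z" for z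
    proof (cases "z \<in> S")
      case True
      have "norm (z - y) \<le> 2 * d"
        using d(2)[of z] d(2)[of y] True y' norm_triangle_ineq4[of z y] by simp
      then have "C * exp (\<eta> * t) * norm (z - y) \<le> C * exp (\<eta> * t) * (2 * d)"
        using C(1) by (intro mult_left_mono) auto
      then have "\<bar>Q t f z - ?c\<bar> \<le> e / 2" using C(2)[OF t0, of z y] T'[of t] t by simp
      moreover have "0 \<le> 2 * N * h z" using N(1) h(2) by simp
      ultimately show ?thesis by linarith
    next
      case False
      have "2 * N * 1 \<le> 2 * N * h z" using h(3)[OF False] N(1) by (intro mult_left_mono) auto
      then show ?thesis using fN[of z] fN[of y] e by linarith
    qed
    have "\<bar>Q s (\<lambda>z. Q t f z - ?c) x\<bar> \<le> Q s (\<lambda>z. e / 2 + 2 * N * h z) x"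
      by (intro abs_Q_le s * bcontfun_diff bcontfun_add bcontfun_const bcontfun_cmult h Q_bcontfun)
    also have "Q s (\<lambda>z. e / 2 + 2 * N * h z) x = e / 2 + 2 * N * Q s h x"
      by (simp only: Q_add[OF s bcontfun_const bcontfun_cmult[OF h(1)]] Q_cmult[OF s h(1)] Q_const[OF s])
    also have "\<dots> \<le> e / 2 + 2 * N * (e / (4 * N))"
      using h(4)[OF s x] N(1) by (intro add_left_mono mult_left_mono) auto
    also have "\<dots> = e" using N(1) by (simp add: field_simps)
    also have "Q s (\<lambda>z. Q t f z - ?c) x = Q (s + t) f x - ?c"
      using s t0 by (simp add: Q_diff Q_bcontfun bcontfun_const Q_const Q_semigroup)
    finally show "\<bar>Q (s + t) f x - Q t f y\<bar> \<le> e" .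
  qed simp
qed

lemma asymptotically_constant:
  assumes f: "f \<in> bcontfun" and B: "0 \<le> B" and e: "0 < e"
  obtains T where "0 < T" "\<And>s t x y. T \<le> t \<Longrightarrow> 0 \<le> s \<Longrightarrow> \<rho> x \<le> ennreal B \<Longrightarrow> \<rho> y \<le> ennreal B \<Longrightarrow>
    \<bar>Q (s + t) f x - Q t f y\<bar> \<le> e"
proof -
  from f obtain N' where N': "continuous_on UNIV f" "\<And>x. \<bar>f x\<bar> \<le> N'" by (auto simp: bcontfun_real_iff)
  define N where "N = N' + 1"
  have N: "0 < N" "\<And>x. \<bar>f x\<bar> \<le> N"
    using order_trans[OF abs_ge_zero N'(2)] by (auto simp: N_def intro: order_trans[OF N'(2)])
  \<comment> \<open>Off S the approximation error is at most N + 2 N = 3 N, which then averages to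
    e/6. With e/6 on S this gives e/3 at each of the two times, and the last third is for g.\<close>
  have "0 < e / (18 * N)" using e N by simp
  then obtain S h where S: "compact S" and h: "h \<in> bcontfun" "\<And>y. 0 \<le> h y" "\<And>y. y \<notin> S \<Longrightarrow> 1 \<le> h y"
    "\<And>t x. 0 \<le> t \<Longrightarrow> \<rho> x \<le> ennreal B \<Longrightarrow> Q t h x \<le> e / (18 * N)"
    using uniformly_tight[OF _ B] by blast
  obtain g where g: "C1_bounded g" "\<And>x. x \<in> S \<Longrightarrow> \<bar>f x - g x\<bar> \<le> e / 6" "\<And>x. \<bar>g x\<bar> \<le> 2 * N"
    using C1_bounded_approximation[OF S N'(1) N(2,1), of "e / 6"] e by auto
  have gb: "g \<in> bcontfun" using g(1) by (simp add: C1_bounded_def)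
  have *: "\<bar>f z - g z\<bar> \<le> e / 6 + 3 * N * h z" for z
  proof (cases "z \<in> S")
    case True
    have "0 \<le> 3 * N * h z" using N(1) h(2) by simp
    then show ?thesis using g(2)[OF True] by linarith
  next
    case False
    have "3 * N * 1 \<le> 3 * N * h z" using h(3)[OF False] N(1) by (intro mult_left_mono) auto
    then show ?thesis using N(2)[of z] g(3)[of z] e by linarith
  qed
  have fg: "\<bar>Q t f x - Q t g x\<bar> \<le> e / 3" if t: "0 \<le> t" and x: "\<rho> x \<le> ennreal B" for t x
  proof -
    have "\<bar>Q t (\<lambda>z. f z - g z) x\<bar> \<le> Q t (\<lambda>z. e / 6 + 3 * N * h z) x"
      by (intro abs_Q_le t * bcontfun_diff bcontfun_add bcontfun_const bcontfun_cmult h f gb)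
    also have "Q t (\<lambda>z. e / 6 + 3 * N * h z) x = e / 6 + 3 * N * Q t h x"
      by (simp only: Q_add[OF t bcontfun_const bcontfun_cmult[OF h(1)]] Q_cmult[OF t h(1)] Q_const[OF t])
    also have "\<dots> \<le> e / 6 + 3 * N * (e / (18 * N))"
      using h(4)[OF t x] N(1) by (intro add_left_mono mult_left_mono) auto
    also have "\<dots> = e / 3" using N(1) by (simp add: field_simps)
    finally show ?thesis by (simp add: Q_diff[OF t f gb])
  qed
  obtain T where T: "0 < T" "\<And>s t x y. T \<le> t \<Longrightarrow> 0 \<le> s \<Longrightarrow> \<rho> x \<le> ennreal B \<Longrightarrow> \<rho> y \<le> ennreal B \<Longrightarrow>
    \<bar>Q (s + t) g x - Q t g y\<bar> \<le> e / 3"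
    using asymptotically_constant_C1[OF g(1) B, of "e / 3"] e by auto
  show ?thesis
  proof (rule that[OF T(1)])
    fix s t :: real and x y
    assume *: "T \<le> t" "0 \<le> s" "\<rho> x \<le> ennreal B" "\<rho> y \<le> ennreal B"
    have "0 \<le> s + t" "0 \<le> t" using * T(1) by auto
    then show "\<bar>Q (s + t) f x - Q t f y\<bar> \<le> e"
      using T(2)[OF *] fg[of "s + t" x] fg[of t y] * by linarith
  qed
qed

section \<open>The limit functional and its invariant measure\<close>

definition base_point :: "real ^ 'n" where
  "base_point = (SOME x. \<rho> x \<noteq> \<infinity>)"

definition \<Lambda> :: "(real ^ 'n \<Rightarrow> real) \<Rightarrow> real" where
  "\<Lambda> f = lim (\<lambda>n. Q (real n) f base_point)"

lemma base_point_finite: "\<rho> base_point \<noteq> \<infinity>"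
  unfolding base_point_def using ex_finite by (rule someI_ex)

lemma Q_convergent:
  assumes f: "f \<in> bcontfun" and x: "\<rho> x \<noteq> \<infinity>"
  shows "convergent (\<lambda>n. Q (real n) f x)"
proof (rule real_Cauchy_convergent, rule CauchyI')
  fix e :: real assume e: "0 < e"
  have x': "\<rho> x \<le> ennreal (r x)" using x by (simp add: less_top)
  have e2: "0 < e / 2" using e by simp
  obtain T where T: "0 < T" "\<And>s t y z. T \<le> t \<Longrightarrow> 0 \<le> s \<Longrightarrow> \<rho> y \<le> ennreal (r x) \<Longrightarrow>
      \<rho> z \<le> ennreal (r x) \<Longrightarrow> \<bar>Q (s + t) f y - Q t f z\<bar> \<le> e / 2"
    by (rule asymptotically_constant[OF f enn2real_nonneg e2]) (rule that)
  obtain N where N: "T \<le> real N" using real_arch_simple by blast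
  have "dist (Q (real m) f x) (Q (real n) f x) < e" if "N \<le> m" "m < n" for m n
  proof -
    have "\<bar>Q (real n) f x - Q (real m) f x\<bar> \<le> e / 2"
      using T(2)[of "real m" "real n - real m" x x] N that x' by simp
    then show ?thesis using e unfolding dist_real_def by linarith
  qed
  then show "\<exists>M. \<forall>m\<ge>M. \<forall>n>m. dist (Q (real m) f x) (Q (real n) f x) < e"
    by blast
qed

lemma Q_tendsto_base: "f \<in> bcontfun \<Longrightarrow> (\<lambda>n. Q (real n) f base_point) \<longlonglongrightarrow> \<Lambda> f"
  unfolding \<Lambda>_def using Q_convergent[OF _ base_point_finite] by (simp add: convergent_LIMSEQ_iff)

text \<open>The shift s has two uses: s = 0 gives the same limit at every admissible x, while a
  positive s gives invariance under the semigroup.\<close>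

lemma Q_shift_tendsto:
  assumes f: "f \<in> bcontfun" and x: "\<rho> x \<noteq> \<infinity>" and s: "0 \<le> s"
  shows "(\<lambda>n. Q (s + real n) f x) \<longlonglongrightarrow> \<Lambda> f"
proof -
  define B where "B = max (r x) (r base_point)"
  have B: "0 \<le> B" by (simp add: B_def le_max_iff_disj)
  have x': "\<rho> x \<le> ennreal B" "\<rho> base_point \<le> ennreal B"
    using x base_point_finite \<rho>_le_iff[OF _ B] by (auto simp: B_def)
  have "(\<lambda>n. Q (s + real n) f x - Q (real n) f base_point) \<longlonglongrightarrow> 0"
  proof (rule LIMSEQ_I)
    fix e :: real assume e: "0 < e"
    have e2: "0 < e / 2" using e by simp
    obtain T where T: "0 < T" "\<And>s t y z. T \<le> t \<Longrightarrow> 0 \<le> s \<Longrightarrow> \<rho> y \<le> ennreal B \<Longrightarrow>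
        \<rho> z \<le> ennreal B \<Longrightarrow> \<bar>Q (s + t) f y - Q t f z\<bar> \<le> e / 2"
      by (rule asymptotically_constant[OF f B e2]) (rule that)
    obtain N where N: "T \<le> real N" using real_arch_simple by blast
    have "norm (Q (s + real n) f x - Q (real n) f base_point - 0) < e" if "N \<le> n" for n
    proof -
      have "T \<le> real n" using N that by simp
      from T(2)[OF this s x'] e show ?thesis by simp
    qed
    then show "\<exists>N. \<forall>n\<ge>N. norm (Q (s + real n) f x - Q (real n) f base_point - 0) < e" by blast
  qed
  from tendsto_add[OF this Q_tendsto_base[OF f]] show ?thesis by simp
qed

text \<open>Algebraic properties pass to the limit. For a decreasing sequence, Dini's theorem gives
  uniform smallness on a compact set S, and off S the fixed bound N is absorbed by N u, whose
  average is small at all times.\<close>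

lemma daniell_mean_\<Lambda>: "daniell_mean \<Lambda>"
proof
  note lim = Q_tendsto_base
  show "\<Lambda> (\<lambda>x. f x + g x) = \<Lambda> f + \<Lambda> g" if "f \<in> bcontfun" "g \<in> bcontfun" for f g
    using lim[OF bcontfun_add[OF that]] tendsto_add[OF lim[OF that(1)] lim[OF that(2)]] that
    by (simp add: Q_add LIMSEQ_unique)
  show "\<Lambda> (\<lambda>x. c * f x) = c * \<Lambda> f" if "f \<in> bcontfun" for f c
    using lim[OF bcontfun_cmult[OF that]] tendsto_mult[OF tendsto_const lim[OF that]]
    unfolding Q_cmult[OF of_nat_0_le_iff that] by (rule LIMSEQ_unique)
  show mono: "\<Lambda> f \<le> \<Lambda> g" if "f \<in> bcontfun" "g \<in> bcontfun" "\<And>x. f x \<le> g x" for f g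
    using lim[OF that(1)] lim[OF that(2)] by (rule LIMSEQ_le) (auto intro!: Q_mono that)
  have const: "\<Lambda> (\<lambda>_. c) = c" for c
    using lim[OF bcontfun_const, of c] by (simp add: Q_const LIMSEQ_const_iff)
  show "\<Lambda> (\<lambda>_. 1) = 1" by (rule const)
  fix h :: "nat \<Rightarrow> real ^ 'n \<Rightarrow> real"
  assume h: "\<And>n. h n \<in> bcontfun" and dec: "\<And>n x. h (Suc n) x \<le> h n x"
    and h0: "\<And>x. (\<lambda>n. h n x) \<longlonglongrightarrow> 0"
  have dec': "h n x \<le> h m x" if "m \<le> n" for m n x
    using that by (induction rule: dec_induct) (auto intro: order_trans dec)
  have nonneg: "0 \<le> h n x" for n x
    by (rule LIMSEQ_le_const2[OF h0[of x]]) (use dec' in blast)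
  obtain N' where N': "\<And>x. \<bar>h 0 x\<bar> \<le> N'" using h[of 0] by (auto simp: bcontfun_real_iff)
  define N where "N = N' + 1"
  have N: "0 < N" using order_trans[OF abs_ge_zero N'] by (simp add: N_def add_nonneg_pos)
  have hN: "h n x \<le> N" for n x
    using dec'[of 0 n x] N'[of x] by (simp add: N_def abs_le_iff)
  show "(\<lambda>n. \<Lambda> (h n)) \<longlonglongrightarrow> 0"
  proof (rule LIMSEQ_I)
    fix e :: real assume e: "0 < e"
    then have "0 < e / (4 * N)" using N by simp
    then obtain S u where S: "compact S" and u: "u \<in> bcontfun" "\<And>y. 0 \<le> u y"
      "\<And>y. y \<notin> S \<Longrightarrow> 1 \<le> u y"
      "\<And>t x. 0 \<le> t \<Longrightarrow> \<rho> x \<le> ennreal (r base_point) \<Longrightarrow> Q t u x \<le> e / (4 * N)"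
      using uniformly_tight[OF _ enn2real_nonneg] by blast
    have cont: "continuous_on UNIV (h n)" for n using h[of n] by (simp add: bcontfun_def)
    have e4: "0 < e / 4" using e by simp
    obtain n0 where n0: "\<And>n x. n0 \<le> n \<Longrightarrow> x \<in> S \<Longrightarrow> h n x < e / 4"
      by (rule dini_compact[OF S cont dec h0 e4]) (rule that)
    have "norm (\<Lambda> (h n) - 0) < e" if n: "n0 \<le> n" for n
    proof -
      have le: "h n z \<le> e / 4 + N * u z" for z
      proof (cases "z \<in> S")
        case True
        have "0 \<le> N * u z" using N u(2) by simp
        then show ?thesis using n0[OF n True] by linarith
      next
        case False
        have "N * 1 \<le> N * u z" using u(3)[OF False] N by (intro mult_left_mono) auto
        then show ?thesis using hN[of n z] e by linarith
      qed
      have bp: "\<rho> base_point \<le> ennreal (r base_point)" using base_point_finite by (simp add: less_top)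
      have "Q (real m) (h n) base_point \<le> e / 2" for m
      proof -
        have m: "0 \<le> real m" by simp
        have "Q (real m) (h n) base_point \<le> Q (real m) (\<lambda>z. e / 4 + N * u z) base_point"
          by (intro Q_mono le bcontfun_add bcontfun_const bcontfun_cmult h u) auto
        also have "\<dots> = e / 4 + N * Q (real m) u base_point"
          by (simp only: Q_add[OF m bcontfun_const bcontfun_cmult[OF u(1)]] Q_cmult[OF m u(1)] Q_const[OF m])
        also have "\<dots> \<le> e / 4 + N * (e / (4 * N))"
          using u(4)[OF m bp] N by (intro add_left_mono mult_left_mono) auto
        also have "\<dots> = e / 2" using N by (simp add: field_simps)
        finally show ?thesis .
      qed
      then have "\<Lambda> (h n) \<le> e / 2" by (intro LIMSEQ_le_const2[OF lim[OF h]]) auto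
      moreover have "0 \<le> \<Lambda> (h n)"
        using mono[OF bcontfun_const h, of 0 n] const[of 0] nonneg by simp
      ultimately show ?thesis using e by simp
    qed
    then show "\<exists>n0. \<forall>n\<ge>n0. norm (\<Lambda> (h n) - 0) < e" by blast
  qed
qed

theorem exists_invariant_limit:
  obtains \<nu> :: "(real ^ 'n) measure" where "prob_space \<nu>" "sets \<nu> = sets borel"
    "\<And>f x. \<rho> x \<noteq> \<infinity> \<Longrightarrow>
      (\<lambda>l. apply_bcontfun (P (real l) f) x) \<longlonglongrightarrow> (\<integral>y. apply_bcontfun f y \<partial>\<nu>)"
    "invariant_measure \<nu> P"
proof -
  interpret daniell_mean \<Lambda> by (rule daniell_mean_\<Lambda>)
  have int: "(\<integral>y. apply_bcontfun f y \<partial>riesz_measure) = \<Lambda> (apply_bcontfun f)" for f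
    by (rule integral_riesz_measure[OF apply_bcontfun])
  show ?thesis
  proof (rule that[OF prob_space_riesz_measure sets_riesz_measure])
    show "(\<lambda>l. apply_bcontfun (P (real l) f) x) \<longlonglongrightarrow> (\<integral>y. apply_bcontfun f y \<partial>riesz_measure)"
      if "\<rho> x \<noteq> \<infinity>" for f x
      using Q_shift_tendsto[OF apply_bcontfun that, of 0 f] by (simp add: int Q_apply)
    show "invariant_measure riesz_measure P"
      unfolding invariant_measure_def int
    proof (intro allI impI)
      fix t :: real and f assume t: "0 \<le> t"
      have "(\<lambda>n. Q (real n) (apply_bcontfun (P t f)) base_point) \<longlonglongrightarrow> \<Lambda> (apply_bcontfun (P t f))"
        by (rule Q_tendsto_base[OF apply_bcontfun])
      \<comment> \<open>Running for time t and then n is running for t + n, so the mean of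
        \<open>P t f\<close> is a limit already identified with the mean of f.\<close>
      moreover have "Q (real n) (apply_bcontfun (P t f)) = Q (t + real n) (apply_bcontfun f)" for n
        using Q_semigroup[of "real n" t "apply_bcontfun f"] t by (simp add: Q_apply add.commute)
      ultimately show "\<Lambda> (apply_bcontfun (P t f)) = \<Lambda> (apply_bcontfun f)"
        using Q_shift_tendsto[OF apply_bcontfun base_point_finite t, of f] by (simp add: LIMSEQ_unique)
    qed
  qed
qed

end

theorem theorem3p9:
  fixes R Rp :: "(real ^ 'n) set"
    and k :: "real ^ 'n \<Rightarrow> real"
    and b :: "real ^ 'n \<Rightarrow> real ^ 'n"
    and P :: "real \<Rightarrow> ((real ^ 'n) \<Rightarrow>\<^sub>C real) \<Rightarrow> ((real ^ 'n) \<Rightarrow>\<^sub>C real)"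
    and \<eta> :: real
    and \<rho> :: "real ^ 'n \<Rightarrow> ennreal"
  assumes "root_system R" and "normalised R" and "positive_subsystem R Rp"
    and "multiplicity_function R k"
    and "\<forall>i. Ck_on 1 UNIV (\<lambda>x. b x $ i)"
    and "generates (dunkl_L Rp k b) P"
    and "(\<Sum>\<alpha>\<in>Rp. k \<alpha>) < 1 / 2"
    and "\<eta> < 0"
    and "\<forall>t>0. \<forall>f. Ck_on 1 UNIV (apply_bcontfun f) \<and>
           bounded (range (sym_Gamma R Rp k (apply_bcontfun f))) \<longrightarrow>
           Ck_on 1 UNIV (apply_bcontfun (P t f)) \<and>
           (\<forall>x. sym_Gamma R Rp k (apply_bcontfun (P t f)) x
              \<le> exp (2 * \<eta> * t) *
                apply_bcontfun (P t (Bcontfun (sym_Gamma R Rp k (apply_bcontfun f)))) x)"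
    and "lyapunov_function Rp k b \<rho>"
  shows "\<exists>(\<tau> :: nat \<Rightarrow> real) (\<nu> :: (real ^ 'n) measure).
           (\<forall>l. 0 \<le> \<tau> l) \<and> filterlim \<tau> at_top sequentially \<and>
           prob_space \<nu> \<and> sets \<nu> = sets borel \<and>
           (\<forall>f x. \<rho> x \<noteq> \<infinity> \<longrightarrow>
              (\<lambda>l. apply_bcontfun (P (\<tau> l) f) x) \<longlonglongrightarrow> (\<integral>y. apply_bcontfun f y \<partial>\<nu>)) \<and>
           invariant_measure \<nu> P"
proof -
  from assms(10) obtain C1 C2 where C: "0 < C1" "0 < C2"
    "\<And>x. \<rho> x \<noteq> \<infinity> \<Longrightarrow> dunkl_L Rp k b (\<lambda>y. enn2real (\<rho> y)) x \<le> C1 - C2 * enn2real (\<rho> x)"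
    unfolding lyapunov_function_def by blast
  interpret contracting_lyapunov R Rp k P b \<rho> C1 C2 \<eta>
  proof
    show "markov_semigroup P" using assms(6) by (simp add: generates_def)
  qed (use assms C in \<open>auto simp: lyapunov_function_def simp del: Ck_on.simps One_nat_def\<close>)
  obtain \<nu> :: "(real ^ 'n) measure" where "prob_space \<nu>" "sets \<nu> = sets borel"
    "\<And>f x. \<rho> x \<noteq> \<infinity> \<Longrightarrow>
      (\<lambda>l. apply_bcontfun (P (real l) f) x) \<longlonglongrightarrow> (\<integral>y. apply_bcontfun f y \<partial>\<nu>)"
    "invariant_measure \<nu> P"
    by (rule exists_invariant_limit) (rule that)
  \<comment> \<open>The sequence of times is the inclusion of the natural numbers in the
    reals.\<close>
  then show ?thesis
    by (intro exI[of _ real] exI[of _ \<nu>]) (auto intro: filterlim_real_sequentially)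
qed

end
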